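(* For non-zero $f\in\mathcal{S}(\mathbb{R})$ and $q\in(1,\infty]$ let \[F_q(f)=\frac{\|f\|_q\|\hat f\|_q}{\|f\|_2\|\hat f\|_2}.\] (1) If $1<q<2$ and $1/p+1/q=1$, then $F_q(f)\ge\big[p^{1/p}/q^{1/q}\big]^{1/2}$ for all $f\in\mathcal{S}(\mathbb{R})\setminus\{0\}$. (2) If $2<q\le\infty$, then the image of $F_q:\mathcal{S}(\mathbb{R})\setminus\{0\}\to\mathbb{R}_{>0}$ is all of $\mathbb{R}_{>0}$.
   Context: $\mathcal{S}(\mathbb{R})$ is the space of Schwartz functions on $\mathbb{R}$; $\|\cdot\|_r$ is the $L^r(\mathbb{R})$ norm with respect to Lebesgue measure; the Fourier transform is $\hat f(\xi)=\int_{\mathbb{R}}f(x)e^{-2\pi i x\xi}\,dx$. *)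

theory Defs
  imports "HOL-Analysis.Analysis" "HOL-Probability.Essential_Supremum"
begin

fun rderiv :: "nat \<Rightarrow> (real \<Rightarrow> complex) \<Rightarrow> real \<Rightarrow> complex" where
  "rderiv 0 f = f"
| "rderiv (Suc n) f = (\<lambda>x. vector_derivative (rderiv n f) (at x))"

definition schwartz :: "(real \<Rightarrow> complex) \<Rightarrow> bool" where
  "schwartz f \<longleftrightarrow>
     (\<forall>n x. rderiv n f differentiable (at x)) \<and>
     (\<forall>m n. \<exists>C. \<forall>x. \<bar>x\<bar> ^ m * norm (rderiv n f x) \<le> C)"

definition fourier :: "(real \<Rightarrow> complex) \<Rightarrow> real \<Rightarrow> complex" where
  "fourier f \<xi> = integral\<^sup>L lborel (\<lambda>x. f x * exp (- 2 * complex_of_real pi * \<i> * complex_of_real (x * \<xi>)))"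

definition Lnorm :: "ereal \<Rightarrow> (real \<Rightarrow> complex) \<Rightarrow> real" where
  "Lnorm q f = (if q = \<infinity> then real_of_ereal (esssup lborel (\<lambda>x. ereal (norm (f x))))
               else (integral\<^sup>L lborel (\<lambda>x. norm (f x) powr real_of_ereal q)) powr (1 / real_of_ereal q))"

definition Fq :: "ereal \<Rightarrow> (real \<Rightarrow> complex) \<Rightarrow> real" where
  "Fq q f = (Lnorm q f * Lnorm q (fourier f)) / (Lnorm 2 f * Lnorm 2 (fourier f))"

end

theory Submission
  imports Defs "HOL-Probability.Probability" "HOL-Real_Asymp.Real_Asymp"
begin

text \<open>
  For \<open>1 < q < 2\<close>, Plancherel and Hoelder give \<open>\<parallel>f\<parallel>\<^sub>2\<^sup>2 = \<parallel>fourier f\<parallel>\<^sub>2\<^sup>2 \<le> \<parallel>fourier f\<parallel>\<^sub>p \<parallel>fourier f\<parallel>\<^sub>q\<close>, and the sharp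
  Hausdorff-Young inequality (Babenko, Beckner) replaces \<open>\<parallel>fourier f\<parallel>\<^sub>p\<close> by a
  constant times \<open>\<parallel>f\<parallel>\<^sub>q\<close>. The latter is proved by
  Beckner's method: a two-point inequality for the operator \<open>a + b x \<mapsto> a + \<i> sqrt (q - 1) b x\<close>
  on \<open>{-1, 1}\<close> tensorises by Minkowski's inequality, the central limit theorem turns it into a Gaussian
  hypercontractive inequality for trigonometric polynomials, which is Hausdorff-Young for their products
  with a Gaussian, and these are dense.

  For \<open>q > 2\<close>, chirped Gaussians realise all values up to the value at a Gaussian; the larger values
  come from self-dual sums of a narrow and a wide Gaussian by the intermediate value theorem.
\<close>

section \<open>The two-point inequality\<close>

text \<open>The factor \<open>sqrt (q - 1)\<close> is the extremal one: it is forced by the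
  second-order expansion of the real two-point inequality at b = 0. The imaginary unit is what turns
  the Gaussian limit of the operator, between Gaussian weights, into a rescaled Fourier transform.
  Tensorisation needs q <= p, since Minkowski's inequality is applied with exponent p / q. Only
  products of factors 1 + \<i> t x_k over the signs x_k are tensorised. They depend on the signs
  through their sum alone, so a random walk on the integers replaces the discrete cube, and in the
  limit they become the exponentials \<open>cis (\<theta> * x)\<close>; Hermite expansions never
  enter. The constant in (1) is the reciprocal of the sharp Hausdorff-Young constant. In (2) both
  families contain a multiple of the Gaussian exp(-pi x^2), at t = 0 and at l = 1, so their ranges
  meet at K = \<open>(gauss_norm q / gauss_norm 2)\<^sup>2\<close> and cover (0, K] and [K,
  \<infinity>). Self-duality reduces \<open>Fq\<close> to the square of one quotient of a q-norm by
  a 2-norm, which a narrow peak makes arbitrarily large for q > 2.\<close>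

lemma conjugate_exponent:
  fixes p q :: real
  assumes "1 < q" "q < 2" "1 / p + 1 / q = 1"
  shows "p = q / (q - 1)" "p > 2" "(p - 1) * (q - 1) = 1"
proof -
  have "p \<noteq> 0" using assms by auto
  with assms have *: "q + p = p * q" by (simp add: field_simps)
  then show p: "p = q / (q - 1)" using assms by (simp add: field_simps)
  show "p > 2" unfolding p using assms by (simp add: pos_less_divide_eq)
  show "(p - 1) * (q - 1) = 1" using * by (simp add: algebra_simps)
qed

text \<open>The quadratic coefficient is the Taylor coefficient of the right-hand side at 0. The
  difference of the two sides has derivative \<open>q / 2 * \<psi>\<close>, and
  \<open>\<psi>\<close> increases from the value 0.\<close>

lemma bonami_aux:
  fixes q s :: real
  assumes q: "1 < q" "q < 2" and s: "0 \<le> s" "s \<le> 1"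
  shows "1 + q * (q - 1) / 2 * s\<^sup>2 \<le> ((1 + s) powr q + (1 - s) powr q) / 2"
proof -
  define \<psi> where "\<psi> t = (1 + t) powr (q - 1) - (1 - t) powr (q - 1) - 2 * (q - 1) * t" for t :: real
  have \<psi>: "0 \<le> \<psi> t" if t: "0 \<le> t" "t < 1" for t
  proof -
    have "\<psi> 0 \<le> \<psi> t"
    proof (rule DERIV_nonneg_imp_nondecreasing[OF t(1)])
      fix x assume x: "0 \<le> x" "x \<le> t"
      let ?y = "(q - 1) * (1 + x) powr (q - 2) + (q - 1) * (1 - x) powr (q - 2) - 2 * (q - 1)"
      have d: "(\<psi> has_real_derivative ?y) (at x)"
        unfolding \<psi>_def using x t by (auto intro!: derivative_eq_intros simp: algebra_simps)
      \<comment> \<open>AM-GM gives \<open>u + v\<close> at least 2, because \<open>u * v\<close> is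
        a negative power of 1 - x^2, which is at most 1.\<close>
      define u v where "u = (1 + x) powr (q - 2)" and "v = (1 - x) powr (q - 2)"
      have uv: "u > 0" "v > 0" using x t by (auto simp: u_def v_def)
      have "1 - x\<^sup>2 > 0" using x t by (simp add: abs_square_less_1)
      have "u * v = (1 - x\<^sup>2) powr (q - 2)" unfolding u_def v_def
        using x t by (subst powr_mult[symmetric]) (auto simp: algebra_simps power2_eq_square)
      also have "\<dots> \<ge> 1"
        using \<open>1 - x\<^sup>2 > 0\<close> q powr_mono2'[of "q - 2" "1 - x\<^sup>2" 1] by auto
      finally have "u * v \<ge> 1" .
      then have "(u + v)\<^sup>2 \<ge> 2\<^sup>2"
        using zero_le_power2[of "u - v"] by (simp add: power2_eq_square algebra_simps)
      then have "u + v \<ge> 2" using uv power2_le_imp_le[of 2 "u + v"] by auto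
      then have "(q - 1) * (u + v - 2) \<ge> 0" using q by auto
      then have "?y \<ge> 0" unfolding u_def v_def by (simp add: algebra_simps)
      then show "\<exists>y. (\<psi> has_real_derivative y) (at x) \<and> 0 \<le> y" using d by blast
    qed
    then show ?thesis by (simp add: \<psi>_def)
  qed
  define \<phi> where "\<phi> t = ((1 + t) powr q + (1 - t) powr q) / 2 - q * (q - 1) / 2 * t\<^sup>2" for t :: real
  \<comment> \<open>The sign of \<open>\<psi>\<close> is known only for t < 1, where (1 - t) powr (q
    - 2) is finite. For s = 1 the endpoint is covered by continuity of
    \<open>\<phi>\<close>.\<close>
  have "\<phi> 0 \<le> \<phi> s"
  proof (rule DERIV_nonneg_imp_increasing_open[OF s(1)])
    show "continuous_on {0..s} \<phi>"
      unfolding \<phi>_def using s q by (intro continuous_intros continuous_on_powr') auto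
    fix x assume x: "0 < x" "x < s"
    have "(\<phi> has_real_derivative q / 2 * \<psi> x) (at x)"
      unfolding \<phi>_def \<psi>_def using x s by (auto intro!: derivative_eq_intros simp: field_simps)
    then show "\<exists>y. (\<phi> has_real_derivative y) (at x) \<and> 0 \<le> y"
      using \<psi>[of x] x s q by (intro exI[of _ "q / 2 * \<psi> x"]) auto
  qed
  then show ?thesis by (simp add: \<phi>_def add_divide_distrib)
qed

lemma bonami_unit:
  fixes q s :: real
  assumes q: "1 < q" "q < 2" and s: "\<bar>s\<bar> \<le> 1"
  shows "1 + (q - 1) * s\<^sup>2 \<le> ((\<bar>1 + s\<bar> powr q + \<bar>1 - s\<bar> powr q) / 2) powr (2 / q)"
proof -
  \<comment> \<open>Young's inequality with second factor 1 is Bernoulli's inequality (1 + y) powr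
    (q / 2) <= 1 + (q / 2) y; the factor q / 2 produces exactly the coefficient in
    \<open>bonami_aux\<close>.\<close>
  have "(1 + (q - 1) * s\<^sup>2) powr (q / 2) * 1 powr (1 - q / 2) \<le> q / 2 * (1 + (q - 1) * s\<^sup>2) + (1 - q / 2) * 1"
    by (rule Youngs_inequality_0) (use q in \<open>auto intro: add_pos_nonneg\<close>)
  also have "\<dots> = 1 + q * (q - 1) / 2 * \<bar>s\<bar>\<^sup>2" by (simp add: field_simps)
  also have "\<dots> \<le> ((1 + \<bar>s\<bar>) powr q + (1 - \<bar>s\<bar>) powr q) / 2"
    by (rule bonami_aux) (use assms in auto)
  also have "\<dots> = (\<bar>1 + s\<bar> powr q + \<bar>1 - s\<bar> powr q) / 2"
    using s by (cases "s \<ge> 0") auto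
  finally have "(1 + (q - 1) * s\<^sup>2) powr (q / 2) \<le> (\<bar>1 + s\<bar> powr q + \<bar>1 - s\<bar> powr q) / 2" by simp
  then have "((1 + (q - 1) * s\<^sup>2) powr (q / 2)) powr (2 / q) \<le> ((\<bar>1 + s\<bar> powr q + \<bar>1 - s\<bar> powr q) / 2) powr (2 / q)"
    using q by (intro powr_mono2) auto
  moreover have "0 < 1 + (q - 1) * s\<^sup>2" using q by (intro add_pos_nonneg) auto
  ultimately show ?thesis using q by (simp add: powr_powr)
qed

lemma two_point_scale:
  fixes q a b :: real
  assumes "q > 0" "a \<noteq> 0"
  shows "((\<bar>a + b\<bar> powr q + \<bar>a - b\<bar> powr q) / 2) powr (2 / q)
    = a\<^sup>2 * ((\<bar>1 + b / a\<bar> powr q + \<bar>1 - b / a\<bar> powr q) / 2) powr (2 / q)"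
proof -
  have 1: "\<bar>a + b\<bar> = \<bar>a\<bar> * \<bar>1 + b / a\<bar>" "\<bar>a - b\<bar> = \<bar>a\<bar> * \<bar>1 - b / a\<bar>"
    using assms by (auto simp: abs_mult[symmetric] field_simps)
  have "(\<bar>a + b\<bar> powr q + \<bar>a - b\<bar> powr q) / 2 = \<bar>a\<bar> powr q * ((\<bar>1 + b / a\<bar> powr q + \<bar>1 - b / a\<bar> powr q) / 2)"
    unfolding 1 by (simp add: powr_mult algebra_simps)
  then show ?thesis using assms by (simp only: powr_mult powr_powr) simp
qed

text \<open>For \<open>\<bar>b\<bar> > \<bar>a\<bar>\<close> the right-hand side is symmetric in \<open>a\<close> and \<open>b\<close>, while the left-hand side only grows when they are exchanged.\<close>
lemma bonami_lower:
  fixes q a b :: real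
  assumes q: "1 < q" "q < 2"
  shows "a\<^sup>2 + (q - 1) * b\<^sup>2 \<le> ((\<bar>a + b\<bar> powr q + \<bar>a - b\<bar> powr q) / 2) powr (2 / q)"
proof -
  have main: "a\<^sup>2 + (q - 1) * b\<^sup>2 \<le> ((\<bar>a + b\<bar> powr q + \<bar>a - b\<bar> powr q) / 2) powr (2 / q)"
    if "\<bar>b\<bar> \<le> \<bar>a\<bar>" "a \<noteq> 0" for a b :: real
  proof -
    have "a\<^sup>2 * (1 + (q - 1) * (b / a)\<^sup>2) \<le> a\<^sup>2 * ((\<bar>1 + b / a\<bar> powr q + \<bar>1 - b / a\<bar> powr q) / 2) powr (2 / q)"
      by (intro mult_left_mono bonami_unit) (use q that in auto)
    moreover have "a\<^sup>2 * (1 + (q - 1) * (b / a)\<^sup>2) = a\<^sup>2 + (q - 1) * b\<^sup>2"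
      using that by (simp add: field_simps)
    ultimately show ?thesis using q that by (subst two_point_scale) auto
  qed
  consider "a = 0" "b = 0" | "\<bar>b\<bar> \<le> \<bar>a\<bar>" "a \<noteq> 0" | "\<bar>a\<bar> < \<bar>b\<bar>" by linarith
  then show ?thesis
  proof cases
    case 3
    then have "a\<^sup>2 \<le> b\<^sup>2" by (simp add: abs_le_square_iff[symmetric])
    then have "(2 - q) * (b\<^sup>2 - a\<^sup>2) \<ge> 0" using q by auto
    then have "a\<^sup>2 + (q - 1) * b\<^sup>2 \<le> b\<^sup>2 + (q - 1) * a\<^sup>2" by (simp add: algebra_simps)
    also have "\<dots> \<le> ((\<bar>b + a\<bar> powr q + \<bar>b - a\<bar> powr q) / 2) powr (2 / q)"
      by (rule main) (use 3 in auto)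
    finally show ?thesis by (simp add: add.commute abs_minus_commute)
  qed (use main in auto)
qed

text \<open>The dual of \<open>bonami_lower\<close>, tested on \<open>sgn X \<bar>X\<bar>\<^sup>p\<^sup>-\<^sup>1\<close> for the random variable \<open>X = a \<plusminus> b\<close>.\<close>
lemma bonami_upper:
  fixes p q a b :: real
  assumes q: "1 < q" "q < 2" and pq: "1 / p + 1 / q = 1"
  shows "((\<bar>a + b\<bar> powr p + \<bar>a - b\<bar> powr p) / 2) powr (2 / p) \<le> a\<^sup>2 + b\<^sup>2 / (q - 1)"
proof -
  have p_eq: "p = q / (q - 1)" by (rule conjugate_exponent(1)[OF q pq])
  have p: "p > 1" "(p - 1) * q = p" using q unfolding p_eq by (auto simp: field_simps)
  define x y where "x = a + b" and "y = a - b"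
  define X Y where "X = sgn x * \<bar>x\<bar> powr (p - 1)" and "Y = sgn y * \<bar>y\<bar> powr (p - 1)"
  define N where "N = (\<bar>x\<bar> powr p + \<bar>y\<bar> powr p) / 2"
  have N0: "N \<ge> 0" by (simp add: N_def)
  have pw: "\<bar>u\<bar> * \<bar>u\<bar> powr (p - 1) = \<bar>u\<bar> powr p" for u :: real
    using p by (cases "u = 0") (auto simp: powr_mult_base)
  have pX: "x * X = \<bar>x\<bar> powr p" "y * Y = \<bar>y\<bar> powr p"
    unfolding X_def Y_def using pw[of x] pw[of y]
    by (metis mult.assoc abs_sgn, metis mult.assoc abs_sgn)
  have aX: "\<bar>X\<bar> powr q = \<bar>x\<bar> powr p" "\<bar>Y\<bar> powr q = \<bar>y\<bar> powr p"
    unfolding X_def Y_def using p q by (auto simp: abs_mult abs_sgn_eq powr_powr)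
  define \<alpha> \<beta> where "\<alpha> = (X + Y) / 2" and "\<beta> = (X - Y) / 2"
  \<comment> \<open>The test function is brought to the form \<alpha> + \<beta>, \<alpha> - \<beta>
    to which \<open>bonami_lower\<close> applies; \<open>N\<close> is then the pairing of (a, b)
    with (\<alpha>, \<beta>).\<close>
  have XY: "X = \<alpha> + \<beta>" "Y = \<alpha> - \<beta>" by (auto simp: \<alpha>_def \<beta>_def field_simps)
  have N_eq: "N = a * \<alpha> + b * \<beta>"
  proof -
    have "N = (x * X + y * Y) / 2" by (simp add: N_def pX)
    also have "\<dots> = a * \<alpha> + b * \<beta>" unfolding XY by (simp add: x_def y_def algebra_simps)
    finally show ?thesis .
  qed
  define c where "c = sqrt (q - 1)"
  have c: "c > 0" "c\<^sup>2 = q - 1" using q by (auto simp: c_def)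
  \<comment> \<open>The weight \<open>c\<close> is moved from one factor to the other before
    Cauchy-Schwarz, so that the second factor becomes the left-hand side of
    \<open>bonami_lower\<close>.\<close>
  have "N = a * \<alpha> + (b / c) * (c * \<beta>)" using c N_eq by simp
  moreover have "(x * u + y * v)\<^sup>2 \<le> (x\<^sup>2 + y\<^sup>2) * (u\<^sup>2 + v\<^sup>2)" for x y u v :: real
    using zero_le_power2[of "x * v - y * u"] by (simp add: power2_eq_square algebra_simps)
  ultimately have "N\<^sup>2 \<le> (a\<^sup>2 + (b / c)\<^sup>2) * (\<alpha>\<^sup>2 + (c * \<beta>)\<^sup>2)"
    by metis
  also have "\<dots> = (a\<^sup>2 + b\<^sup>2 / (q - 1)) * (\<alpha>\<^sup>2 + (q - 1) * \<beta>\<^sup>2)"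
    by (simp add: power_mult_distrib power_divide c)
  also have "\<dots> \<le> (a\<^sup>2 + b\<^sup>2 / (q - 1)) * N powr (2 / q)"
    using bonami_lower[OF q, of \<alpha> \<beta>] q aX unfolding XY[symmetric] N_def
    by (intro mult_left_mono) auto
  finally have *: "N\<^sup>2 \<le> (a\<^sup>2 + b\<^sup>2 / (q - 1)) * N powr (2 / q)" .
  have "N powr (2 / p) \<le> a\<^sup>2 + b\<^sup>2 / (q - 1)"
  proof (cases "N = 0")
    case True then show ?thesis using q by auto
  next
    case False
    then have "N > 0" using N0 by auto
    have "N\<^sup>2 = N powr (2 / p) * N powr (2 / q)"
    proof -
      have "2 / p + 2 / q = 2" using pq by (simp add: field_simps)
      then have "N powr (2 / p) * N powr (2 / q) = N powr 2" by (metis powr_add)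
      then show ?thesis using \<open>N > 0\<close> by simp
    qed
    with * have "N powr (2 / p) * N powr (2 / q) \<le> (a\<^sup>2 + b\<^sup>2 / (q - 1)) * N powr (2 / q)" by simp
    then show ?thesis using \<open>N > 0\<close> by simp
  qed
  then show ?thesis by (simp add: N_def x_def y_def)
qed

section \<open>Convexity of powers and Minkowski's inequality on two points\<close>

lemma powr_ge_tangent:
  fixes r x :: real
  assumes "1 \<le> r" "0 \<le> x"
  shows "1 + r * (x - 1) \<le> x powr r"
proof (cases "x = 0")
  case False
  then have "(x powr r) powr (1 / r) * 1 powr (1 - 1 / r) \<le> 1 / r * x powr r + (1 - 1 / r) * 1"
    using assms by (intro Youngs_inequality_0) auto
  then have "r * x \<le> r * (1 / r * x powr r + (1 - 1 / r))"
    using assms False by (intro mult_left_mono) (auto simp: powr_powr)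
  also have "\<dots> = x powr r + r - 1" using assms by (simp add: algebra_simps)
  finally show ?thesis by (simp add: algebra_simps)
qed (use assms in auto)

lemma powr_le_tangent:
  fixes r x :: real
  assumes "0 < r" "r \<le> 1" "0 \<le> x"
  shows "x powr r \<le> 1 + r * (x - 1)"
proof (cases "x = 0")
  case False
  then have "x powr r * 1 powr (1 - r) \<le> r * x + (1 - r) * 1"
    using assms by (intro Youngs_inequality_0) auto
  then show ?thesis by (simp add: algebra_simps)
qed (use assms in auto)

text \<open>Convexity of the r-th power at the points u / m and v / n, proved by adding tangent
  inequalities at their weighted mean. It is the pointwise form of Minkowski's inequality:
  integrated with m and n the r-norms of u and v, it says that the norm of u + v is at most m +
  n.\<close>

lemma powr_add_le_weighted:
  fixes r u v m n :: real
  assumes "1 \<le> r" "0 \<le> u" "0 \<le> v" "0 < m" "0 < n"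
  shows "(u + v) powr r \<le> (m + n) powr r * (m / (m + n) * (u / m) powr r + n / (m + n) * (v / n) powr r)"
proof (cases "u + v = 0")
  case False
  define z where "z = (u + v) / (m + n)"
  have z: "z > 0" using assms False by (auto simp: z_def intro!: divide_pos_pos)
  define l k where "l = m / (m + n)" and "k = n / (m + n)"
  have lk: "l + k = 1" "l * (u / m) + k * (v / n) = z" "l \<ge> 0" "k \<ge> 0"
    using assms by (simp_all add: l_def k_def z_def add_divide_distrib[symmetric])
  have t: "z powr r * (1 + r * (x / z - 1)) \<le> x powr r" if "x \<ge> 0" for x
  proof -
    have "z powr r * (1 + r * (x / z - 1)) \<le> z powr r * (x / z) powr r"
      using assms z that by (intro mult_left_mono powr_ge_tangent) auto
    then show ?thesis using z that by (simp add: powr_divide)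
  qed
  have "l * (z powr r * (1 + r * (u / m / z - 1))) + k * (z powr r * (1 + r * (v / n / z - 1)))
     \<le> l * (u / m) powr r + k * (v / n) powr r"
    using assms lk(3,4) by (intro add_mono mult_left_mono t) auto
  also have "l * (z powr r * (1 + r * (u / m / z - 1))) + k * (z powr r * (1 + r * (v / n / z - 1)))
     = z powr r * (l + k + r * ((l * (u / m) + k * (v / n)) / z - (l + k)))"
    by (simp add: algebra_simps add_divide_distrib)
  also have "\<dots> = z powr r" using z lk by simp
  finally have "(m + n) powr r * z powr r \<le> (m + n) powr r * (l * (u / m) powr r + k * (v / n) powr r)"
    by (intro mult_left_mono) auto
  moreover have "(m + n) powr r * z powr r = (u + v) powr r"
    using assms by (simp add: z_def powr_mult[symmetric])
  ultimately show ?thesis by (simp add: l_def k_def)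
qed (use assms in auto)

text \<open>The concave counterpart of \<open>powr_add_le_weighted\<close>: tangents now lie above
  the graph, which leads to the reverse Minkowski inequality for exponents at most 1.\<close>

lemma powr_add_ge_weighted:
  fixes r u v m n :: real
  assumes "0 < r" "r \<le> 1" "0 \<le> u" "0 \<le> v" "0 < m" "0 < n"
  shows "(m + n) powr r * (m / (m + n) * (u / m) powr r + n / (m + n) * (v / n) powr r) \<le> (u + v) powr r"
proof (cases "u + v = 0")
  case True
  then have "u = 0" "v = 0" using assms by auto
  then show ?thesis by simp
next
  case False
  define z where "z = (u + v) / (m + n)"
  have z: "z > 0" using assms False by (auto simp: z_def intro!: divide_pos_pos)
  define l k where "l = m / (m + n)" and "k = n / (m + n)"
  have lk: "l + k = 1" "l * (u / m) + k * (v / n) = z" "l \<ge> 0" "k \<ge> 0"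
    using assms by (simp_all add: l_def k_def z_def add_divide_distrib[symmetric])
  have t: "x powr r \<le> z powr r * (1 + r * (x / z - 1))" if "x \<ge> 0" for x
  proof -
    have "z powr r * (x / z) powr r \<le> z powr r * (1 + r * (x / z - 1))"
      using assms z that by (intro mult_left_mono powr_le_tangent) auto
    then show ?thesis using z that by (simp add: powr_divide)
  qed
  have "l * (u / m) powr r + k * (v / n) powr r
     \<le> l * (z powr r * (1 + r * (u / m / z - 1))) + k * (z powr r * (1 + r * (v / n / z - 1)))"
    using assms lk(3,4) by (intro add_mono mult_left_mono t) auto
  also have "l * (z powr r * (1 + r * (u / m / z - 1))) + k * (z powr r * (1 + r * (v / n / z - 1)))
     = z powr r * (l + k + r * ((l * (u / m) + k * (v / n)) / z - (l + k)))"
    by (simp add: algebra_simps add_divide_distrib)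
  also have "\<dots> = z powr r" using z lk by simp
  finally have "(m + n) powr r * (l * (u / m) powr r + k * (v / n) powr r) \<le> (m + n) powr r * z powr r"
    by (intro mult_left_mono) auto
  moreover have "(m + n) powr r * z powr r = (u + v) powr r"
    using assms by (simp add: z_def powr_mult[symmetric])
  ultimately show ?thesis by (simp add: l_def k_def)
qed

text \<open>Minkowski's inequality for the uniform measure on two points, with a constant as second
  function. The cases v = 0 and M = 0 are separate because the weights of
  \<open>powr_add_le_weighted\<close> must be positive.\<close>

lemma two_point_shift_le:
  fixes r u1 u2 v :: real
  assumes "1 \<le> r" "0 \<le> u1" "0 \<le> u2" "0 \<le> v"
  shows "(((u1 + v) powr r + (u2 + v) powr r) / 2) powr (1 / r) \<le> ((u1 powr r + u2 powr r) / 2) powr (1 / r) + v"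
proof -
  define S where "S = (u1 powr r + u2 powr r) / 2"
  define M where "M = S powr (1 / r)"
  consider "v = 0" | "M = 0" | "M > 0" "v > 0" using assms by (fastforce simp: M_def)
  then show ?thesis
  proof cases
    case 2
    then have "S = 0" by (simp add: M_def)
    then have "u1 powr r + u2 powr r = 0" by (simp add: S_def)
    then have "u1 = 0" "u2 = 0" by (auto simp: add_nonneg_eq_0_iff)
    then show ?thesis using assms by (auto simp: powr_powr)
  next
    case 3
    have "S \<noteq> 0" "S \<ge> 0" using 3 by (auto simp: M_def S_def)
    then have S: "S = M powr r" "S > 0" using assms by (auto simp: M_def powr_powr)
    have "(u + v) powr r \<le> (M + v) powr r * (M / (M + v) * (u powr r / S) + v / (M + v))" if "u \<ge> 0" for u
      using powr_add_le_weighted[of r u v M v] assms 3 that by (simp add: powr_divide S)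
    from add_mono[OF this[OF assms(2)] this[OF assms(3)]]
    have "(u1 + v) powr r + (u2 + v) powr r \<le> (M + v) powr r * (M / (M + v) * ((u1 powr r + u2 powr r) / S) + 2 * (v / (M + v)))"
      by (simp add: algebra_simps add_divide_distrib)
    also have "(u1 powr r + u2 powr r) / S = 2" using S(2) by (auto simp: S_def field_simps)
    also have "M / (M + v) * 2 + 2 * (v / (M + v)) = 2 * ((M + v) / (M + v))"
      by (simp only: add_divide_distrib) simp
    also have "\<dots> = 2" using 3 by simp
    finally have "((u1 + v) powr r + (u2 + v) powr r) / 2 \<le> (M + v) powr r" by simp
    then have "(((u1 + v) powr r + (u2 + v) powr r) / 2) powr (1 / r) \<le> ((M + v) powr r) powr (1 / r)"
      using assms by (intro powr_mono2) auto
    then show ?thesis using assms 3 by (simp add: powr_powr M_def S_def)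
  qed (use assms in \<open>auto\<close>)
qed

text \<open>Reverse Minkowski for an exponent in (0, 1], again with a constant as second function.
  The complex two-point inequality uses it at exponent q / 2, and its companion at p / 2.\<close>

lemma two_point_shift_ge:
  fixes r u1 u2 v :: real
  assumes "0 < r" "r \<le> 1" "0 \<le> u1" "0 \<le> u2" "0 \<le> v"
  shows "((u1 powr r + u2 powr r) / 2) powr (1 / r) + v \<le> (((u1 + v) powr r + (u2 + v) powr r) / 2) powr (1 / r)"
proof -
  define S where "S = (u1 powr r + u2 powr r) / 2"
  define M where "M = S powr (1 / r)"
  consider "v = 0" | "M = 0" | "M > 0" "v > 0" using assms by (fastforce simp: M_def)
  then show ?thesis
  proof cases
    case 2
    then have "S = 0" by (simp add: M_def)
    then have "u1 powr r + u2 powr r = 0" by (simp add: S_def)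
    then have "u1 = 0" "u2 = 0" by (auto simp: add_nonneg_eq_0_iff)
    then show ?thesis using assms by (auto simp: powr_powr)
  next
    case 3
    have "S \<noteq> 0" "S \<ge> 0" using 3 by (auto simp: M_def S_def)
    then have S: "S = M powr r" "S > 0" using assms by (auto simp: M_def powr_powr)
    have "(M + v) powr r * (M / (M + v) * (u powr r / S) + v / (M + v)) \<le> (u + v) powr r" if "u \<ge> 0" for u
      using powr_add_ge_weighted[of r u v M v] assms 3 that by (simp add: powr_divide S)
    from add_mono[OF this[OF assms(3)] this[OF assms(4)]]
    have "(M + v) powr r * (M / (M + v) * ((u1 powr r + u2 powr r) / S) + 2 * (v / (M + v))) \<le> (u1 + v) powr r + (u2 + v) powr r"
      by (simp add: algebra_simps add_divide_distrib)
    also have "(u1 powr r + u2 powr r) / S = 2" using S(2) by (auto simp: S_def field_simps)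
    also have "M / (M + v) * 2 + 2 * (v / (M + v)) = 2 * ((M + v) / (M + v))"
      by (simp only: add_divide_distrib) simp
    also have "\<dots> = 2" using 3 by simp
    finally have "(M + v) powr r \<le> ((u1 + v) powr r + (u2 + v) powr r) / 2" by simp
    then have "((M + v) powr r) powr (1 / r) \<le> (((u1 + v) powr r + (u2 + v) powr r) / 2) powr (1 / r)"
      using assms by (intro powr_mono2) auto
    then show ?thesis using assms 3 by (simp add: powr_powr M_def S_def)
  qed (use assms in \<open>auto\<close>)
qed

text \<open>After rotating \<open>a\<close> onto the real axis both sides are compared with
  \<open>\<bar>a\<bar>\<^sup>2 + (q - 1) (Re b)\<^sup>2 + (Im b)\<^sup>2\<close>.\<close>
lemma two_point_complex:
  fixes p q :: real and a b :: complex
  assumes q: "1 < q" "q < 2" and pq: "1 / p + 1 / q = 1"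
  defines "w \<equiv> \<i> * complex_of_real (sqrt (q - 1))"
  shows "((cmod (a + w * b) powr p + cmod (a - w * b) powr p) / 2) powr (2 / p)
    \<le> ((cmod (a + b) powr q + cmod (a - b) powr q) / 2) powr (2 / q)"
proof -
  define u where "u = (if a = 0 then 1 else sgn a)"
  have u: "cmod u = 1" "a = u * complex_of_real (cmod a)"
    by (simp_all add: u_def norm_sgn) (simp add: sgn_eq)
  then have "u \<noteq> 0" by auto
  define \<alpha> d c where "\<alpha> = cmod a" and "d = b / u" and "c = sqrt (q - 1)"
  define \<xi> \<eta> where "\<xi> = Re d" and "\<eta> = Im d"
  have b: "b = u * d" using \<open>u \<noteq> 0\<close> by (simp add: d_def)
  have c: "c\<^sup>2 = q - 1" using q by (simp add: c_def)
  have rot: "cmod (a + z * b) = cmod (\<alpha> + z * d)" for z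
  proof -
    have "a = u * complex_of_real \<alpha>" using u(2) by (simp add: \<alpha>_def)
    then have "a + z * b = u * (\<alpha> + z * d)" unfolding b by (simp only:) (simp add: algebra_simps)
    then show ?thesis by (simp add: norm_mult u(1))
  qed
  \<comment> \<open>Passing to squared moduli makes the imaginary part an additive shift and halves
    the exponents: p / 2 >= 1 allows Minkowski, q / 2 <= 1 the reverse inequality.\<close>
  have sq: "cmod z powr s = ((Re z)\<^sup>2 + (Im z)\<^sup>2) powr (s / 2)" for z s
    unfolding cmod_def by (simp add: powr_half_sqrt[symmetric] powr_powr)
  have asq: "(x\<^sup>2) powr (s / 2) = \<bar>x\<bar> powr s" for x s :: real
  proof (cases "x = 0")
    case False
    then have "x\<^sup>2 = \<bar>x\<bar> powr 2" by simp
    then show ?thesis by (simp only: powr_powr) simp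
  qed simp
  have e1: "cmod (a + w * b) powr p = ((\<alpha> - c * \<eta>)\<^sup>2 + (c * \<xi>)\<^sup>2) powr (p / 2)"
    unfolding rot sq by (simp add: w_def c_def \<xi>_def \<eta>_def)
  have e2: "cmod (a - w * b) powr p = ((\<alpha> + c * \<eta>)\<^sup>2 + (c * \<xi>)\<^sup>2) powr (p / 2)"
  proof -
    have "cmod (a - w * b) = cmod (\<alpha> - w * d)" using rot[of "- w"] by simp
    then have "cmod (a - w * b) powr p = cmod (\<alpha> - w * d) powr p" by simp
    also have "\<dots> = ((\<alpha> + c * \<eta>)\<^sup>2 + (c * \<xi>)\<^sup>2) powr (p / 2)"
      unfolding sq by (simp add: w_def c_def \<xi>_def \<eta>_def)
    finally show ?thesis .
  qed
  have e3: "cmod (a + b) powr q = ((\<alpha> + \<xi>)\<^sup>2 + \<eta>\<^sup>2) powr (q / 2)"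
    using rot[of 1] by (simp add: sq \<xi>_def \<eta>_def)
  have e4: "cmod (a - b) powr q = ((\<alpha> - \<xi>)\<^sup>2 + \<eta>\<^sup>2) powr (q / 2)"
    using rot[of "- 1"] by (simp add: sq \<xi>_def \<eta>_def)
  have p: "p \<ge> 2" using conjugate_exponent(2)[OF q pq] by simp
  have "((cmod (a + w * b) powr p + cmod (a - w * b) powr p) / 2) powr (2 / p)
      \<le> ((\<bar>\<alpha> - c * \<eta>\<bar> powr p + \<bar>\<alpha> + c * \<eta>\<bar> powr p) / 2) powr (2 / p) + (c * \<xi>)\<^sup>2"
    unfolding e1 e2 using two_point_shift_le[of "p / 2" "(\<alpha> - c * \<eta>)\<^sup>2" "(\<alpha> + c * \<eta>)\<^sup>2" "(c * \<xi>)\<^sup>2"] p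
    by (simp add: asq)
  \<comment> \<open>Multiplication by \<open>w\<close> rotates \<open>d\<close> by a right angle, so
    its imaginary part lands on the real axis. There the division by q - 1 in
    \<open>bonami_upper\<close> cancels \<open>c\<^sup>2\<close>, while the other component keeps
    its factor q - 1.\<close>
  also have "\<dots> \<le> \<alpha>\<^sup>2 + (c * \<eta>)\<^sup>2 / (q - 1) + (c * \<xi>)\<^sup>2"
    using bonami_upper[OF q pq, of \<alpha> "c * \<eta>"] by (simp add: add.commute)
  also have "\<dots> = \<alpha>\<^sup>2 + (q - 1) * \<xi>\<^sup>2 + \<eta>\<^sup>2"
    using q by (simp add: power_mult_distrib c)
  also have "\<dots> \<le> ((\<bar>\<alpha> + \<xi>\<bar> powr q + \<bar>\<alpha> - \<xi>\<bar> powr q) / 2) powr (2 / q) + \<eta>\<^sup>2"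
    using bonami_lower[OF q, of \<alpha> \<xi>] by simp
  also have "\<dots> \<le> ((cmod (a + b) powr q + cmod (a - b) powr q) / 2) powr (2 / q)"
    unfolding e3 e4 using two_point_shift_ge[of "q / 2" "(\<alpha> + \<xi>)\<^sup>2" "(\<alpha> - \<xi>)\<^sup>2" "\<eta>\<^sup>2"] q
    by (simp add: asq)
  finally show ?thesis .
qed

section \<open>Tensorisation along the random walk\<close>

text \<open>The law of a sum of n independent signs. It stands in for the uniform measure on the
  n-dimensional cube, since all functions to be integrated depend on the signs through their
  sum.\<close>

primrec walk :: "nat \<Rightarrow> int pmf" where
  "walk 0 = return_pmf 0"
| "walk (Suc n) = bind_pmf (walk n) (\<lambda>s. pmf_of_set {s + 1, s - 1})"

lemma finite_set_walk: "finite (set_pmf (walk n))"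
  by (induction n) auto

lemma integrable_walk [simp]: "integrable (measure_pmf (walk n)) (f :: int \<Rightarrow> 'b :: {banach, second_countable_topology})"
  by (rule integrable_measure_pmf_finite[OF finite_set_walk])

lemma expectation_walk_Suc:
  fixes f :: "int \<Rightarrow> 'b :: {banach, second_countable_topology}"
  shows "measure_pmf.expectation (walk (Suc n)) f =
    (1 / 2) *\<^sub>R (measure_pmf.expectation (walk n) (\<lambda>s. f (s + 1)) + measure_pmf.expectation (walk n) (\<lambda>s. f (s - 1)))"
proof -
  have e: "measure_pmf.expectation (pmf_of_set {s + 1, s - 1}) f = (1 / 2) *\<^sub>R (f (s + 1) + f (s - 1))" for s :: int
    by (subst integral_measure_pmf[where A = "{s + 1, s - 1}"]) (auto simp: scaleR_add_right)
  have "measure_pmf.expectation (walk (Suc n)) f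
      = (\<Sum>a\<in>set_pmf (walk n). pmf (walk n) a *\<^sub>R measure_pmf.expectation (pmf_of_set {a + 1, a - 1}) f)"
    unfolding walk.simps by (rule pmf_expectation_bind[OF finite_set_walk]) auto
  also have "\<dots> = measure_pmf.expectation (walk n) (\<lambda>s. (1 / 2) *\<^sub>R (f (s + 1) + f (s - 1)))"
    unfolding e by (rule integral_measure_pmf[symmetric, OF finite_set_walk]) auto
  also have "\<dots> = (1 / 2) *\<^sub>R (measure_pmf.expectation (walk n) (\<lambda>s. f (s + 1)) + measure_pmf.expectation (walk n) (\<lambda>s. f (s - 1)))"
    by simp
  finally show ?thesis .
qed

text \<open>Minkowski's inequality with m and k as bounds for the two r-norms, obtained by
  integrating \<open>powr_add_le_weighted\<close>. That lemma needs positive weights, so both bounds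
  are enlarged by 1 / (i + 1) and i tends to infinity.\<close>

lemma walk_minkowski:
  fixes r m k :: real and u v :: "int \<Rightarrow> real"
  assumes r: "1 \<le> r" and u: "\<And>s. 0 \<le> u s" and v: "\<And>s. 0 \<le> v s" and m: "0 \<le> m" and k: "0 \<le> k"
    and um: "measure_pmf.expectation (walk n) (\<lambda>s. u s powr r) \<le> m powr r"
    and vk: "measure_pmf.expectation (walk n) (\<lambda>s. v s powr r) \<le> k powr r"
  shows "measure_pmf.expectation (walk n) (\<lambda>s. (u s + v s) powr r) \<le> (m + k) powr r"
proof (rule LIMSEQ_le_const)
  show "(\<lambda>i. (m + k + 2 * inverse (real (Suc i))) powr r) \<longlonglongrightarrow> (m + k) powr r"
  proof (rule tendsto_powr2)
    show "(\<lambda>i. m + k + 2 * inverse (real (Suc i))) \<longlonglongrightarrow> m + k"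
      using tendsto_add[OF tendsto_const tendsto_mult[OF tendsto_const LIMSEQ_inverse_real_of_nat], of "m + k" 2] by simp
  qed (use r m k in auto)
  show "\<exists>N. \<forall>i\<ge>N. measure_pmf.expectation (walk n) (\<lambda>s. (u s + v s) powr r) \<le> (m + k + 2 * inverse (real (Suc i))) powr r"
  proof (intro exI allI impI)
    fix i :: nat
    define e m' k' where "e = inverse (real (Suc i))" and "m' = m + e" and "k' = k + e"
    have e: "e > 0" by (simp add: e_def)
    have pos: "m' > 0" "k' > 0" using m k e by (auto simp: m'_def k'_def)
    have u': "measure_pmf.expectation (walk n) (\<lambda>s. (u s / m') powr r) \<le> 1"
    proof -
      have "measure_pmf.expectation (walk n) (\<lambda>s. u s powr r) \<le> m' powr r"
        using um powr_mono2[of r m m'] r m e by (simp add: m'_def)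
      then show ?thesis using pos u by (simp add: powr_divide)
    qed
    have v': "measure_pmf.expectation (walk n) (\<lambda>s. (v s / k') powr r) \<le> 1"
    proof -
      have "measure_pmf.expectation (walk n) (\<lambda>s. v s powr r) \<le> k' powr r"
        using vk powr_mono2[of r k k'] r k e by (simp add: k'_def)
      then show ?thesis using pos v by (simp add: powr_divide)
    qed
    have "measure_pmf.expectation (walk n) (\<lambda>s. (u s + v s) powr r)
      \<le> measure_pmf.expectation (walk n) (\<lambda>s. (m' + k') powr r * (m' / (m' + k') * (u s / m') powr r + k' / (m' + k') * (v s / k') powr r))"
      using r u v pos by (intro integral_mono powr_add_le_weighted) auto
    also have "\<dots> = (m' + k') powr r * (m' / (m' + k') * measure_pmf.expectation (walk n) (\<lambda>s. (u s / m') powr r)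
        + k' / (m' + k') * measure_pmf.expectation (walk n) (\<lambda>s. (v s / k') powr r))"
      by simp
    also have "\<dots> \<le> (m' + k') powr r * (m' / (m' + k') * 1 + k' / (m' + k') * 1)"
      using pos by (intro mult_left_mono add_mono u' v') auto
    also have "m' / (m' + k') * 1 + k' / (m' + k') * 1 = 1"
      using pos by (simp add: add_divide_distrib[symmetric])
    also have "m' + k' = m + k + 2 * inverse (real (Suc i))" by (simp add: m'_def k'_def e_def)
    finally show "measure_pmf.expectation (walk n) (\<lambda>s. (u s + v s) powr r) \<le> (m + k + 2 * inverse (real (Suc i))) powr r"
      by simp
  qed
qed

text \<open>Here \<open>F j n s\<close> is the product \<open>\<Prod>\<^sub>i (1 + t j * x\<^sub>i)\<close> over a sign vector \<open>x\<close> of length \<open>n\<close> and sum \<open>s\<close>,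
  and \<open>G j n s\<close> is its image under the operator replacing each \<open>x\<^sub>i\<close> by \<open>w * x\<^sub>i\<close>.\<close>
lemma walk_hypercontractive:
  fixes p q :: real and F G :: "'j \<Rightarrow> nat \<Rightarrow> int \<Rightarrow> complex" and t \<kappa> :: "'j \<Rightarrow> complex"
  assumes q: "1 < q" "q < 2" and pq: "1 / p + 1 / q = 1"
  defines "w \<equiv> \<i> * complex_of_real (sqrt (q - 1))"
  assumes F0: "\<And>j. j \<in> J \<Longrightarrow> F j 0 0 = 1"
    and F1: "\<And>j n s. j \<in> J \<Longrightarrow> F j (Suc n) (s + 1) = (1 + t j) * F j n s"
    and F2: "\<And>j n s. j \<in> J \<Longrightarrow> F j (Suc n) (s - 1) = (1 - t j) * F j n s"
    and G0: "\<And>j. j \<in> J \<Longrightarrow> G j 0 0 = 1"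
    and G1: "\<And>j n s. j \<in> J \<Longrightarrow> G j (Suc n) (s + 1) = (1 + w * t j) * G j n s"
    and G2: "\<And>j n s. j \<in> J \<Longrightarrow> G j (Suc n) (s - 1) = (1 - w * t j) * G j n s"
  shows "measure_pmf.expectation (walk n) (\<lambda>s. cmod (\<Sum>j\<in>J. \<kappa> j * G j n s) powr p)
    \<le> measure_pmf.expectation (walk n) (\<lambda>s. cmod (\<Sum>j\<in>J. \<kappa> j * F j n s) powr q) powr (p / q)"
\<comment> \<open>Fixing the last sign multiplies the coefficients by \<open>1 + t j\<close> or
  \<open>1 - t j\<close>, so the induction hypothesis is used for two other coefficient families,
  \<open>\<kappa>p\<close> and \<open>\<kappa>m\<close>.\<close>
proof (induction n arbitrary: \<kappa>)
  case 0
  then show ?case using q by (simp add: F0 G0 powr_powr cong: sum.cong)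
next
  case (Suc n)
  have p: "p \<ge> 2" using conjugate_exponent(2)[OF q pq] by simp
  define r where "r = p / q"
  have r: "1 \<le> r" using p q by (simp add: r_def)
  define U V where "U s = (\<Sum>j\<in>J. \<kappa> j * G j n s)" and "V s = (\<Sum>j\<in>J. t j * \<kappa> j * G j n s)" for s
  define \<kappa>p \<kappa>m where "\<kappa>p j = \<kappa> j * (1 + t j)" and "\<kappa>m j = \<kappa> j * (1 - t j)" for j
  have UV: "U s + V s = (\<Sum>j\<in>J. \<kappa>p j * G j n s)" "U s - V s = (\<Sum>j\<in>J. \<kappa>m j * G j n s)" for s
    unfolding U_def V_def \<kappa>p_def \<kappa>m_def
    by (simp_all add: sum.distrib[symmetric] sum_subtractf[symmetric] algebra_simps)
  have wUV: "(\<Sum>j\<in>J. \<kappa> j * G j (Suc n) (s + 1)) = U s + w * V s"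
    "(\<Sum>j\<in>J. \<kappa> j * G j (Suc n) (s - 1)) = U s - w * V s" for s
    unfolding U_def V_def
    by (simp_all only: sum.distrib[symmetric] sum_subtractf[symmetric] sum_distrib_left)
       (auto intro!: sum.cong simp: G1 G2 ring_distribs mult_ac)
  define mp mm where "mp = measure_pmf.expectation (walk n) (\<lambda>s. cmod (\<Sum>j\<in>J. \<kappa>p j * F j n s) powr q) / 2"
    and "mm = measure_pmf.expectation (walk n) (\<lambda>s. cmod (\<Sum>j\<in>J. \<kappa>m j * F j n s) powr q) / 2"
  have half: "(cmod z powr q / 2) powr r = cmod z powr p / 2 powr r" for z
    using q by (simp add: powr_divide powr_powr r_def)
  have "measure_pmf.expectation (walk (Suc n)) (\<lambda>s. cmod (\<Sum>j\<in>J. \<kappa> j * G j (Suc n) s) powr p)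
      = measure_pmf.expectation (walk n) (\<lambda>s. (cmod (U s + w * V s) powr p + cmod (U s - w * V s) powr p) / 2)"
    unfolding expectation_walk_Suc wUV by simp
  \<comment> \<open>For each fixed value of the first n signs' sum, the two-point inequality is
    applied in the last sign.\<close>
  also have "\<dots> \<le> measure_pmf.expectation (walk n) (\<lambda>s. (cmod (U s + V s) powr q / 2 + cmod (U s - V s) powr q / 2) powr r)"
  proof (intro integral_mono)
    fix s
    let ?A = "(cmod (U s + w * V s) powr p + cmod (U s - w * V s) powr p) / 2"
    let ?B = "(cmod (U s + V s) powr q + cmod (U s - V s) powr q) / 2"
    have "?A powr (2 / p) \<le> ?B powr (2 / q)"
      unfolding w_def by (rule two_point_complex[OF q pq])
    then have "(?A powr (2 / p)) powr (p / 2) \<le> (?B powr (2 / q)) powr (p / 2)"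
      using p by (intro powr_mono2) auto
    then show "?A \<le> (cmod (U s + V s) powr q / 2 + cmod (U s - V s) powr q / 2) powr r"
      using p q by (simp add: powr_powr r_def add_divide_distrib)
  qed auto
  \<comment> \<open>The heart of tensorisation: Minkowski with exponent r = p / q bounds the r-norm
    of the sum of the two q-th powers by the sum of their r-norms, and the induction hypothesis
    bounds each of these by a q-th moment of the untransformed function.\<close>
  also have "\<dots> \<le> (mp + mm) powr r"
  proof (rule walk_minkowski[OF r])
    show "measure_pmf.expectation (walk n) (\<lambda>s. (cmod (U s + V s) powr q / 2) powr r) \<le> mp powr r"
      unfolding half UV using Suc[of \<kappa>p] q by (simp add: mp_def powr_divide r_def divide_right_mono)
    show "measure_pmf.expectation (walk n) (\<lambda>s. (cmod (U s - V s) powr q / 2) powr r) \<le> mm powr r"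
      unfolding half UV using Suc[of \<kappa>m] q by (simp add: mm_def powr_divide r_def divide_right_mono)
  qed (auto simp: mp_def mm_def intro!: Bochner_Integration.integral_nonneg)
  also have "mp + mm = measure_pmf.expectation (walk (Suc n)) (\<lambda>s. cmod (\<Sum>j\<in>J. \<kappa> j * F j (Suc n) s) powr q)"
    unfolding expectation_walk_Suc mp_def mm_def \<kappa>p_def \<kappa>m_def
    by (simp add: F1 F2 mult.assoc add_divide_distrib cong: sum.cong)
  finally show ?case by (simp add: r_def)
qed

section \<open>The Gaussian limit\<close>

lemma expectation_walk_iexp:
  "measure_pmf.expectation (walk n) (\<lambda>s. exp (\<i> * complex_of_real (\<tau> * real_of_int s))) = complex_of_real (cos \<tau> ^ n)"
proof (induction n)
  case (Suc n)
  have e: "exp (\<i> * complex_of_real (\<tau> * real_of_int (s + 1))) = exp (\<i> * \<tau>) * exp (\<i> * complex_of_real (\<tau> * real_of_int s))"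
    "exp (\<i> * complex_of_real (\<tau> * real_of_int (s - 1))) = exp (- (\<i> * \<tau>)) * exp (\<i> * complex_of_real (\<tau> * real_of_int s))" for s
    by (simp_all add: exp_add[symmetric] algebra_simps)
  have "(exp (\<i> * \<tau>) + exp (- (\<i> * \<tau>))) / 2 = complex_of_real (cos \<tau>)"
    by (simp add: cos_of_real[symmetric] cos_exp_eq)
  then show ?case
    unfolding expectation_walk_Suc e using Suc
    by (simp add: distrib_right[symmetric] scaleR_conv_of_real)
qed simp

definition scaled_walk :: "nat \<Rightarrow> real measure" where
  "scaled_walk n = distr (measure_pmf (walk n)) borel (\<lambda>s. real_of_int s / sqrt (real n))"

lemma real_distribution_scaled_walk: "real_distribution (scaled_walk n)"
  unfolding scaled_walk_def
  by (intro prob_space.real_distribution_distr measure_pmf.prob_space_axioms) auto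

text \<open>The central limit theorem for signs, by Levy's continuity theorem: the characteristic
  function at t is the n-th power of cos (t / sqrt n).\<close>

lemma weak_conv_scaled_walk: "weak_conv_m scaled_walk std_normal_distribution"
proof (rule levy_continuity[OF real_distribution_scaled_walk real_dist_normal_dist])
  fix t :: real
  have "char (scaled_walk n) t = complex_of_real (cos (t / sqrt (real n)) ^ n)" for n
    unfolding char_def scaled_walk_def
    by (subst integral_distr) (use expectation_walk_iexp[of n "t / sqrt (real n)"] in \<open>simp_all add: algebra_simps\<close>)
  moreover have "(\<lambda>n. cos (t / sqrt (real n)) ^ n) \<longlonglongrightarrow> exp (- t\<^sup>2 / 2)"
  proof -
    \<comment> \<open>The limit is taken with a real exponent; \<open>powr\<close> agrees with the
      natural power as soon as the cosine is positive, which holds eventually.\<close>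
    have "((\<lambda>x. cos (t / sqrt x) powr x) \<longlongrightarrow> exp (- t\<^sup>2 / 2)) at_top"
      by (real_asymp simp: power2_eq_square)
    then have "(\<lambda>n. cos (t / sqrt (real n)) powr real n) \<longlonglongrightarrow> exp (- t\<^sup>2 / 2)"
      by (rule filterlim_compose[OF _ filterlim_real_sequentially])
    moreover have "eventually (\<lambda>x. cos (t / sqrt x) > 0) at_top" by real_asymp
    then have "eventually (\<lambda>n. cos (t / sqrt (real n)) > 0) sequentially"
      using filterlim_real_sequentially by (rule eventually_compose_filterlim)
    then have "eventually (\<lambda>n. cos (t / sqrt (real n)) powr real n = cos (t / sqrt (real n)) ^ n) sequentially"
      by eventually_elim (simp add: powr_realpow)
    ultimately show ?thesis by (rule Lim_transform_eventually)
  qed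
  ultimately show "(\<lambda>n. char (scaled_walk n) t) \<longlonglongrightarrow> char std_normal_distribution t"
    unfolding char_std_normal_distribution by (simp only: tendsto_of_real)
qed

text \<open>The polar form of 1 + \<i> x. It turns a product of factors 1 + \<i> x and 1 - \<i> x
  into a power of the modulus times \<open>cis\<close> of \<open>arctan x\<close> times the sum of
  the signs.\<close>

lemma cis_arctan: "complex_of_real (sqrt (1 + x\<^sup>2)) * cis (arctan x) = 1 + \<i> * x"
proof -
  have "sqrt (1 + x\<^sup>2) \<noteq> 0" by (simp add: add_nonneg_eq_0_iff)
  then show ?thesis by (auto simp: complex_eq_iff cos_arctan sin_arctan)
qed

text \<open>The real analogue of \<open>cis_arctan\<close>, for the factors 1 + x and 1 - x that
  appear once the operator has been applied.\<close>

lemma exp_artanh: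
  fixes x :: real
  assumes "\<bar>x\<bar> < 1"
  shows "sqrt (1 - x\<^sup>2) * exp (artanh x) = 1 + x"
proof -
  have "exp (artanh x) = sqrt ((1 + x) / (1 - x))"
    using assms by (simp add: artanh_def ln_sqrt[symmetric])
  moreover have "1 - x\<^sup>2 = (1 + x) * (1 - x)" by (simp add: power2_eq_square algebra_simps)
  ultimately show ?thesis using assms by (simp add: real_sqrt_mult real_sqrt_divide)
qed

text \<open>For the step \<theta> / sqrt n, these are the limits of the amplitude and of the
  frequency, before (\<open>arctan\<close>) and after (\<open>artanh\<close>) the operator is
  applied. The amplitudes become the Gaussian factors, the frequencies become \<theta>.\<close>

lemma gaussian_limits:
  fixes \<theta> :: real
  shows "(\<lambda>n. sqrt (1 + (\<theta> / sqrt (real n))\<^sup>2) ^ n) \<longlonglongrightarrow> exp (\<theta>\<^sup>2 / 2)"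
    and "(\<lambda>n. sqrt (real n) * arctan (\<theta> / sqrt (real n))) \<longlonglongrightarrow> \<theta>"
    and "(\<lambda>n. sqrt (1 - (\<theta> / sqrt (real n))\<^sup>2) ^ n) \<longlonglongrightarrow> exp (- \<theta>\<^sup>2 / 2)"
    and "(\<lambda>n. sqrt (real n) * artanh (\<theta> / sqrt (real n))) \<longlonglongrightarrow> \<theta>"
proof -
  have *: "(\<lambda>n. f (real n) ^ n) \<longlonglongrightarrow> l" if "((\<lambda>x. f x powr x) \<longlongrightarrow> l) at_top" "eventually (\<lambda>x. f x > 0) at_top" for f :: "real \<Rightarrow> real" and l
  proof -
    have "(\<lambda>n. f (real n) powr real n) \<longlonglongrightarrow> l"
      by (rule filterlim_compose[OF that(1) filterlim_real_sequentially])
    moreover have "eventually (\<lambda>n. f (real n) > 0) sequentially"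
      using that(2) filterlim_real_sequentially by (rule eventually_compose_filterlim)
    then have "eventually (\<lambda>n. f (real n) powr real n = f (real n) ^ n) sequentially"
      by eventually_elim (simp add: powr_realpow)
    ultimately show ?thesis by (rule Lim_transform_eventually)
  qed
  show "(\<lambda>n. sqrt (1 + (\<theta> / sqrt (real n))\<^sup>2) ^ n) \<longlonglongrightarrow> exp (\<theta>\<^sup>2 / 2)"
    unfolding power_divide real_sqrt_pow2[OF of_nat_0_le_iff]
    by (rule *[of "\<lambda>x. sqrt (1 + \<theta>\<^sup>2 / x)"]) (real_asymp simp: power2_eq_square)+
  show "(\<lambda>n. sqrt (1 - (\<theta> / sqrt (real n))\<^sup>2) ^ n) \<longlonglongrightarrow> exp (- \<theta>\<^sup>2 / 2)"
    unfolding power_divide real_sqrt_pow2[OF of_nat_0_le_iff]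
    by (rule *[of "\<lambda>x. sqrt (1 - \<theta>\<^sup>2 / x)"]) (real_asymp simp: power2_eq_square)+
  show "(\<lambda>n. sqrt (real n) * arctan (\<theta> / sqrt (real n))) \<longlonglongrightarrow> \<theta>"
  proof (rule filterlim_compose[of "\<lambda>x. x * arctan (\<theta> / x)" _ at_top])
    show "((\<lambda>x. x * arctan (\<theta> / x)) \<longlongrightarrow> \<theta>) at_top"
    proof (cases "\<theta> = 0")
      case False
      then consider "\<theta> < 0" | "\<theta> > 0" by linarith
      then show ?thesis by cases real_asymp+
    qed simp
  qed real_asymp
  show "(\<lambda>n. sqrt (real n) * artanh (\<theta> / sqrt (real n))) \<longlonglongrightarrow> \<theta>" unfolding artanh_def by real_asymp
qed

text \<open>Weak convergence of the scaled walk is upgraded to pointwise convergence by Skorohod's theorem; the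
  right-hand sides then converge by domination, the left-hand sides are controlled by Fatou's lemma.\<close>
lemma gaussian_hypercontractive:
  fixes p q :: real and \<theta> :: "'j \<Rightarrow> real" and \<kappa> :: "'j \<Rightarrow> complex"
  assumes q: "1 < q" "q < 2" and pq: "1 / p + 1 / q = 1" and J: "finite J"
  defines "c \<equiv> sqrt (q - 1)"
  shows "(\<integral>\<^sup>+x. ennreal (cmod (\<Sum>j\<in>J. \<kappa> j * complex_of_real (exp (- (c * \<theta> j)\<^sup>2 / 2) * exp (- (c * \<theta> j * x)))) powr p) \<partial>std_normal_distribution)
    \<le> ennreal ((\<integral>x. cmod (\<Sum>j\<in>J. \<kappa> j * (complex_of_real (exp ((\<theta> j)\<^sup>2 / 2)) * cis (\<theta> j * x))) powr q \<partial>std_normal_distribution) powr (p / q))"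
proof -
  have p: "p > 2" by (rule conjugate_exponent(2)[OF q pq])
  obtain \<Omega> :: "real measure" and Y :: "nat \<Rightarrow> real \<Rightarrow> real" and Z :: "real \<Rightarrow> real" where
    \<Omega>: "prob_space \<Omega>" and Y[measurable]: "\<And>n. Y n \<in> borel_measurable \<Omega>" and dY: "\<And>n. distr \<Omega> borel (Y n) = scaled_walk n"
    and Z: "Z \<in> measurable \<Omega> lborel" and dZ: "distr \<Omega> borel Z = std_normal_distribution"
    and YZ: "\<And>x. x \<in> space \<Omega> \<Longrightarrow> (\<lambda>n. Y n x) \<longlonglongrightarrow> Z x"
    using Skorohod[OF real_distribution_scaled_walk real_dist_normal_dist weak_conv_scaled_walk] by blast
  interpret prob_space \<Omega> by fact
  have Z[measurable]: "Z \<in> borel_measurable \<Omega>" using Z by simp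
  \<comment> \<open>\<open>A\<close> and \<open>B\<close> interpolate the discrete functions: at x =
    s / sqrt n they are the product of the factors 1 + \<i> t x_k with t = \<theta> / sqrt n, and
    its image under the operator.\<close>
  define A where "A n j x = complex_of_real (sqrt (1 + (\<theta> j / sqrt (real n))\<^sup>2) ^ n)
      * cis (sqrt (real n) * arctan (\<theta> j / sqrt (real n)) * x)" for n j x
  define B where "B n j x = complex_of_real (sqrt (1 - (c * \<theta> j / sqrt (real n))\<^sup>2) ^ n
      * exp (- (sqrt (real n) * artanh (c * \<theta> j / sqrt (real n)) * x)))" for n j x
  define R where "R n = (\<integral>x. cmod (\<Sum>j\<in>J. \<kappa> j * A n j (Y n x)) powr q \<partial>\<Omega>)" for n
  define R0 where "R0 = (\<integral>x. cmod (\<Sum>j\<in>J. \<kappa> j * (complex_of_real (exp ((\<theta> j)\<^sup>2 / 2)) * cis (\<theta> j * Z x))) powr q \<partial>\<Omega>)"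
  have [measurable]: "A n j \<in> borel_measurable borel" "B n j \<in> borel_measurable borel" for n j
    unfolding A_def B_def by (intro borel_measurable_continuous_onI continuous_intros)+
  have [measurable]: "(\<lambda>x. cis (a * x)) \<in> borel_measurable borel" for a
    by (intro borel_measurable_continuous_onI continuous_intros)
  have A_bound: "cmod (A n j x) \<le> exp ((\<theta> j)\<^sup>2 / 2)" if n: "n > 0" for n j x
  proof -
    have "sqrt (1 + (\<theta> j / sqrt (real n))\<^sup>2) ^ n \<le> sqrt (exp ((\<theta> j)\<^sup>2 / real n)) ^ n"
      by (intro power_mono real_sqrt_le_mono) (auto simp: power_divide)
    also have "\<dots> = exp ((\<theta> j)\<^sup>2 / real n / 2) ^ n"
    proof -
      have "sqrt (exp y) = exp (y / 2)" for y
        by (rule real_sqrt_unique) (simp_all add: power2_eq_square exp_add[symmetric])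
      then show ?thesis by simp
    qed
    also have "\<dots> = exp ((\<theta> j)\<^sup>2 / 2)" using n by (simp add: exp_of_nat_mult[symmetric])
    finally show ?thesis by (simp add: A_def norm_mult norm_power)
  qed
  have R_lim: "R \<longlonglongrightarrow> R0"
    unfolding R_def R0_def
  \<comment> \<open>The index is shifted by one because \<open>A_bound\<close> is stated for n >
    0.\<close>
  proof (rule LIMSEQ_offset[where k = 1], rule integral_dominated_convergence)
    show "AE x in \<Omega>. (\<lambda>n. cmod (\<Sum>j\<in>J. \<kappa> j * A (n + 1) j (Y (n + 1) x)) powr q)
      \<longlonglongrightarrow> cmod (\<Sum>j\<in>J. \<kappa> j * (complex_of_real (exp ((\<theta> j)\<^sup>2 / 2)) * cis (\<theta> j * Z x))) powr q"
    proof (rule AE_I2)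
      fix x assume x: "x \<in> space \<Omega>"
      have "(\<lambda>n. cmod (\<Sum>j\<in>J. \<kappa> j * A n j (Y n x)) powr q)
        \<longlonglongrightarrow> cmod (\<Sum>j\<in>J. \<kappa> j * (complex_of_real (exp ((\<theta> j)\<^sup>2 / 2)) * cis (\<theta> j * Z x))) powr q"
        unfolding A_def
        by (rule tendsto_powr2[OF tendsto_norm[OF tendsto_sum] tendsto_const])
           ((intro tendsto_mult tendsto_const tendsto_of_real tendsto_cis gaussian_limits YZ[OF x])[1], use q in auto)
      then show "(\<lambda>n. cmod (\<Sum>j\<in>J. \<kappa> j * A (n + 1) j (Y (n + 1) x)) powr q)
        \<longlonglongrightarrow> cmod (\<Sum>j\<in>J. \<kappa> j * (complex_of_real (exp ((\<theta> j)\<^sup>2 / 2)) * cis (\<theta> j * Z x))) powr q"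
        by (rule LIMSEQ_ignore_initial_segment)
    qed
    show "AE x in \<Omega>. norm (cmod (\<Sum>j\<in>J. \<kappa> j * A (n + 1) j (Y (n + 1) x)) powr q)
        \<le> (\<Sum>j\<in>J. cmod (\<kappa> j) * exp ((\<theta> j)\<^sup>2 / 2)) powr q" for n
    proof (rule AE_I2)
      fix x
      have "cmod (\<Sum>j\<in>J. \<kappa> j * A (n + 1) j (Y (n + 1) x)) \<le> (\<Sum>j\<in>J. cmod (\<kappa> j) * exp ((\<theta> j)\<^sup>2 / 2))"
        by (rule sum_norm_le) (auto simp: norm_mult intro!: mult_left_mono A_bound)
      then show "norm (cmod (\<Sum>j\<in>J. \<kappa> j * A (n + 1) j (Y (n + 1) x)) powr q)
        \<le> (\<Sum>j\<in>J. cmod (\<kappa> j) * exp ((\<theta> j)\<^sup>2 / 2)) powr q"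
        using q by (auto intro!: powr_mono2)
    qed
  qed (auto simp: J)
  \<comment> \<open>The \<open>artanh\<close> form of the image is valid only for arguments in (-1,
    1). Finiteness of \<open>J\<close> gives one threshold for all frequencies.\<close>
  have "eventually (\<lambda>n. \<bar>c * \<theta> j / sqrt (real n)\<bar> < 1) sequentially" for j
  proof -
    have "(\<lambda>n. c * \<theta> j / sqrt (real n)) \<longlonglongrightarrow> 0" by real_asymp
    from order_tendstoD(2)[OF tendsto_rabs_zero[OF this], of 1] show ?thesis by simp
  qed
  then have small: "eventually (\<lambda>n. \<forall>j\<in>J. \<bar>c * \<theta> j / sqrt (real n)\<bar> < 1) sequentially"
    by (intro eventually_ball_finite[OF J]) auto
  have step: "(\<integral>\<^sup>+x. ennreal (cmod (\<Sum>j\<in>J. \<kappa> j * B n j (Y n x)) powr p) \<partial>\<Omega>) \<le> ennreal (R n powr (p / q))"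
    if n: "n > 0" and sm: "\<forall>j\<in>J. \<bar>c * \<theta> j / sqrt (real n)\<bar> < 1" for n
  proof -
    define t where "t j = \<theta> j / sqrt (real n)" for j
    define F where "F j m s = complex_of_real (sqrt (1 + (t j)\<^sup>2) ^ m) * cis (arctan (t j) * real_of_int s)" for j m s
    define G where "G j m s = complex_of_real (sqrt (1 - (c * t j)\<^sup>2) ^ m * exp (- (artanh (c * t j) * real_of_int s)))" for j m s
    have F1: "F j (Suc m) (s + 1) = (1 + \<i> * t j) * F j m s" for j m s
      unfolding F_def cis_arctan[symmetric] by (simp add: algebra_simps cis_mult)
    have F2: "F j (Suc m) (s - 1) = (1 - \<i> * t j) * F j m s" for j m s
    proof -
      have e: "1 - \<i> * t j = complex_of_real (sqrt (1 + (t j)\<^sup>2)) * cis (- arctan (t j))"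
        using cis_arctan[of "- t j"] by (simp add: arctan_minus)
      show ?thesis unfolding F_def e by (simp add: algebra_simps cis_mult)
    qed
    have G1: "G j (Suc m) (s + 1) = (1 + (\<i> * c) * (\<i> * t j)) * G j m s" if "j \<in> J" for j m s
    proof -
      have e: "sqrt (1 - (c * t j)\<^sup>2) * exp (- artanh (c * t j)) = 1 - c * t j"
        using exp_artanh[of "- (c * t j)"] sm that by (simp add: t_def artanh_minus_real)
      have "sqrt (1 - (c * t j)\<^sup>2) ^ Suc m * exp (- (artanh (c * t j) * real_of_int (s + 1)))
        = (sqrt (1 - (c * t j)\<^sup>2) * exp (- artanh (c * t j))) * (sqrt (1 - (c * t j)\<^sup>2) ^ m * exp (- (artanh (c * t j) * real_of_int s)))"
        by (simp add: exp_add[symmetric] algebra_simps)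
      \<comment> \<open>The imaginary units of the operator and of the factor multiply to -1, so
        oscillating exponentials are mapped to real ones.\<close>
      moreover have "1 + (\<i> * c) * (\<i> * t j) = complex_of_real (1 - c * t j)"
        by (simp add: complex_eq_iff)
      ultimately show ?thesis unfolding G_def e by (simp only: of_real_mult)
    qed
    have G2: "G j (Suc m) (s - 1) = (1 - (\<i> * c) * (\<i> * t j)) * G j m s" if "j \<in> J" for j m s
    proof -
      have e: "sqrt (1 - (c * t j)\<^sup>2) * exp (artanh (c * t j)) = 1 + c * t j"
        using exp_artanh[of "c * t j"] sm that by (simp add: t_def)
      have "sqrt (1 - (c * t j)\<^sup>2) ^ Suc m * exp (- (artanh (c * t j) * real_of_int (s - 1)))
        = (sqrt (1 - (c * t j)\<^sup>2) * exp (artanh (c * t j))) * (sqrt (1 - (c * t j)\<^sup>2) ^ m * exp (- (artanh (c * t j) * real_of_int s)))"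
        by (simp add: exp_add[symmetric] algebra_simps)
      moreover have "1 - (\<i> * c) * (\<i> * t j) = complex_of_real (1 + c * t j)"
        by (simp add: complex_eq_iff)
      ultimately show ?thesis unfolding G_def e by (simp only: of_real_mult)
    qed
    have AF: "A n j (real_of_int s / sqrt (real n)) = F j n s" for j s
      using n by (simp add: A_def F_def t_def)
    have BG: "B n j (real_of_int s / sqrt (real n)) = G j n s" for j s
      using n by (simp add: B_def G_def t_def)
    have int_eq: "(\<integral>x. H (Y n x) \<partial>\<Omega>) = measure_pmf.expectation (walk n) (\<lambda>s. H (real_of_int s / sqrt (real n)))"
      if [measurable]: "H \<in> borel_measurable borel" for H :: "real \<Rightarrow> real"
    proof -
      have "(\<integral>x. H (Y n x) \<partial>\<Omega>) = (\<integral>x. H x \<partial>distr \<Omega> borel (Y n))" by (simp add: integral_distr)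
      also have "\<dots> = measure_pmf.expectation (walk n) (\<lambda>s. H (real_of_int s / sqrt (real n)))"
        unfolding dY scaled_walk_def by (subst integral_distr) auto
      finally show ?thesis .
    qed
    have nn_eq: "(\<integral>\<^sup>+x. ennreal (H (Y n x)) \<partial>\<Omega>) = ennreal (measure_pmf.expectation (walk n) (\<lambda>s. H (real_of_int s / sqrt (real n))))"
      if [measurable]: "H \<in> borel_measurable borel" and "\<And>x. H x \<ge> 0" for H :: "real \<Rightarrow> real"
    proof -
      have "(\<integral>\<^sup>+x. ennreal (H (Y n x)) \<partial>\<Omega>) = (\<integral>\<^sup>+x. ennreal (H x) \<partial>distr \<Omega> borel (Y n))" by (simp add: nn_integral_distr)
      also have "\<dots> = (\<integral>\<^sup>+s. ennreal (H (real_of_int s / sqrt (real n))) \<partial>measure_pmf (walk n))"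
        unfolding dY scaled_walk_def by (subst nn_integral_distr) auto
      also have "\<dots> = ennreal (measure_pmf.expectation (walk n) (\<lambda>s. H (real_of_int s / sqrt (real n))))"
        using that by (intro nn_integral_eq_integral) auto
      finally show ?thesis .
    qed
    have "measure_pmf.expectation (walk n) (\<lambda>s. cmod (\<Sum>j\<in>J. \<kappa> j * G j n s) powr p)
      \<le> measure_pmf.expectation (walk n) (\<lambda>s. cmod (\<Sum>j\<in>J. \<kappa> j * F j n s) powr q) powr (p / q)"
      by (rule walk_hypercontractive[OF q pq, where t = "\<lambda>j. \<i> * t j"])
         (use F1 F2 G1 G2 in \<open>auto simp: F_def G_def c_def\<close>)
    moreover have "R n = measure_pmf.expectation (walk n) (\<lambda>s. cmod (\<Sum>j\<in>J. \<kappa> j * F j n s) powr q)"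
      using int_eq[of "\<lambda>x. cmod (\<Sum>j\<in>J. \<kappa> j * A n j x) powr q"] by (simp add: R_def AF)
    moreover have "(\<integral>\<^sup>+x. ennreal (cmod (\<Sum>j\<in>J. \<kappa> j * B n j (Y n x)) powr p) \<partial>\<Omega>)
      = ennreal (measure_pmf.expectation (walk n) (\<lambda>s. cmod (\<Sum>j\<in>J. \<kappa> j * G j n s) powr p))"
      using nn_eq[of "\<lambda>x. cmod (\<Sum>j\<in>J. \<kappa> j * B n j x) powr p"] by (simp add: BG)
    ultimately show ?thesis by (simp add: ennreal_leI)
  qed
  have "(\<integral>\<^sup>+x. ennreal (cmod (\<Sum>j\<in>J. \<kappa> j * complex_of_real (exp (- (c * \<theta> j)\<^sup>2 / 2) * exp (- (c * \<theta> j * Z x)))) powr p) \<partial>\<Omega>)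
     = (\<integral>\<^sup>+x. liminf (\<lambda>n. ennreal (cmod (\<Sum>j\<in>J. \<kappa> j * B n j (Y n x)) powr p)) \<partial>\<Omega>)"
  proof (rule nn_integral_cong)
    fix x assume x: "x \<in> space \<Omega>"
    have "(\<lambda>n. cmod (\<Sum>j\<in>J. \<kappa> j * B n j (Y n x)) powr p)
      \<longlonglongrightarrow> cmod (\<Sum>j\<in>J. \<kappa> j * complex_of_real (exp (- (c * \<theta> j)\<^sup>2 / 2) * exp (- (c * \<theta> j * Z x)))) powr p"
      unfolding B_def
      by (rule tendsto_powr2[OF tendsto_norm[OF tendsto_sum] tendsto_const])
         ((intro tendsto_mult tendsto_const tendsto_of_real tendsto_exp tendsto_minus gaussian_limits YZ[OF x])[1], use p in auto)
    then have "(\<lambda>n. ennreal (cmod (\<Sum>j\<in>J. \<kappa> j * B n j (Y n x)) powr p))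
      \<longlonglongrightarrow> ennreal (cmod (\<Sum>j\<in>J. \<kappa> j * complex_of_real (exp (- (c * \<theta> j)\<^sup>2 / 2) * exp (- (c * \<theta> j * Z x)))) powr p)"
      by (rule tendsto_ennrealI)
    from lim_imp_Liminf[OF _ this] show "ennreal (cmod (\<Sum>j\<in>J. \<kappa> j * complex_of_real (exp (- (c * \<theta> j)\<^sup>2 / 2) * exp (- (c * \<theta> j * Z x)))) powr p)
      = liminf (\<lambda>n. ennreal (cmod (\<Sum>j\<in>J. \<kappa> j * B n j (Y n x)) powr p))" by simp
  qed
  \<comment> \<open>The functions \<open>B n j\<close> are real exponentials without a uniform bound
    like \<open>A_bound\<close>; an inequality in this direction is all that is required.\<close>
  also have "\<dots> \<le> liminf (\<lambda>n. \<integral>\<^sup>+x. ennreal (cmod (\<Sum>j\<in>J. \<kappa> j * B n j (Y n x)) powr p) \<partial>\<Omega>)"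
    by (rule nn_integral_liminf) measurable
  also have "\<dots> \<le> liminf (\<lambda>n. ennreal (R n powr (p / q)))"
  proof (rule Liminf_mono)
    show "eventually (\<lambda>n. (\<integral>\<^sup>+x. ennreal (cmod (\<Sum>j\<in>J. \<kappa> j * B n j (Y n x)) powr p) \<partial>\<Omega>) \<le> ennreal (R n powr (p / q))) sequentially"
      using eventually_gt_at_top[of 0] small by eventually_elim (rule step)
  qed
  also have "\<dots> = ennreal (R0 powr (p / q))"
  proof (rule lim_imp_Liminf)
    have "(\<lambda>n. R n powr (p / q)) \<longlonglongrightarrow> R0 powr (p / q)"
      by (rule tendsto_powr2[OF R_lim tendsto_const])
         (use p q in \<open>auto simp: R_def intro!: always_eventually Bochner_Integration.integral_nonneg\<close>)
    then show "(\<lambda>n. ennreal (R n powr (p / q))) \<longlonglongrightarrow> ennreal (R0 powr (p / q))" by (rule tendsto_ennrealI)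
  qed simp
  finally show ?thesis
    unfolding R0_def dZ[symmetric] by (simp add: nn_integral_distr integral_distr)
qed

section \<open>Hausdorff-Young for trigonometric polynomials times a Gaussian\<close>

lemma normal_density_gaussian:
  fixes a :: real
  assumes "a > 0"
  shows "exp (- (pi * a * x\<^sup>2)) = 1 / sqrt a * normal_density 0 (1 / sqrt (2 * pi * a)) x"
  using assms by (simp add: normal_density_def real_sqrt_divide real_sqrt_mult power_divide field_simps)

lemma
  fixes a :: real
  assumes a: "a > 0"
  shows integrable_gaussian: "integrable lborel (\<lambda>x. exp (- (pi * a * x\<^sup>2)))"
    and integral_gaussian: "(\<integral>x. exp (- (pi * a * x\<^sup>2)) \<partial>lborel) = 1 / sqrt a"
proof -
  have s: "0 < 1 / sqrt (2 * pi * a)" using a by simp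
  show "integrable lborel (\<lambda>x. exp (- (pi * a * x\<^sup>2)))"
    unfolding normal_density_gaussian[OF a] using s by simp
  show "(\<integral>x. exp (- (pi * a * x\<^sup>2)) \<partial>lborel) = 1 / sqrt a"
    unfolding normal_density_gaussian[OF a] using s by simp
qed

lemma borel_measurable_cis [measurable]: "cis \<in> borel_measurable borel"
  by (intro borel_measurable_continuous_onI continuous_intros)

section \<open>Elementary rules for the Fourier transform\<close>

lemma norm_fourier_kernel [simp]:
  "cmod (exp (- 2 * complex_of_real pi * \<i> * complex_of_real (x * \<xi>))) = 1"
  by (simp add: norm_exp_eq_Re)

lemma fourier_kernel_cis:
  "exp (- 2 * complex_of_real pi * \<i> * complex_of_real (x * \<xi>)) = cis (- (2 * pi * \<xi> * x))"
  by (simp add: cis_conv_exp algebra_simps)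

lemma fourier_kernel_measurable [measurable]:
  "(\<lambda>x. exp (- 2 * complex_of_real pi * \<i> * complex_of_real (x * \<xi>))) \<in> borel_measurable borel"
  by (intro borel_measurable_continuous_onI continuous_intros)

lemma integrable_fourier_integrand:
  assumes "integrable lborel f"
  shows "integrable lborel (\<lambda>x. f x * exp (- 2 * complex_of_real pi * \<i> * complex_of_real (x * \<xi>)))"
proof (rule Bochner_Integration.integrable_bound[OF assms])
  have [measurable]: "f \<in> borel_measurable borel" using assms borel_measurable_integrable by force
  show "(\<lambda>x. f x * exp (- 2 * complex_of_real pi * \<i> * complex_of_real (x * \<xi>))) \<in> borel_measurable lborel"
    by measurable
qed (simp add: norm_mult del: of_real_mult)

lemma norm_fourier_le:
  "cmod (fourier f \<xi>) \<le> (\<integral>x. cmod (f x) \<partial>lborel)"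
  unfolding fourier_def
  by (rule order_trans[OF integral_norm_bound]) (simp add: norm_mult del: of_real_mult)

lemma fourier_cmult: "fourier (\<lambda>x. c * f x) \<xi> = c * fourier f \<xi>"
  unfolding fourier_def by (simp add: mult.assoc)

lemma fourier_sum:
  assumes "\<And>j. j \<in> J \<Longrightarrow> integrable lborel (f j)"
  shows "fourier (\<lambda>x. \<Sum>j\<in>J. f j x) \<xi> = (\<Sum>j\<in>J. fourier (f j) \<xi>)"
  unfolding fourier_def sum_distrib_right
  by (rule Bochner_Integration.integral_sum) (intro integrable_fourier_integrand assms)

lemma fourier_modulation: "fourier (\<lambda>x. cis (\<theta> * x) * f x) \<xi> = fourier f (\<xi> - \<theta> / (2 * pi))"
proof -
  have "cis (\<theta> * x) * f x * cis (- (2 * pi * \<xi> * x)) = f x * cis (- (2 * pi * (\<xi> - \<theta> / (2 * pi)) * x))" for x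
  proof -
    have "cis (\<theta> * x) * cis (- (2 * pi * \<xi> * x)) = cis (- (2 * pi * (\<xi> - \<theta> / (2 * pi)) * x))"
      by (simp add: cis_mult algebra_simps)
    then show ?thesis by (metis mult.assoc mult.commute)
  qed
  then show ?thesis unfolding fourier_def fourier_kernel_cis by (simp only:)
qed

lemma fourier_gaussian:
  fixes a :: real
  assumes a: "a > 0"
  shows "fourier (\<lambda>x. complex_of_real (exp (- (pi * a * x\<^sup>2)))) \<xi> = complex_of_real (1 / sqrt a * exp (- (pi * \<xi>\<^sup>2 / a)))"
proof -
  define s where "s = sqrt (2 * pi * a)"
  have s: "s > 0" "s\<^sup>2 = 2 * pi * a" using a by (auto simp: s_def)
  have "fourier (\<lambda>x. complex_of_real (exp (- (pi * a * x\<^sup>2)))) \<xi>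
     = \<bar>1 / s\<bar> *\<^sub>R (\<integral>x. complex_of_real (exp (- (pi * a * (0 + 1 / s * x)\<^sup>2))) * cis (- (2 * pi * \<xi> * (0 + 1 / s * x))) \<partial>lborel)"
    unfolding fourier_def fourier_kernel_cis by (rule lborel_integral_real_affine) (use s in simp)
  also have "(\<lambda>x. complex_of_real (exp (- (pi * a * (0 + 1 / s * x)\<^sup>2))) * cis (- (2 * pi * \<xi> * (0 + 1 / s * x))))
     = (\<lambda>x. sqrt (2 * pi) *\<^sub>R (std_normal_density x *\<^sub>R iexp (- (2 * pi * \<xi> / s) * x)))"
  proof
    fix x
    have "pi * a * (0 + 1 / s * x)\<^sup>2 = x\<^sup>2 / 2" using a s by (simp add: power_divide)
    then show "complex_of_real (exp (- (pi * a * (0 + 1 / s * x)\<^sup>2))) * cis (- (2 * pi * \<xi> * (0 + 1 / s * x)))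
      = sqrt (2 * pi) *\<^sub>R (std_normal_density x *\<^sub>R iexp (- (2 * pi * \<xi> / s) * x))"
      by (simp add: std_normal_density_def cis_conv_exp scaleR_conv_of_real)
  qed
  also have "(\<integral>x. sqrt (2 * pi) *\<^sub>R (std_normal_density x *\<^sub>R iexp (- (2 * pi * \<xi> / s) * x)) \<partial>lborel)
     = sqrt (2 * pi) *\<^sub>R char std_normal_distribution (- (2 * pi * \<xi> / s))"
  proof -
    have "char std_normal_distribution (- (2 * pi * \<xi> / s)) = (\<integral>x. std_normal_density x *\<^sub>R iexp (- (2 * pi * \<xi> / s) * x) \<partial>lborel)"
      unfolding char_def by (subst integral_density) auto
    then show ?thesis by (simp only: integral_scaleR_right)
  qed
  also have "char std_normal_distribution (- (2 * pi * \<xi> / s)) = complex_of_real (exp (- (pi * \<xi>\<^sup>2 / a)))"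
  proof -
    have "(2 * pi * \<xi> / s)\<^sup>2 / 2 = (2 * pi * \<xi>)\<^sup>2 / (2 * pi * a) / 2" by (simp only: power_divide s)
    also have "\<dots> = pi * \<xi>\<^sup>2 / a" using a by (simp add: power2_eq_square)
    finally have "(2 * pi * \<xi> / s)\<^sup>2 / 2 = pi * \<xi>\<^sup>2 / a" .
    then show ?thesis by (simp add: char_std_normal_distribution)
  qed
  also have "\<bar>1 / s\<bar> *\<^sub>R sqrt (2 * pi) *\<^sub>R complex_of_real (exp (- (pi * \<xi>\<^sup>2 / a))) = complex_of_real (1 / sqrt a * exp (- (pi * \<xi>\<^sup>2 / a)))"
    using a s(1) by (simp add: s_def real_sqrt_mult scaleR_conv_of_real)
  finally show ?thesis .
qed

text \<open>With the Gaussian weight \<open>exp (-x\<^sup>2 / (2 q))\<close>, the \<open>q\<close>-th power of \<open>cmod f\<close> carries the standard normal density;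
  the frequency variable corresponds to the Gaussian variable through \<open>x = -2 \<pi> q \<xi> / sqrt (q - 1)\<close>.\<close>
lemma hausdorff_young_trig:
  fixes p q :: real and d :: "'j \<Rightarrow> complex" and \<theta> :: "'j \<Rightarrow> real"
  assumes q: "1 < q" "q < 2" and pq: "1 / p + 1 / q = 1" and J: "finite J"
  defines "f \<equiv> \<lambda>x. (\<Sum>j\<in>J. d j * cis (\<theta> j * x)) * complex_of_real (exp (- (x\<^sup>2 / (2 * q))))"
  shows "(\<integral>\<^sup>+\<xi>. ennreal (cmod (fourier f \<xi>) powr p) \<partial>lborel)
    \<le> ennreal (q powr (p / (2 * q)) / sqrt p * (\<integral>x. cmod (f x) powr q \<partial>lborel) powr (p / q))"
proof -
  have p: "p > 2" and p_eq: "p = q / (q - 1)" using conjugate_exponent[OF q pq] by auto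
  define c where "c = sqrt (q - 1)"
  have c: "c > 0" "c\<^sup>2 = q - 1" using q by (auto simp: c_def)
  \<comment> \<open>Compensates the factor exp (\<theta>^2 / 2) in
    \<open>gaussian_hypercontractive\<close>, so that its right-hand side contains the given
    trigonometric polynomial \<open>h\<close>.\<close>
  define \<kappa> where "\<kappa> j = d j * complex_of_real (exp (- (\<theta> j)\<^sup>2 / 2))" for j
  define S where "S x = (\<Sum>j\<in>J. \<kappa> j * complex_of_real (exp (- (c * \<theta> j)\<^sup>2 / 2) * exp (- (c * \<theta> j * x))))" for x
  define h where "h x = (\<Sum>j\<in>J. d j * cis (\<theta> j * x))" for x
  have [measurable]: "S \<in> borel_measurable borel" "h \<in> borel_measurable borel"
    unfolding S_def h_def by (intro borel_measurable_continuous_onI continuous_intros)+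
  have h_eq: "(\<Sum>j\<in>J. \<kappa> j * (complex_of_real (exp ((\<theta> j)\<^sup>2 / 2)) * cis (\<theta> j * x))) = h x" for x
  proof -
    have "exp (- (\<theta> j)\<^sup>2 / 2) * exp ((\<theta> j)\<^sup>2 / 2) = 1" for j
      by (simp add: exp_add[symmetric])
    then have "complex_of_real (exp (- (\<theta> j)\<^sup>2 / 2)) * complex_of_real (exp ((\<theta> j)\<^sup>2 / 2)) = 1" for j
      by (simp only: of_real_mult[symmetric] of_real_1)
    then show ?thesis unfolding h_def \<kappa>_def
      by (intro sum.cong refl) (metis (no_types, lifting) mult.assoc mult.right_neutral)
  qed
  have hc: "(\<integral>\<^sup>+x. ennreal (cmod (S x) powr p) \<partial>std_normal_distribution)
    \<le> ennreal ((\<integral>x. cmod (h x) powr q \<partial>std_normal_distribution) powr (p / q))"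
    using gaussian_hypercontractive[OF q pq J, of \<kappa> \<theta>]
    unfolding h_eq c_def[symmetric] S_def .
  define a where "a = 1 / (2 * pi * q)"
  have a: "a > 0" using q by (simp add: a_def)
  have ga: "exp (- (x\<^sup>2 / (2 * q))) = exp (- (pi * a * x\<^sup>2))" for x
    by (simp add: a_def)
  define m where "m = 2 * pi * q / c"
  have m: "m > 0" using q c by (simp add: m_def)
  \<comment> \<open>The argument is written \<open>0 + - m * \<xi>\<close> to match the affine
    substitution rule for the integral over \<xi>.\<close>
  have F: "fourier f \<xi> = complex_of_real (sqrt (2 * pi * q) * exp (- (2 * pi\<^sup>2 * q * \<xi>\<^sup>2))) * S (0 + - m * \<xi>)" for \<xi>
  proof -
    have "f = (\<lambda>x. \<Sum>j\<in>J. d j * (cis (\<theta> j * x) * complex_of_real (exp (- (pi * a * x\<^sup>2)))))"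
      unfolding f_def ga by (simp add: sum_distrib_right mult.assoc)
    then have "fourier f \<xi> = (\<Sum>j\<in>J. fourier (\<lambda>x. d j * (cis (\<theta> j * x) * complex_of_real (exp (- (pi * a * x\<^sup>2))))) \<xi>)"
    proof (simp only:, intro fourier_sum)
      fix j
      have "integrable lborel (\<lambda>x. cmod (d j) * exp (- (pi * a * x\<^sup>2)))"
        using integrable_gaussian[OF a] by simp
      then show "integrable lborel (\<lambda>x. d j * (cis (\<theta> j * x) * complex_of_real (exp (- (pi * a * x\<^sup>2)))))"
      proof (rule Bochner_Integration.integrable_bound)
        show "(\<lambda>x. d j * (cis (\<theta> j * x) * complex_of_real (exp (- (pi * a * x\<^sup>2))))) \<in> borel_measurable lborel"
          by measurable
      qed (simp add: norm_mult)
    qed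
    also have "\<dots> = (\<Sum>j\<in>J. d j * complex_of_real (1 / sqrt a * exp (- (pi * (\<xi> - \<theta> j / (2 * pi))\<^sup>2 / a))))"
      unfolding fourier_cmult fourier_modulation fourier_gaussian[OF a] ..
    also have "\<dots> = (\<Sum>j\<in>J. complex_of_real (sqrt (2 * pi * q) * exp (- (2 * pi\<^sup>2 * q * \<xi>\<^sup>2)))
        * (\<kappa> j * complex_of_real (exp (- (c * \<theta> j)\<^sup>2 / 2) * exp (- (c * \<theta> j * (0 + - m * \<xi>))))))"
    proof (rule sum.cong[OF refl])
      fix j
      \<comment> \<open>Expanding the square with 1 / a = 2 pi q leaves q \<theta>^2 / 2, which
        splits by q = 1 + c^2 into the factor in \<open>\<kappa>\<close> and the factor in
        \<open>S\<close>; the mixed term fixes m through c m = 2 pi q.\<close>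
      have "- (pi * (\<xi> - \<theta> j / (2 * pi))\<^sup>2 / a) = - (2 * pi\<^sup>2 * q * \<xi>\<^sup>2) + (- (\<theta> j)\<^sup>2 / 2 + (- (c * \<theta> j)\<^sup>2 / 2 + - (c * \<theta> j * (0 + - m * \<xi>))))"
        using c(1) by (simp add: a_def m_def power_mult_distrib c(2)) (simp add: field_simps power2_eq_square)
      then have "exp (- (pi * (\<xi> - \<theta> j / (2 * pi))\<^sup>2 / a)) = exp (- (2 * pi\<^sup>2 * q * \<xi>\<^sup>2)) * (exp (- (\<theta> j)\<^sup>2 / 2) * (exp (- (c * \<theta> j)\<^sup>2 / 2) * exp (- (c * \<theta> j * (0 + - m * \<xi>)))))"
        by (simp only: exp_add)
      moreover have "1 / sqrt a = sqrt (2 * pi * q)" using q by (simp add: a_def real_sqrt_divide)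
      ultimately show "d j * complex_of_real (1 / sqrt a * exp (- (pi * (\<xi> - \<theta> j / (2 * pi))\<^sup>2 / a)))
        = complex_of_real (sqrt (2 * pi * q) * exp (- (2 * pi\<^sup>2 * q * \<xi>\<^sup>2)))
        * (\<kappa> j * complex_of_real (exp (- (c * \<theta> j)\<^sup>2 / 2) * exp (- (c * \<theta> j * (0 + - m * \<xi>)))))"
        unfolding \<kappa>_def by (simp only: of_real_mult mult_ac)
    qed
    also have "\<dots> = complex_of_real (sqrt (2 * pi * q) * exp (- (2 * pi\<^sup>2 * q * \<xi>\<^sup>2))) * S (0 + - m * \<xi>)"
      unfolding S_def sum_distrib_left ..
    finally show ?thesis .
  qed
  have Fp: "cmod (fourier f \<xi>) powr p = (2 * pi * q) powr (p / 2) * sqrt (2 * pi) * (std_normal_density (0 + - m * \<xi>) * cmod (S (0 + - m * \<xi>)) powr p)" for \<xi>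
  proof -
    have "cmod (fourier f \<xi>) = sqrt (2 * pi * q) * exp (- (2 * pi\<^sup>2 * q * \<xi>\<^sup>2)) * cmod (S (0 + - m * \<xi>))"
      unfolding F using q by (simp add: norm_mult)
    then have "cmod (fourier f \<xi>) powr p = sqrt (2 * pi * q) powr p * exp (- (2 * pi\<^sup>2 * q * \<xi>\<^sup>2)) powr p * cmod (S (0 + - m * \<xi>)) powr p"
      by (simp add: powr_mult)
    moreover have "sqrt (2 * pi * q) powr p = (2 * pi * q) powr (p / 2)"
      using q by (simp add: powr_half_sqrt[symmetric] powr_powr)
    moreover have "exp (- (2 * pi\<^sup>2 * q * \<xi>\<^sup>2)) powr p = exp (- (0 + - m * \<xi>)\<^sup>2 / 2)"
    proof -
      \<comment> \<open>Because p = q / (q - 1), the p-th power of the Gaussian prefactor is exactly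
        the standard normal density at \<open>- m * \<xi>\<close>, up to a constant.\<close>
      have "2 * pi\<^sup>2 * q * \<xi>\<^sup>2 * p = (0 + - m * \<xi>)\<^sup>2 / 2"
      proof -
        define k where "k = 1 / (q - 1)"
        have "p = q * k" by (simp add: p_eq k_def)
        moreover have "(0 + - m * \<xi>)\<^sup>2 = (2 * pi * q * \<xi>)\<^sup>2 * k"
          by (simp add: m_def power_mult_distrib power_divide c k_def)
        ultimately show ?thesis by (simp only:) (simp add: power2_eq_square)
      qed
      then show ?thesis by (simp add: powr_def algebra_simps)
    qed
    ultimately show ?thesis by (simp add: std_normal_density_def)
  qed
  define C where "C = (2 * pi * q) powr (p / 2) * sqrt (2 * pi)"
  have C: "C \<ge> 0" by (simp add: C_def)
  have "(\<integral>\<^sup>+\<xi>. ennreal (cmod (fourier f \<xi>) powr p) \<partial>lborel)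
      = (\<integral>\<^sup>+\<xi>. ennreal (C * (std_normal_density (0 + - m * \<xi>) * cmod (S (0 + - m * \<xi>)) powr p)) \<partial>lborel)"
    unfolding Fp C_def ..
  also have "\<dots> = ennreal C * (\<integral>\<^sup>+\<xi>. ennreal (std_normal_density (0 + - m * \<xi>) * cmod (S (0 + - m * \<xi>)) powr p) \<partial>lborel)"
    by (subst nn_integral_cmult[symmetric]) (use C in \<open>simp_all add: ennreal_mult\<close>)
  also have "(\<integral>\<^sup>+\<xi>. ennreal (std_normal_density (0 + - m * \<xi>) * cmod (S (0 + - m * \<xi>)) powr p) \<partial>lborel)
      = ennreal (1 / m) * (\<integral>\<^sup>+x. ennreal (std_normal_density x * cmod (S x) powr p) \<partial>lborel)"
  proof -
    have "(\<integral>\<^sup>+x. ennreal (std_normal_density x * cmod (S x) powr p) \<partial>lborel)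
      = ennreal \<bar>- m\<bar> * (\<integral>\<^sup>+\<xi>. ennreal (std_normal_density (0 + - m * \<xi>) * cmod (S (0 + - m * \<xi>)) powr p) \<partial>lborel)"
      by (rule nn_integral_real_affine) (use m in auto)
    then show ?thesis using m by (simp add: mult.assoc[symmetric] ennreal_mult[symmetric])
  qed
  also have "(\<integral>\<^sup>+x. ennreal (std_normal_density x * cmod (S x) powr p) \<partial>lborel)
     = (\<integral>\<^sup>+x. ennreal (cmod (S x) powr p) \<partial>std_normal_distribution)"
    by (subst nn_integral_density) (auto simp: ennreal_mult)
  also have "ennreal C * (ennreal (1 / m) * \<dots>)
     \<le> ennreal C * (ennreal (1 / m) * ennreal ((\<integral>x. cmod (h x) powr q \<partial>std_normal_distribution) powr (p / q)))"
    by (intro mult_left_mono hc) auto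
  also have "\<dots> = ennreal (C * (1 / m) * (\<integral>x. cmod (h x) powr q \<partial>std_normal_distribution) powr (p / q))"
    using C m by (simp add: ennreal_mult[symmetric])
  also have "(\<integral>x. cmod (h x) powr q \<partial>std_normal_distribution) = 1 / sqrt (2 * pi) * (\<integral>x. cmod (f x) powr q \<partial>lborel)"
  proof -
    have "(\<integral>x. cmod (h x) powr q \<partial>std_normal_distribution) = (\<integral>x. std_normal_density x * cmod (h x) powr q \<partial>lborel)"
      by (subst integral_density) auto
    also have "\<dots> = (\<integral>x. 1 / sqrt (2 * pi) * cmod (f x) powr q \<partial>lborel)"
    proof (rule Bochner_Integration.integral_cong[OF refl])
      fix x
      have "exp (- (x\<^sup>2 / (2 * q))) powr q = exp (- x\<^sup>2 / 2)" using q by (simp add: powr_def)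
      then show "std_normal_density x * cmod (h x) powr q = 1 / sqrt (2 * pi) * cmod (f x) powr q"
        unfolding f_def h_def[symmetric] by (simp add: norm_mult powr_mult std_normal_density_def)
    qed
    finally show ?thesis by simp
  qed
  also have "C * (1 / m) * (1 / sqrt (2 * pi) * (\<integral>x. cmod (f x) powr q \<partial>lborel)) powr (p / q)
    = q powr (p / (2 * q)) / sqrt p * (\<integral>x. cmod (f x) powr q \<partial>lborel) powr (p / q)"
  proof -
    define I where "I = (\<integral>x. cmod (f x) powr q \<partial>lborel)"
    \<comment> \<open>Bookkeeping of the constant: p / q = p - 1 makes all powers of 2 pi cancel,
      and c = sqrt (q / p) supplies the remaining powers of p and q.\<close>
    have pq1: "p / q = p - 1" "p / (2 * q) = p / 2 - 1 / 2" using p_eq q by (auto simp: field_simps)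
    have e1: "(1 / sqrt (2 * pi)) powr (p / q) = (2 * pi) powr (1 / 2 - p / 2)"
      by (simp add: pq1 powr_half_sqrt[symmetric] powr_divide powr_powr powr_minus_divide[symmetric] algebra_simps diff_divide_distrib)
    have e2: "C * (1 / m) = (2 * pi) powr (p / 2 + 1 / 2 - 1) * (q powr (p / 2 - 1) * c)"
    proof -
      have "1 / m = (2 * pi) powr (- 1) * (q powr (- 1) * c)"
        using q by (simp add: m_def powr_minus_divide)
      moreover have "C = (2 * pi) powr (p / 2) * q powr (p / 2) * (2 * pi) powr (1 / 2)"
        using q by (simp add: C_def powr_mult powr_half_sqrt real_sqrt_mult)
      ultimately have "C * (1 / m) = ((2 * pi) powr (p / 2) * (2 * pi) powr (1 / 2) * (2 * pi) powr (- 1)) * ((q powr (p / 2) * q powr (- 1)) * c)"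
        by (simp only: mult_ac)
      then show ?thesis by (simp only: powr_add[symmetric]) simp
    qed
    have e3: "(2 * pi) powr (p / 2 + 1 / 2 - 1) * (2 * pi) powr (1 / 2 - p / 2) = 1"
      by (simp add: powr_add[symmetric])
    have "c = sqrt q / sqrt p" using q p by (simp add: c_def real_sqrt_divide[symmetric] p_eq)
    then have e4: "q powr (p / 2 - 1) * c = q powr (p / (2 * q)) / sqrt p"
    proof -
      have "q powr (p / 2 - 1) * q powr (1 / 2) = q powr (p / (2 * q))"
        unfolding pq1 powr_add[symmetric] by (rule arg_cong[where f = "(powr) q"]) simp
      then show ?thesis using \<open>c = sqrt q / sqrt p\<close> q by (simp add: powr_half_sqrt)
    qed
    have "C * (1 / m) * (1 / sqrt (2 * pi) * I) powr (p / q)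
       = (2 * pi) powr (p / 2 + 1 / 2 - 1) * (q powr (p / 2 - 1) * c) * ((2 * pi) powr (1 / 2 - p / 2) * I powr (p / q))"
      unfolding e2 powr_mult e1 ..
    also have "\<dots> = ((2 * pi) powr (p / 2 + 1 / 2 - 1) * (2 * pi) powr (1 / 2 - p / 2)) * (q powr (p / 2 - 1) * c) * I powr (p / q)"
      by (simp only: mult_ac)
    also have "\<dots> = q powr (p / (2 * q)) / sqrt p * I powr (p / q)"
      unfolding e3 e4 by simp
    finally show ?thesis unfolding I_def .
  qed
  finally show ?thesis .
qed

section \<open>Density\<close>

definition trig_poly :: "(real \<Rightarrow> complex) \<Rightarrow> bool" where
  "trig_poly h \<longleftrightarrow> (\<exists>J d. finite J \<and> (\<forall>x. h x = (\<Sum>\<theta>\<in>J. d \<theta> * cis (\<theta> * x))))"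

lemma trig_poly_cis: "trig_poly (\<lambda>x. c * cis (\<theta> * x))"
  unfolding trig_poly_def by (intro exI[of _ "{\<theta>}"] exI[of _ "\<lambda>_. c"]) simp

lemma trig_poly_const: "trig_poly (\<lambda>x. c)"
  using trig_poly_cis[of c 0] by simp

lemma trig_poly_add:
  assumes "trig_poly f" "trig_poly g"
  shows "trig_poly (\<lambda>x. f x + g x)"
proof -
  obtain J d where J: "finite J" "\<And>x. f x = (\<Sum>\<theta>\<in>J. d \<theta> * cis (\<theta> * x))"
    using assms(1) unfolding trig_poly_def by blast
  obtain K e where K: "finite K" "\<And>x. g x = (\<Sum>\<theta>\<in>K. e \<theta> * cis (\<theta> * x))"
    using assms(2) unfolding trig_poly_def by blast
  let ?d = "\<lambda>\<theta>. (if \<theta> \<in> J then d \<theta> else 0) + (if \<theta> \<in> K then e \<theta> else 0)"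
  have "f x + g x = (\<Sum>\<theta>\<in>J \<union> K. ?d \<theta> * cis (\<theta> * x))" for x
  proof -
    have "f x = (\<Sum>\<theta>\<in>J \<union> K. (if \<theta> \<in> J then d \<theta> else 0) * cis (\<theta> * x))"
      unfolding J(2) by (rule sum.mono_neutral_cong_left) (use J K in auto)
    moreover have "g x = (\<Sum>\<theta>\<in>J \<union> K. (if \<theta> \<in> K then e \<theta> else 0) * cis (\<theta> * x))"
      unfolding K(2) by (rule sum.mono_neutral_cong_left) (use J K in auto)
    ultimately show ?thesis by (simp add: sum.distrib distrib_right)
  qed
  then show ?thesis unfolding trig_poly_def
    using J(1) K(1) by (intro exI[of _ "J \<union> K"] exI[of _ ?d]) auto
qed

lemma trig_poly_sum:
  assumes "\<And>i. i \<in> I \<Longrightarrow> trig_poly (f i)"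
  shows "trig_poly (\<lambda>x. \<Sum>i\<in>I. f i x)"
  using assms by (induction I rule: infinite_finite_induct) (auto intro: trig_poly_const trig_poly_add)

lemma trig_poly_mult:
  assumes "trig_poly f" "trig_poly g"
  shows "trig_poly (\<lambda>x. f x * g x)"
proof -
  obtain J d where J: "finite J" "\<And>x. f x = (\<Sum>\<theta>\<in>J. d \<theta> * cis (\<theta> * x))"
    using assms(1) unfolding trig_poly_def by blast
  obtain K e where K: "finite K" "\<And>x. g x = (\<Sum>\<theta>\<in>K. e \<theta> * cis (\<theta> * x))"
    using assms(2) unfolding trig_poly_def by blast
  have "cis ((\<theta> + \<phi>) * x) = cis (\<theta> * x) * cis (\<phi> * x)" for \<theta> \<phi> x
    by (simp add: cis_mult distrib_right)
  then have "(\<lambda>x. f x * g x) = (\<lambda>x. \<Sum>\<theta>\<in>J. \<Sum>\<phi>\<in>K. (d \<theta> * e \<phi>) * cis ((\<theta> + \<phi>) * x))"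
    unfolding J(2) K(2) sum_product by (intro ext sum.cong refl) (simp only: mult_ac)
  then show ?thesis by (auto intro!: trig_poly_sum trig_poly_cis)
qed

text \<open>On the unit circle a real-linear functional is a combination of cosine and sine, hence
  of the frequencies \<omega> and -\<omega>; sums and products of trigonometric polynomials remain
  such.\<close>

lemma trig_poly_real_polynomial:
  assumes "real_polynomial_function (P :: complex \<Rightarrow> real)"
  shows "trig_poly (\<lambda>x. complex_of_real (P (cis (\<omega> * x))))"
  using assms
proof (induction P rule: real_polynomial_function.induct)
  case (linear f)
  then interpret bounded_linear f .
  have "complex_of_real (f (cis (\<omega> * x)))
     = (f 1 / 2 - \<i> * f \<i> / 2) * cis (\<omega> * x) + (f 1 / 2 + \<i> * f \<i> / 2) * cis (- \<omega> * x)" for x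
  proof -
    have "cis (\<omega> * x) = cos (\<omega> * x) *\<^sub>R 1 + sin (\<omega> * x) *\<^sub>R \<i>" by (simp add: complex_eq_iff)
    then have "f (cis (\<omega> * x)) = cos (\<omega> * x) * f 1 + sin (\<omega> * x) * f \<i>"
      by (simp only: add scale) simp
    then show ?thesis by (simp add: complex_eq_iff algebra_simps)
  qed
  then show ?case by (simp only:) (intro trig_poly_add trig_poly_cis)
qed (auto intro: trig_poly_const trig_poly_add trig_poly_mult)

lemma trig_poly_polynomial:
  assumes "polynomial_function (P :: complex \<Rightarrow> complex)"
  shows "trig_poly (\<lambda>x. P (cis (\<omega> * x)))"
proof -
  have "real_polynomial_function (Re \<circ> P)" "real_polynomial_function (Im \<circ> P)"
    using assms bounded_linear_Re bounded_linear_Im unfolding polynomial_function_def by auto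
  from this[THEN trig_poly_real_polynomial, of \<omega>]
  have "trig_poly (\<lambda>x. complex_of_real (Re (P (cis (\<omega> * x)))) + \<i> * complex_of_real (Im (P (cis (\<omega> * x)))))"
    by (intro trig_poly_add trig_poly_mult trig_poly_const) (auto simp: o_def)
  then show ?thesis by (simp only: complex_eq[symmetric])
qed

text \<open>A function supported in \<open>[-R, R]\<close> is transplanted to the unit circle, where the Stone-Weierstrass theorem applies.\<close>
lemma trig_poly_approx:
  fixes u :: "real \<Rightarrow> complex"
  assumes u: "continuous_on UNIV u" and supp: "\<And>x. \<bar>x\<bar> \<ge> R \<Longrightarrow> u x = 0" and R: "0 < R" "R < L" and e: "0 < e"
    and B: "\<And>x. cmod (u x) \<le> B"
  obtains h where "trig_poly h" "\<And>x. \<bar>x\<bar> < L \<Longrightarrow> cmod (u x - h x) < e" "\<And>x. cmod (h x) \<le> B + e"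
proof -
  \<comment> \<open>On a circle of circumference 2 L the condition \<open>Re z \<le> r\<close>
    describes the arc corresponding to R <= |x|, where \<open>u\<close> vanishes.\<close>
  define r where "r = cos (pi * R / L)"
  have RL: "0 < pi * R / L" "pi * R / L < pi" using R by (auto simp: field_simps)
  have r: "r > - 1" using cos_monotone_0_pi[of "pi * R / L" pi] RL by (simp add: r_def)
  \<comment> \<open>The explicit value 0 on the far arc bypasses the jump of \<open>Arg\<close> on
    the negative axis: r > -1 keeps -1 out of the arc where the formula with \<open>Arg\<close> is
    used.\<close>
  define U where "U z = (if Re z \<le> r then 0 else u (L * Arg z / pi))" for z
  have Arg_ge: "\<bar>L * Arg z / pi\<bar> \<ge> R" if "cmod z = 1" "Re z \<le> r" for z
  proof -
    have "z \<noteq> 0" using that by auto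
    then have "cis (Arg z) = z" using that by (simp add: cis_Arg sgn_eq)
    then have "cos \<bar>Arg z\<bar> = Re z" by (metis cis.simps(1) cos_abs_real)
    then have "cos \<bar>Arg z\<bar> \<le> cos (pi * R / L)" using that by (simp add: r_def)
    moreover have "\<bar>Arg z\<bar> \<le> pi" using Arg_bounded[of z] by auto
    ultimately have "pi * R / L \<le> \<bar>Arg z\<bar>"
      using RL cos_monotone_0_pi[of "\<bar>Arg z\<bar>" "pi * R / L"] by force
    then show ?thesis using R by (simp add: abs_mult field_simps)
  qed
  have cU: "continuous_on (sphere 0 1) U"
  proof -
    have eq: "sphere 0 1 = (sphere 0 1 \<inter> {z. Re z \<le> r}) \<union> (sphere 0 1 \<inter> {z. r \<le> Re z})" by auto
    show ?thesis unfolding U_def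
    proof (subst eq, rule continuous_on_cases)
      show "closed (sphere 0 1 \<inter> {z. Re z \<le> r})" "closed (sphere 0 1 \<inter> {z. r \<le> Re z})"
        by (auto intro!: closed_Int closed_halfspace_Re_le closed_halfspace_Re_ge)
      show "continuous_on (sphere 0 1 \<inter> {z. r \<le> Re z}) (\<lambda>z. u (L * Arg z / pi))"
      proof (rule continuous_on_compose2[OF u])
        have "z \<notin> \<real>\<^sub>\<le>\<^sub>0" if "cmod z = 1" "r \<le> Re z" for z
        proof
          assume "z \<in> \<real>\<^sub>\<le>\<^sub>0"
          then have "Re z \<le> 0" "Im z = 0" by (auto simp: complex_nonpos_Reals_iff)
          then have "cmod z = - Re z" by (simp add: cmod_eq_Re)
          then show False using that r by simp
        qed
        then show "continuous_on (sphere 0 1 \<inter> {z. r \<le> Re z}) (\<lambda>z. L * Arg z / pi)"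
          by (intro continuous_intros continuous_at_imp_continuous_on ballI continuous_at_Arg) auto
      qed auto
      show "\<forall>z. z \<in> sphere 0 1 \<inter> {z. Re z \<le> r} \<and> \<not> Re z \<le> r \<or> z \<in> sphere 0 1 \<inter> {z. r \<le> Re z} \<and> Re z \<le> r
          \<longrightarrow> 0 = u (L * Arg z / pi)"
        using Arg_ge supp by auto
    qed auto
  qed
  obtain g where g: "polynomial_function g" "\<And>z. z \<in> sphere 0 1 \<Longrightarrow> cmod (U z - g z) < e"
    using Stone_Weierstrass_polynomial_function[OF compact_sphere cU e] by metis
  have Ubound: "cmod (U z) \<le> B" for z
    using B norm_ge_zero[of "u 0"] order_trans[OF norm_ge_zero B] by (auto simp: U_def)
  show thesis
  proof
    show "trig_poly (\<lambda>x. g (cis (pi / L * x)))" by (rule trig_poly_polynomial[OF g(1)])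
    \<comment> \<open>Beyond L the approximant repeats periodically and is no longer close to
      \<open>u\<close>. This global bound is what later allows domination by a Gaussian.\<close>
    show "cmod (g (cis (pi / L * x))) \<le> B + e" for x
    proof -
      have "cmod (U (cis (pi / L * x)) - g (cis (pi / L * x))) < e" by (rule g(2)) simp
      then show ?thesis using Ubound[of "cis (pi / L * x)"] norm_triangle_sub[of "g (cis (pi / L * x))" "U (cis (pi / L * x))"]
        by (simp add: norm_minus_commute)
    qed
    show "cmod (u x - g (cis (pi / L * x))) < e" if x: "\<bar>x\<bar> < L" for x
    proof -
      have "pi * (\<bar>x\<bar> / L) < pi * 1" using x R by (intro mult_strict_left_mono) auto
      then have "\<bar>pi / L * x\<bar> < pi" using R by (simp add: abs_mult)
      then have "pi / L * x \<in> {- pi<..pi}" unfolding abs_less_iff greaterThanAtMost_iff by linarith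
      then have A: "Arg (cis (pi / L * x)) = pi / L * x" by (simp add: Arg_cis)
      have "U (cis (pi / L * x)) = u x"
      proof (cases "Re (cis (pi / L * x)) \<le> r")
        case True
        then show ?thesis using Arg_ge[of "cis (pi / L * x)"] supp R unfolding U_def A by simp
      next
        case False
        then show ?thesis using R unfolding U_def A by simp
      qed
      then show ?thesis using g(2)[of "cis (pi / L * x)"] by simp
    qed
  qed
qed

section \<open>Extension of the Hausdorff-Young inequality by limits\<close>

lemma fourier_tendsto:
  fixes f :: "nat \<Rightarrow> real \<Rightarrow> complex"
  assumes f: "\<And>n. f n \<in> borel_measurable borel" "g \<in> borel_measurable borel"
    and lim: "\<And>x. (\<lambda>n. f n x) \<longlonglongrightarrow> g x" and w: "integrable lborel w" "\<And>n x. cmod (f n x) \<le> w x"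
  shows "(\<lambda>n. fourier (f n) \<xi>) \<longlonglongrightarrow> fourier g \<xi>"
  unfolding fourier_def
proof (rule integral_dominated_convergence[OF _ _ w(1)])
  show "AE x in lborel. cmod (f n x * exp (- 2 * complex_of_real pi * \<i> * complex_of_real (x * \<xi>))) \<le> w x" for n
    using w(2) by (simp add: norm_mult del: of_real_mult)
qed (use f in \<open>auto intro!: tendsto_mult lim simp del: of_real_mult\<close>)

lemma continuous_fourier:
  assumes f: "integrable lborel f"
  shows "continuous_on UNIV (fourier f)"
  unfolding continuous_on_sequentially
proof (intro allI ballI impI)
  have [measurable]: "f \<in> borel_measurable borel" using f borel_measurable_integrable by force
  fix s :: "nat \<Rightarrow> real" and \<xi> assume "(\<forall>n. s n \<in> UNIV) \<and> s \<longlonglongrightarrow> \<xi>"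
  then have s: "s \<longlonglongrightarrow> \<xi>" by simp
  show "(fourier f \<circ> s) \<longlonglongrightarrow> fourier f \<xi>"
    unfolding fourier_def o_def
  proof (rule integral_dominated_convergence[where w = "\<lambda>x. cmod (f x)"])
    show "AE x in lborel. (\<lambda>n. f x * exp (- 2 * complex_of_real pi * \<i> * complex_of_real (x * s n)))
      \<longlonglongrightarrow> f x * exp (- 2 * complex_of_real pi * \<i> * complex_of_real (x * \<xi>))"
      by (intro AE_I2 tendsto_intros s)
  qed (use f in \<open>auto simp: norm_mult simp del: of_real_mult\<close>)
qed

lemma borel_measurable_fourier [measurable]:
  assumes f: "integrable lborel f"
  shows "fourier f \<in> borel_measurable borel"
  by (rule borel_measurable_continuous_onI[OF continuous_fourier[OF f]])

text \<open>Domination by \<open>w\<close> gives pointwise convergence of the transforms and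
  convergence of the q-norms. For the p-norms Fatou's lemma suffices; stating them as nonnegative
  integrals avoids any prior integrability of the transform.\<close>

lemma hausdorff_young_limit:
  fixes f :: "nat \<Rightarrow> real \<Rightarrow> complex"
  assumes pq: "0 < p" "0 < q" and K: "0 \<le> K"
    and f: "\<And>n. f n \<in> borel_measurable borel" "g \<in> borel_measurable borel"
    and lim: "\<And>x. (\<lambda>n. f n x) \<longlonglongrightarrow> g x"
    and w: "integrable lborel w" "integrable lborel (\<lambda>x. w x powr q)" "\<And>n x. cmod (f n x) \<le> w x"
    and hy: "\<And>n. (\<integral>\<^sup>+\<xi>. ennreal (cmod (fourier (f n) \<xi>) powr p) \<partial>lborel)
      \<le> ennreal (K * (\<integral>x. cmod (f n x) powr q \<partial>lborel) powr (p / q))"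
  shows "(\<integral>\<^sup>+\<xi>. ennreal (cmod (fourier g \<xi>) powr p) \<partial>lborel)
      \<le> ennreal (K * (\<integral>x. cmod (g x) powr q \<partial>lborel) powr (p / q))"
proof -
  note f[measurable]
  have fi: "integrable lborel (f n)" for n
    by (rule Bochner_Integration.integrable_bound[OF w(1)]) (auto intro!: order_trans[OF w(3) abs_ge_self])
  have [measurable]: "fourier (f n) \<in> borel_measurable borel" for n
    by (rule borel_measurable_fourier[OF fi])
  have I: "(\<lambda>n. \<integral>x. cmod (f n x) powr q \<partial>lborel) \<longlonglongrightarrow> (\<integral>x. cmod (g x) powr q \<partial>lborel)"
  proof (rule integral_dominated_convergence[OF _ _ w(2)])
    show "AE x in lborel. (\<lambda>n. cmod (f n x) powr q) \<longlonglongrightarrow> cmod (g x) powr q"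
      by (rule AE_I2, rule tendsto_powr2) (use lim pq in \<open>auto intro: tendsto_norm\<close>)
    show "AE x in lborel. norm (cmod (f n x) powr q) \<le> w x powr q" for n
      using w(3) pq by (auto intro!: powr_mono2)
  qed auto
  have "(\<integral>\<^sup>+\<xi>. ennreal (cmod (fourier g \<xi>) powr p) \<partial>lborel)
      = (\<integral>\<^sup>+\<xi>. liminf (\<lambda>n. ennreal (cmod (fourier (f n) \<xi>) powr p)) \<partial>lborel)"
  proof (rule nn_integral_cong)
    fix \<xi>
    have "(\<lambda>n. cmod (fourier (f n) \<xi>) powr p) \<longlonglongrightarrow> cmod (fourier g \<xi>) powr p"
      by (rule tendsto_powr2[OF tendsto_norm[OF fourier_tendsto[OF f lim w(1,3)]] tendsto_const]) (use pq in auto)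
    from lim_imp_Liminf[OF _ tendsto_ennrealI[OF this]]
    show "ennreal (cmod (fourier g \<xi>) powr p) = liminf (\<lambda>n. ennreal (cmod (fourier (f n) \<xi>) powr p))" by simp
  qed
  also have "\<dots> \<le> liminf (\<lambda>n. \<integral>\<^sup>+\<xi>. ennreal (cmod (fourier (f n) \<xi>) powr p) \<partial>lborel)"
    by (rule nn_integral_liminf) measurable
  also have "\<dots> \<le> liminf (\<lambda>n. ennreal (K * (\<integral>x. cmod (f n x) powr q \<partial>lborel) powr (p / q)))"
    by (rule Liminf_mono) (use hy in auto)
  also have "\<dots> = ennreal (K * (\<integral>x. cmod (g x) powr q \<partial>lborel) powr (p / q))"
  proof (rule lim_imp_Liminf)
    have "(\<lambda>n. K * (\<integral>x. cmod (f n x) powr q \<partial>lborel) powr (p / q)) \<longlonglongrightarrow> K * (\<integral>x. cmod (g x) powr q \<partial>lborel) powr (p / q)"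
      by (rule tendsto_mult[OF tendsto_const tendsto_powr2[OF I tendsto_const]]) (use pq in auto)
    then show "(\<lambda>n. ennreal (K * (\<integral>x. cmod (f n x) powr q \<partial>lborel) powr (p / q)))
      \<longlonglongrightarrow> ennreal (K * (\<integral>x. cmod (g x) powr q \<partial>lborel) powr (p / q))" by (rule tendsto_ennrealI)
  qed simp
  finally show ?thesis .
qed

text \<open>The quotient \<open>u\<close> of f by the Gaussian is again continuous with compact
  support, hence bounded. Trigonometric polynomials approximate it on intervals growing with n, with
  error at most 1 / (n + 1), and their products with the Gaussian converge to f under the bound (B +
  1) times the Gaussian.\<close>

lemma hausdorff_young_compact:
  fixes p q :: real and f :: "real \<Rightarrow> complex"
  assumes q: "1 < q" "q < 2" and pq: "1 / p + 1 / q = 1"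
    and f: "continuous_on UNIV f" and R: "0 < R" and supp: "\<And>x. \<bar>x\<bar> \<ge> R \<Longrightarrow> f x = 0"
  shows "(\<integral>\<^sup>+\<xi>. ennreal (cmod (fourier f \<xi>) powr p) \<partial>lborel)
    \<le> ennreal (q powr (p / (2 * q)) / sqrt p * (\<integral>x. cmod (f x) powr q \<partial>lborel) powr (p / q))"
proof -
  have p: "p > 2" by (rule conjugate_exponent(2)[OF q pq])
  define G where "G x = complex_of_real (exp (- (x\<^sup>2 / (2 * q))))" for x
  define u where "u x = f x / G x" for x
  have G0: "G x \<noteq> 0" for x by (simp add: G_def)
  have cG: "continuous_on UNIV G" using q unfolding G_def by (intro continuous_intros) auto
  have cu: "continuous_on UNIV u" unfolding u_def using G0 by (intro continuous_intros f cG) auto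
  have us: "u x = 0" if "\<bar>x\<bar> \<ge> R" for x using supp[OF that] by (simp add: u_def)
  obtain B where B: "\<And>x. cmod (u x) \<le> B"
  proof -
    have "compact (u ` {-R..R})"
      by (rule compact_continuous_image[OF continuous_on_subset[OF cu]]) auto
    from compact_imp_bounded[OF this] obtain B where B: "\<forall>y\<in>u ` {-R..R}. cmod y \<le> B"
      unfolding bounded_iff by (elim exE)
    have "cmod (u x) \<le> max B 0" for x
    proof (cases "\<bar>x\<bar> \<ge> R")
      case False
      then have "x \<in> {-R..R}" by auto
      from bspec[OF B imageI[OF this]] show ?thesis by simp
    qed (simp add: us)
    then show thesis by (rule that)
  qed
  have "\<forall>n. \<exists>h. trig_poly h \<and> (\<forall>x. \<bar>x\<bar> < R + 1 + real n \<longrightarrow> cmod (u x - h x) < inverse (real (Suc n)))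
    \<and> (\<forall>x. cmod (h x) \<le> B + inverse (real (Suc n)))"
  proof
    fix n :: nat
    obtain h where "trig_poly h" "\<And>x. \<bar>x\<bar> < R + 1 + real n \<Longrightarrow> cmod (u x - h x) < inverse (real (Suc n))"
      "\<And>x. cmod (h x) \<le> B + inverse (real (Suc n))"
      by (rule trig_poly_approx[OF cu us R _ _ B, of "R + 1 + real n" "inverse (real (Suc n))"]) auto
    then show "\<exists>h. trig_poly h \<and> (\<forall>x. \<bar>x\<bar> < R + 1 + real n \<longrightarrow> cmod (u x - h x) < inverse (real (Suc n)))
      \<and> (\<forall>x. cmod (h x) \<le> B + inverse (real (Suc n)))" by blast
  qed
  then obtain h where h: "\<And>n. trig_poly (h n)"
    "\<And>n x. \<bar>x\<bar> < R + 1 + real n \<Longrightarrow> cmod (u x - h n x) < inverse (real (Suc n))"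
    "\<And>n x. cmod (h n x) \<le> B + inverse (real (Suc n))" by metis
  have hc: "continuous_on UNIV (h n)" for n
  proof -
    obtain J d where "h n = (\<lambda>x. \<Sum>\<theta>\<in>J. d \<theta> * cis (\<theta> * x))"
      using h(1)[of n] unfolding trig_poly_def by blast
    then show ?thesis by (auto intro!: continuous_intros)
  qed
  define a where "a = 1 / (2 * pi * q)"
  have a: "a > 0" using q by (simp add: a_def)
  have Ga: "cmod (G x) = exp (- (pi * a * x\<^sup>2))" for x by (simp add: a_def G_def)
  have Gaq: "cmod (G x) powr q = exp (- (pi * (a * q) * x\<^sup>2))" for x unfolding Ga by (simp add: powr_def)
  show ?thesis
  proof (rule hausdorff_young_limit[where f = "\<lambda>n x. h n x * G x" and w = "\<lambda>x. (B + 1) * cmod (G x)"])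
    show "(\<lambda>x. h n x * G x) \<in> borel_measurable borel" for n
      by (intro borel_measurable_continuous_onI continuous_intros hc cG)
    show "f \<in> borel_measurable borel" by (rule borel_measurable_continuous_onI[OF f])
    show "(\<lambda>n. h n x * G x) \<longlonglongrightarrow> f x" for x
    proof -
      have "(\<lambda>n. h n x) \<longlonglongrightarrow> u x"
      proof (rule LIM_zero_cancel, rule Lim_null_comparison[OF _ LIMSEQ_inverse_real_of_nat])
        obtain N where "\<bar>x\<bar> < real N" using reals_Archimedean2 by blast
        then show "eventually (\<lambda>n. norm (h n x - u x) \<le> inverse (real (Suc n))) sequentially"
        proof (intro eventually_sequentiallyI[of N])
          fix n assume "N \<le> n"
          then have "\<bar>x\<bar> < R + 1 + real n" using \<open>\<bar>x\<bar> < real N\<close> R by simp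
          from h(2)[OF this] show "norm (h n x - u x) \<le> inverse (real (Suc n))"
            by (simp add: norm_minus_commute)
        qed
      qed
      then have "(\<lambda>n. h n x * G x) \<longlonglongrightarrow> u x * G x" by (intro tendsto_intros)
      then show ?thesis using G0 by (simp add: u_def)
    qed
    show "integrable lborel (\<lambda>x. (B + 1) * cmod (G x))"
      unfolding Ga using integrable_gaussian[OF a] by simp
    show "integrable lborel (\<lambda>x. ((B + 1) * cmod (G x)) powr q)"
      unfolding powr_mult Gaq using integrable_gaussian[of "a * q"] a q by simp
    show "cmod (h n x * G x) \<le> (B + 1) * cmod (G x)" for n x
    proof -
      have "inverse (real (Suc n)) \<le> 1" by (simp add: field_simps)
      then show ?thesis using h(3)[of n x] by (simp add: norm_mult mult_right_mono)
    qed
    show "(\<integral>\<^sup>+\<xi>. ennreal (cmod (fourier (\<lambda>x. h n x * G x) \<xi>) powr p) \<partial>lborel)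
      \<le> ennreal (q powr (p / (2 * q)) / sqrt p * (\<integral>x. cmod (h n x * G x) powr q \<partial>lborel) powr (p / q))" for n
    proof -
      obtain J d where J: "finite J" "h n = (\<lambda>x. \<Sum>\<theta>\<in>J. d \<theta> * cis (\<theta> * x))"
        using h(1)[of n] unfolding trig_poly_def by blast
      show ?thesis unfolding J(2) G_def by (rule hausdorff_young_trig[OF q pq J(1)])
    qed
  qed (use p q in auto)
qed

text \<open>Reduced to compact support by the piecewise linear cut-offs \<open>\<eta> n\<close>,
  equal to 1 up to |x| = n and to 0 from n + 1 on. The p-th root of the constant is (q^(1/q) /
  p^(1/p))^(1/2).\<close>

lemma hausdorff_young_sharp:
  fixes p q :: real and f :: "real \<Rightarrow> complex"
  assumes q: "1 < q" "q < 2" and pq: "1 / p + 1 / q = 1"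
    and f: "continuous_on UNIV f" "integrable lborel f" "integrable lborel (\<lambda>x. cmod (f x) powr q)"
  shows "(\<integral>\<^sup>+\<xi>. ennreal (cmod (fourier f \<xi>) powr p) \<partial>lborel)
    \<le> ennreal (q powr (p / (2 * q)) / sqrt p * (\<integral>x. cmod (f x) powr q \<partial>lborel) powr (p / q))"
proof -
  have p: "p > 2" by (rule conjugate_exponent(2)[OF q pq])
  define \<eta> :: "nat \<Rightarrow> real \<Rightarrow> real" where "\<eta> n x = max 0 (min 1 (real n + 1 - \<bar>x\<bar>))" for n x
  have \<eta>c: "continuous_on UNIV (\<lambda>x. complex_of_real (\<eta> n x) * f x)" for n
    unfolding \<eta>_def by (intro continuous_intros f)
  show ?thesis
  proof (rule hausdorff_young_limit[where f = "\<lambda>n x. complex_of_real (\<eta> n x) * f x" and w = "\<lambda>x. cmod (f x)"])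
    show "(\<lambda>x. complex_of_real (\<eta> n x) * f x) \<in> borel_measurable borel" for n
      by (rule borel_measurable_continuous_onI[OF \<eta>c])
    show "f \<in> borel_measurable borel" by (rule borel_measurable_continuous_onI[OF f(1)])
    show "(\<lambda>n. complex_of_real (\<eta> n x) * f x) \<longlonglongrightarrow> f x" for x
    proof (rule tendsto_eventually)
      obtain N where "\<bar>x\<bar> < real N" using reals_Archimedean2 by blast
      then show "eventually (\<lambda>n. complex_of_real (\<eta> n x) * f x = f x) sequentially"
        by (intro eventually_sequentiallyI[of N]) (auto simp: \<eta>_def)
    qed
    show "integrable lborel (\<lambda>x. cmod (f x))" using f(2) by simp
    show "cmod (complex_of_real (\<eta> n x) * f x) \<le> cmod (f x)" for n x
      using mult_right_mono[of "\<eta> n x" 1 "cmod (f x)"] by (auto simp: norm_mult \<eta>_def)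
    show "(\<integral>\<^sup>+\<xi>. ennreal (cmod (fourier (\<lambda>x. complex_of_real (\<eta> n x) * f x) \<xi>) powr p) \<partial>lborel)
      \<le> ennreal (q powr (p / (2 * q)) / sqrt p * (\<integral>x. cmod (complex_of_real (\<eta> n x) * f x) powr q \<partial>lborel) powr (p / q))" for n
      by (rule hausdorff_young_compact[OF q pq \<eta>c, of "real n + 1"]) (auto simp: \<eta>_def)
  qed (use p q f in auto)
qed

section \<open>Plancherel's theorem\<close>

text \<open>Fubini's theorem; the kernel has modulus 1, so the double integrand is dominated by a
  product. This formula takes the place of Fourier inversion in the proof of Plancherel's
  theorem.\<close>

lemma fourier_multiplication:
  assumes f: "integrable lborel f" and g: "integrable lborel g"
  shows "(\<integral>\<xi>. fourier f \<xi> * g \<xi> \<partial>lborel) = (\<integral>x. f x * fourier g x \<partial>lborel)"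
proof -
  define h where "h x \<xi> = f x * g \<xi> * exp (- 2 * complex_of_real pi * \<i> * complex_of_real (x * \<xi>))" for x \<xi>
  have [measurable]: "f \<in> borel_measurable borel" "g \<in> borel_measurable borel"
    using f g borel_measurable_integrable by force+
  have hm: "case_prod h \<in> borel_measurable (lborel \<Otimes>\<^sub>M lborel)"
    unfolding h_def fourier_kernel_cis by measurable
  have norm_h: "cmod (h x \<xi>) = cmod (f x) * cmod (g \<xi>)" for x \<xi>
    unfolding h_def by (simp add: norm_mult del: of_real_mult)
  have hi: "integrable (lborel \<Otimes>\<^sub>M lborel) (case_prod h)"
  proof (rule lborel_pair.Fubini_integrable[OF hm])
    show "integrable lborel (\<lambda>x. \<integral>y. cmod (case (x, y) of (x, y) \<Rightarrow> h x y) \<partial>lborel)"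
      using f by (simp add: norm_h)
    have "integrable lborel (\<lambda>y. f x * (g y * exp (- 2 * complex_of_real pi * \<i> * complex_of_real (y * x))))" for x
      by (intro integrable_mult_right integrable_fourier_integrand g)
    then show "AE x in lborel. integrable lborel (\<lambda>y. case (x, y) of (x, y) \<Rightarrow> h x y)"
      by (intro AE_I2) (simp add: h_def mult_ac)
  qed
  have "(\<integral>x. h x \<xi> \<partial>lborel) = fourier f \<xi> * g \<xi>" for \<xi>
  proof -
    have "h x \<xi> = f x * exp (- 2 * complex_of_real pi * \<i> * complex_of_real (x * \<xi>)) * g \<xi>" for x
      by (simp only: h_def mult_ac)
    then show ?thesis by (simp only: fourier_def integral_mult_left_zero)
  qed
  moreover have "(\<integral>\<xi>. h x \<xi> \<partial>lborel) = f x * fourier g x" for x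
  proof -
    have "h x \<xi> = f x * (g \<xi> * exp (- 2 * complex_of_real pi * \<i> * complex_of_real (\<xi> * x)))" for \<xi>
      by (simp only: h_def mult_ac)
    then show ?thesis by (simp only: fourier_def integral_mult_right_zero)
  qed
  ultimately show ?thesis using lborel_pair.Fubini_integral[OF hi] by simp
qed

text \<open>The Gaussian factor makes all integrals absolutely convergent; Plancherel is the limit \<open>a \<rightarrow> 0\<close>.\<close>
lemma fourier_square_gaussian:
  assumes f: "integrable lborel f" and a: "a > 0"
  shows "integrable lborel (\<lambda>\<xi>. (cmod (fourier f \<xi>))\<^sup>2 * exp (- (pi * a * \<xi>\<^sup>2)))"
    and "complex_of_real (\<integral>\<xi>. (cmod (fourier f \<xi>))\<^sup>2 * exp (- (pi * a * \<xi>\<^sup>2)) \<partial>lborel)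
      = (\<integral>x. f x * cnj (\<integral>u. f (x + sqrt a * u) * complex_of_real (exp (- (pi * 1 * u\<^sup>2))) \<partial>lborel) \<partial>lborel)"
proof -
  have [measurable]: "f \<in> borel_measurable borel" "fourier f \<in> borel_measurable borel"
    using f borel_measurable_integrable by force+
  define E where "E \<xi> = complex_of_real (exp (- (pi * a * \<xi>\<^sup>2)))" for \<xi>
  have E: "integrable lborel E" unfolding E_def using integrable_gaussian[OF a] by (rule integrable_of_real)
  define M where "M = (\<integral>x. cmod (f x) \<partial>lborel)"
  have M: "cmod (fourier f \<xi>) \<le> M" for \<xi> unfolding M_def by (rule norm_fourier_le)
  have M0: "M \<ge> 0" by (rule order_trans[OF norm_ge_zero M])
  show i: "integrable lborel (\<lambda>\<xi>. (cmod (fourier f \<xi>))\<^sup>2 * exp (- (pi * a * \<xi>\<^sup>2)))"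
  proof (rule Bochner_Integration.integrable_bound)
    show "integrable lborel (\<lambda>\<xi>. M\<^sup>2 * exp (- (pi * a * \<xi>\<^sup>2)))" using integrable_gaussian[OF a] by simp
    show "AE \<xi> in lborel. norm ((cmod (fourier f \<xi>))\<^sup>2 * exp (- (pi * a * \<xi>\<^sup>2))) \<le> norm (M\<^sup>2 * exp (- (pi * a * \<xi>\<^sup>2)))"
      using M by (auto simp: power_mono)
  qed measurable
  \<comment> \<open>Chosen so that \<open>fourier f \<xi> * g \<xi>\<close> is the weighted square
    modulus; the multiplication formula then moves the transform from f to \<open>g\<close>.\<close>
  define g where "g \<xi> = cnj (fourier f \<xi>) * E \<xi>" for \<xi>
  have [measurable]: "E \<in> borel_measurable borel" using E borel_measurable_integrable by force
  have [measurable]: "g \<in> borel_measurable borel"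
    unfolding g_def by (rule borel_measurable_times) (auto intro!: borel_measurable_continuous_on[of cnj] continuous_intros)
  have g: "integrable lborel g"
  proof (rule Bochner_Integration.integrable_bound)
    show "integrable lborel (\<lambda>\<xi>. M *\<^sub>R E \<xi>)" using E by simp
    show "AE \<xi> in lborel. norm (g \<xi>) \<le> norm (M *\<^sub>R E \<xi>)"
      using M M0 by (auto simp: g_def norm_mult mult_right_mono)
  qed measurable
  \<comment> \<open>The transform of \<open>g\<close> is the conjugate of f averaged against a
    Gaussian around x. The substitution y = x + sqrt a * u puts the dependence on a into the
    argument of f, ready for a limit with a fixed dominating Gaussian.\<close>
  have gx: "fourier g x = cnj (\<integral>u. f (x + sqrt a * u) * complex_of_real (exp (- (pi * 1 * u\<^sup>2))) \<partial>lborel)" for x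
  proof -
    have i1: "integrable lborel (\<lambda>\<xi>. cis (2 * pi * x * \<xi>) * E \<xi>)"
      by (rule Bochner_Integration.integrable_bound[OF E]) (auto simp: norm_mult)
    have "fourier g x = cnj (\<integral>\<xi>. fourier f \<xi> * (cis (2 * pi * x * \<xi>) * E \<xi>) \<partial>lborel)"
    proof -
      have "g \<xi> * cis (- (2 * pi * x * \<xi>)) = cnj (fourier f \<xi> * (cis (2 * pi * x * \<xi>) * E \<xi>))" for \<xi>
        by (simp add: g_def E_def cis_cnj mult_ac)
      then show ?thesis unfolding fourier_def[of g] fourier_kernel_cis by (simp only: Bochner_Integration.integral_cnj)
    qed
    also have "(\<integral>\<xi>. fourier f \<xi> * (cis (2 * pi * x * \<xi>) * E \<xi>) \<partial>lborel) = (\<integral>y. f y * fourier (\<lambda>\<xi>. cis (2 * pi * x * \<xi>) * E \<xi>) y \<partial>lborel)"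
      by (rule fourier_multiplication[OF f i1])
    also have "\<dots> = (\<integral>y. f y * complex_of_real (1 / sqrt a * exp (- (pi * (y - x)\<^sup>2 / a))) \<partial>lborel)"
      unfolding fourier_modulation E_def fourier_gaussian[OF a] by simp
    also have "\<dots> = \<bar>sqrt a\<bar> *\<^sub>R (\<integral>u. f (x + sqrt a * u) * complex_of_real (1 / sqrt a * exp (- (pi * ((x + sqrt a * u) - x)\<^sup>2 / a))) \<partial>lborel)"
      by (rule lborel_integral_real_affine) (use a in simp)
    also have "\<dots> = (\<integral>u. \<bar>sqrt a\<bar> *\<^sub>R (f (x + sqrt a * u) * complex_of_real (1 / sqrt a * exp (- (pi * ((x + sqrt a * u) - x)\<^sup>2 / a)))) \<partial>lborel)"
      by (rule integral_scaleR_right[symmetric])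
    also have "\<dots> = (\<integral>u. f (x + sqrt a * u) * complex_of_real (exp (- (pi * 1 * u\<^sup>2))) \<partial>lborel)"
      using a by (simp add: power_mult_distrib scaleR_conv_of_real)
    finally show ?thesis .
  qed
  have "complex_of_real (\<integral>\<xi>. (cmod (fourier f \<xi>))\<^sup>2 * exp (- (pi * a * \<xi>\<^sup>2)) \<partial>lborel)
     = (\<integral>\<xi>. fourier f \<xi> * g \<xi> \<partial>lborel)"
    unfolding integral_complex_of_real[symmetric] g_def E_def
    by (simp add: complex_norm_square[symmetric] mult.assoc[symmetric])
  also have "\<dots> = (\<integral>x. f x * fourier g x \<partial>lborel)" by (rule fourier_multiplication[OF f g])
  finally show "complex_of_real (\<integral>\<xi>. (cmod (fourier f \<xi>))\<^sup>2 * exp (- (pi * a * \<xi>\<^sup>2)) \<partial>lborel)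
      = (\<integral>x. f x * cnj (\<integral>u. f (x + sqrt a * u) * complex_of_real (exp (- (pi * 1 * u\<^sup>2))) \<partial>lborel) \<partial>lborel)"
    unfolding gx .
qed

text \<open>As the parameter decreases to 0, the averages of f converge to f by continuity and stay
  bounded by B, so the right-hand side of \<open>fourier_square_gaussian\<close> tends to the
  integral of |f|^2. On the frequency side the weights increase to 1, and monotone convergence
  yields integrability together with the value.\<close>

lemma plancherel:
  fixes f :: "real \<Rightarrow> complex"
  assumes c: "continuous_on UNIV f" and f: "integrable lborel f" and B: "\<And>x. cmod (f x) \<le> B"
  shows "integrable lborel (\<lambda>\<xi>. (cmod (fourier f \<xi>))\<^sup>2)"
    and "(\<integral>\<xi>. (cmod (fourier f \<xi>))\<^sup>2 \<partial>lborel) = (\<integral>x. (cmod (f x))\<^sup>2 \<partial>lborel)"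
proof -
  have [measurable]: "f \<in> borel_measurable borel" "fourier f \<in> borel_measurable borel"
    using f borel_measurable_integrable by force+
  define e where "e n = inverse (real (Suc n))" for n
  have e: "e n > 0" for n by (simp add: e_def)
  have e0: "e \<longlonglongrightarrow> 0" unfolding e_def by (rule LIMSEQ_inverse_real_of_nat)
  define J where "J n = (\<integral>\<xi>. (cmod (fourier f \<xi>))\<^sup>2 * exp (- (pi * e n * \<xi>\<^sup>2)) \<partial>lborel)" for n
  define A where "A n x = (\<integral>u. f (x + sqrt (e n) * u) * complex_of_real (exp (- (pi * 1 * u\<^sup>2))) \<partial>lborel)" for n x
  have i1: "integrable lborel (\<lambda>u. B * exp (- (pi * 1 * u\<^sup>2)))" using integrable_gaussian[of 1] by simp
  have fc: "isCont f x" for x using c by (simp add: continuous_on_eq_continuous_at)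
  have A_lim: "(\<lambda>n. A n x) \<longlonglongrightarrow> f x" for x
  proof -
    have "(\<lambda>n. A n x) \<longlonglongrightarrow> (\<integral>u. f x * complex_of_real (exp (- (pi * 1 * u\<^sup>2))) \<partial>lborel)"
      unfolding A_def
    proof (rule integral_dominated_convergence[OF _ _ i1])
      show "AE u in lborel. (\<lambda>n. f (x + sqrt (e n) * u) * complex_of_real (exp (- (pi * 1 * u\<^sup>2))))
        \<longlonglongrightarrow> f x * complex_of_real (exp (- (pi * 1 * u\<^sup>2)))"
      proof (intro AE_I2 tendsto_mult tendsto_const isCont_tendsto_compose[OF fc])
        fix u
        have "(\<lambda>n. x + sqrt (e n) * u) \<longlonglongrightarrow> x + sqrt 0 * u" by (intro tendsto_intros e0)
        then show "(\<lambda>n. x + sqrt (e n) * u) \<longlonglongrightarrow> x" by simp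
      qed
    qed (use B in \<open>auto simp: norm_mult intro!: mult_right_mono\<close>)
    also have "(\<integral>u. f x * complex_of_real (exp (- (pi * 1 * u\<^sup>2))) \<partial>lborel) = f x * complex_of_real (\<integral>u. exp (- (pi * 1 * u\<^sup>2)) \<partial>lborel)"
      unfolding integral_complex_of_real[symmetric] by (rule integral_mult_right_zero)
    also have "(\<integral>u. exp (- (pi * 1 * u\<^sup>2)) \<partial>lborel) = 1" using integral_gaussian[of 1] by simp
    finally show ?thesis by simp
  qed
  have A_bound: "cmod (A n x) \<le> B" for n x
  proof -
    have "cmod (A n x) \<le> (\<integral>u. B * exp (- (pi * 1 * u\<^sup>2)) \<partial>lborel)"
      unfolding A_def
    proof (rule Bochner_Integration.integral_norm_bound_integral[OF _ i1])
      have le: "cmod (f (x + sqrt (e n) * u) * complex_of_real (exp (- (pi * 1 * u\<^sup>2)))) \<le> B * exp (- (pi * 1 * u\<^sup>2))" for u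
        using B by (simp add: norm_mult mult_right_mono)
      then show "cmod (f (x + sqrt (e n) * u) * complex_of_real (exp (- (pi * 1 * u\<^sup>2)))) \<le> B * exp (- (pi * 1 * u\<^sup>2))" for u .
      show "integrable lborel (\<lambda>u. f (x + sqrt (e n) * u) * complex_of_real (exp (- (pi * 1 * u\<^sup>2))))"
      proof (rule Bochner_Integration.integrable_bound[OF i1])
        show "AE u in lborel. cmod (f (x + sqrt (e n) * u) * complex_of_real (exp (- (pi * 1 * u\<^sup>2)))) \<le> norm (B * exp (- (pi * 1 * u\<^sup>2)))"
          by (intro AE_I2 order_trans[OF le]) simp
      qed measurable
    qed
    then show ?thesis using integral_gaussian[of 1] by simp
  qed
  have A_meas: "A n \<in> borel_measurable borel" for n
    unfolding A_def by measurable
  have "(\<lambda>n. complex_of_real (J n)) \<longlonglongrightarrow> (\<integral>x. f x * cnj (f x) \<partial>lborel)"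
    unfolding J_def fourier_square_gaussian(2)[OF f e] A_def[symmetric]
  proof (rule integral_dominated_convergence[where w = "\<lambda>x. cmod (f x) * B"])
    show "AE x in lborel. (\<lambda>n. f x * cnj (A n x)) \<longlonglongrightarrow> f x * cnj (f x)"
      by (intro AE_I2 tendsto_mult tendsto_const tendsto_cnj A_lim)
    show "AE x in lborel. cmod (f x * cnj (A n x)) \<le> cmod (f x) * B" for n
      using A_bound by (auto simp: norm_mult intro!: mult_left_mono)
    show "(\<lambda>x. f x * cnj (f x)) \<in> borel_measurable lborel"
      by (auto intro!: borel_measurable_times borel_measurable_continuous_on[of cnj] continuous_intros)
    show "(\<lambda>x. f x * cnj (A n x)) \<in> borel_measurable lborel" for n
      using A_meas[of n] by (auto intro!: borel_measurable_times borel_measurable_continuous_on[of cnj] continuous_intros)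
  qed (use f in simp)
  also have "(\<integral>x. f x * cnj (f x) \<partial>lborel) = complex_of_real (\<integral>x. (cmod (f x))\<^sup>2 \<partial>lborel)"
    unfolding integral_complex_of_real[symmetric] by (simp add: complex_norm_square[symmetric])
  finally have J: "J \<longlonglongrightarrow> (\<integral>x. (cmod (f x))\<^sup>2 \<partial>lborel)"
    by (simp only: tendsto_of_real_iff)
  have *: "integrable lborel (\<lambda>\<xi>. (cmod (fourier f \<xi>))\<^sup>2) \<and> (\<integral>\<xi>. (cmod (fourier f \<xi>))\<^sup>2 \<partial>lborel) = (\<integral>x. (cmod (f x))\<^sup>2 \<partial>lborel)"
  proof (intro conjI)
    have m: "AE \<xi> in lborel. mono (\<lambda>n. (cmod (fourier f \<xi>))\<^sup>2 * exp (- (pi * e n * \<xi>\<^sup>2)))"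
    proof (intro AE_I2 monoI mult_left_mono)
      fix \<xi> :: real and n m :: nat assume "n \<le> m"
      then have "e m \<le> e n" by (simp add: e_def)
      then show "exp (- (pi * e n * \<xi>\<^sup>2)) \<le> exp (- (pi * e m * \<xi>\<^sup>2))" by (auto intro!: mult_right_mono)
    qed auto
    have l: "AE \<xi> in lborel. (\<lambda>n. (cmod (fourier f \<xi>))\<^sup>2 * exp (- (pi * e n * \<xi>\<^sup>2))) \<longlonglongrightarrow> (cmod (fourier f \<xi>))\<^sup>2"
    proof (rule AE_I2)
      fix \<xi> :: real
      have "(\<lambda>n. (cmod (fourier f \<xi>))\<^sup>2 * exp (- (pi * e n * \<xi>\<^sup>2))) \<longlonglongrightarrow> (cmod (fourier f \<xi>))\<^sup>2 * exp (- (pi * 0 * \<xi>\<^sup>2))"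
        by (intro tendsto_intros e0)
      then show "(\<lambda>n. (cmod (fourier f \<xi>))\<^sup>2 * exp (- (pi * e n * \<xi>\<^sup>2))) \<longlonglongrightarrow> (cmod (fourier f \<xi>))\<^sup>2" by simp
    qed
    show "integrable lborel (\<lambda>\<xi>. (cmod (fourier f \<xi>))\<^sup>2)"
      by (rule integrable_monotone_convergence[OF fourier_square_gaussian(1)[OF f e] m l J[unfolded J_def]]) simp
    show "(\<integral>\<xi>. (cmod (fourier f \<xi>))\<^sup>2 \<partial>lborel) = (\<integral>x. (cmod (f x))\<^sup>2 \<partial>lborel)"
      by (rule integral_monotone_convergence[OF fourier_square_gaussian(1)[OF f e] m l J[unfolded J_def]]) simp
  qed
  then show "integrable lborel (\<lambda>\<xi>. (cmod (fourier f \<xi>))\<^sup>2)"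
    "(\<integral>\<xi>. (cmod (fourier f \<xi>))\<^sup>2 \<partial>lborel) = (\<integral>x. (cmod (f x))\<^sup>2 \<partial>lborel)" by blast+
qed

text \<open>A common class for a Schwartz function, its derivatives and its Fourier transform. It
  lies in every L^r with r >= 1, so the transform need not be shown to be Schwartz.\<close>

definition quad_decay :: "(real \<Rightarrow> complex) \<Rightarrow> bool" where
  "quad_decay g \<longleftrightarrow> continuous_on UNIV g \<and> (\<exists>C. \<forall>x. (1 + x\<^sup>2) * cmod (g x) \<le> C)"

lemma quad_decay_bounds:
  assumes "quad_decay g"
  obtains C where "C > 0" "\<And>x. cmod (g x) \<le> C * inverse (1 + x\<^sup>2)" "\<And>x. cmod (g x) \<le> C"
proof -
  obtain C where C: "\<And>x. (1 + x\<^sup>2) * cmod (g x) \<le> C" using assms unfolding quad_decay_def by blast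
  have pos: "1 + x\<^sup>2 > 0" for x :: real by (simp add: add_pos_nonneg)
  have C0: "C \<ge> 0" using order_trans[OF norm_ge_zero, of "g 0" C] C[of 0] by simp
  have 1: "cmod (g x) \<le> (C + 1) * inverse (1 + x\<^sup>2)" for x
    using C[of x] pos[of x] by (simp add: field_simps)
  have "inverse (1 + x\<^sup>2) \<le> 1" for x :: real by (simp add: inverse_le_1_iff)
  then have "cmod (g x) \<le> C + 1" for x
    using order_trans[OF 1[of x], of "C + 1"] C0 mult_left_mono[of "inverse (1 + x\<^sup>2)" 1 "C + 1"] by simp
  with 1 C0 show thesis by (intro that[of "C + 1"]) auto
qed

lemma quad_decay_powr_integrable:
  assumes g: "quad_decay g" and r: "1 \<le> r"
  shows "integrable lborel (\<lambda>x. cmod (g x) powr r)"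
proof -
  obtain C where C: "C > 0" "\<And>x. cmod (g x) \<le> C * inverse (1 + x\<^sup>2)" "\<And>x. cmod (g x) \<le> C"
    by (rule quad_decay_bounds[OF g]) blast
  have [measurable]: "g \<in> borel_measurable borel"
    using g unfolding quad_decay_def by (intro borel_measurable_continuous_onI) auto
  have "integrable lborel (\<lambda>x::real. inverse (1 + x\<^sup>2))"
    using integrable_inverse_1_plus_square unfolding set_integrable_def einterval_eq by simp
  then have "integrable lborel (\<lambda>x. C powr r * inverse (1 + x\<^sup>2))" by simp
  then show ?thesis
  proof (rule Bochner_Integration.integrable_bound)
    show "AE x in lborel. norm (cmod (g x) powr r) \<le> norm (C powr r * inverse (1 + x\<^sup>2))"
    proof (rule AE_I2)
      fix x :: real
      have i: "0 < inverse (1 + x\<^sup>2)" "inverse (1 + x\<^sup>2) \<le> 1" by (auto simp: inverse_le_1_iff add_pos_nonneg)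
      have "cmod (g x) powr r \<le> (C * inverse (1 + x\<^sup>2)) powr r" using C(2) r by (intro powr_mono2) auto
      also have "\<dots> = C powr r * inverse (1 + x\<^sup>2) powr r" by (simp add: powr_mult)
      \<comment> \<open>A base in (0, 1] makes the power with exponent r >= 1 no larger than the
        first power.\<close>
      also have "\<dots> \<le> C powr r * inverse (1 + x\<^sup>2) powr 1"
        using i r by (intro mult_left_mono powr_mono') auto
      finally show "norm (cmod (g x) powr r) \<le> norm (C powr r * inverse (1 + x\<^sup>2))"
        using i C(1) by (simp add: abs_mult)
    qed
  qed measurable
qed

lemma quad_decay_integrable:
  assumes "quad_decay g"
  shows "integrable lborel g"
proof -
  have "g \<in> borel_measurable borel"
    using assms unfolding quad_decay_def by (intro borel_measurable_continuous_onI) auto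
  moreover have "integrable lborel (\<lambda>x. cmod (g x))"
    using quad_decay_powr_integrable[OF assms, of 1] by simp
  ultimately show ?thesis by (simp add: integrable_norm_iff)
qed

lemma continuous_AE_zero:
  fixes g :: "real \<Rightarrow> complex"
  assumes "continuous_on UNIV g" "AE x in lborel. g x = 0"
  shows "g = (\<lambda>x. 0)"
proof
  fix x
  have "closed (g -` {0})" using assms(1) by (intro closed_vimage) auto
  moreover have "AE x in lebesgue. x \<in> g -` {0}" using assms(2) by (auto dest: AE_completion)
  ultimately have "x \<in> g -` {0}" by (rule mem_closed_if_AE_lebesgue)
  then show "g x = 0" by simp
qed

lemma quad_decay_integral_pos:
  assumes g: "quad_decay g" "g \<noteq> (\<lambda>x. 0)" and r: "1 \<le> r"
  shows "0 < (\<integral>x. cmod (g x) powr r \<partial>lborel)"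
proof (rule ccontr)
  assume "\<not> ?thesis"
  moreover have "0 \<le> (\<integral>x. cmod (g x) powr r \<partial>lborel)" by (rule Bochner_Integration.integral_nonneg) simp
  ultimately have "(\<integral>x. cmod (g x) powr r \<partial>lborel) = 0" by linarith
  then have "AE x in lborel. cmod (g x) powr r = 0"
    by (subst (asm) integral_nonneg_eq_0_iff_AE[OF quad_decay_powr_integrable[OF g(1) r]]) auto
  then have "AE x in lborel. g x = 0" by simp
  then show False using continuous_AE_zero g unfolding quad_decay_def by blast
qed

section \<open>The lower bound\<close>

lemma schwartz_quad_decay:
  assumes "schwartz f"
  shows "quad_decay (rderiv n f)"
  unfolding quad_decay_def
proof
  have "rderiv n f differentiable (at x)" for x using assms unfolding schwartz_def by blast
  then show "continuous_on UNIV (rderiv n f)"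
    by (intro continuous_at_imp_continuous_on ballI differentiable_imp_continuous_within)
  obtain C where C: "\<And>x. \<bar>x\<bar> ^ 0 * norm (rderiv n f x) \<le> C" using assms unfolding schwartz_def by metis
  obtain D where D: "\<And>x. \<bar>x\<bar> ^ 2 * norm (rderiv n f x) \<le> D" using assms unfolding schwartz_def by metis
  have "(1 + x\<^sup>2) * cmod (rderiv n f x) \<le> C + D" for x
    using C[of x] D[of x] by (simp add: algebra_simps)
  then show "\<exists>C. \<forall>x. (1 + x\<^sup>2) * cmod (rderiv n f x) \<le> C" by blast
qed

text \<open>Integration by parts: the derivative of f times the kernel integrates to 0 over the
  line, as the product tends to 0 at both ends.\<close>

lemma fourier_vector_derivative:
  assumes f: "quad_decay f" and g: "quad_decay g" and d: "\<And>x. (f has_vector_derivative g x) (at x)"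
  shows "fourier g \<xi> = 2 * pi * \<i> * \<xi> * fourier f \<xi>"
proof -
  define c where "c = - 2 * complex_of_real pi * \<i> * \<xi>"
  define e where "e x = exp (c * complex_of_real x)" for x
  have e_eq: "exp (- 2 * complex_of_real pi * \<i> * complex_of_real (x * \<xi>)) = e x" for x
    by (simp add: e_def c_def mult_ac)
  have ne: "cmod (e x) = 1" for x unfolding e_eq[symmetric] by (rule norm_fourier_kernel)
  have de: "(e has_vector_derivative c * e x) (at x)" for x
    unfolding e_def by (rule has_vector_derivative_real_field) (auto intro!: derivative_eq_intros)
  define F' where "F' x = f x * (c * e x) + g x * e x" for x
  have dF: "((\<lambda>x. f x * e x) has_vector_derivative F' x) (at x)" for x
    unfolding F'_def by (rule has_vector_derivative_mult[OF d de])
  have fc: "continuous_on UNIV f" and gc: "continuous_on UNIV g"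
    using f g unfolding quad_decay_def by auto
  have ec: "continuous_on UNIV e" unfolding e_def by (intro continuous_intros)
  have F'c: "continuous_on UNIV F'" unfolding F'_def by (intro continuous_intros fc gc ec)
  note fi = integrable_fourier_integrand[OF quad_decay_integrable[OF f], of \<xi>, unfolded e_eq]
  note gi = integrable_fourier_integrand[OF quad_decay_integrable[OF g], of \<xi>, unfolded e_eq]
  have F'_eq: "F' x = c * (f x * e x) + g x * e x" for x by (simp add: F'_def)
  have F'i: "integrable lborel F'" unfolding F'_eq by (intro Bochner_Integration.integrable_add integrable_mult_right fi gi)
  obtain C where C: "C > 0" "\<And>x. cmod (f x) \<le> C * inverse (1 + x\<^sup>2)" "\<And>x. cmod (f x) \<le> C"
    by (rule quad_decay_bounds[OF f]) blast
  have lim: "((\<lambda>x. f x * e x) \<longlongrightarrow> 0) at_top" "((\<lambda>x. f x * e x) \<longlongrightarrow> 0) at_bot"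
  proof -
    have b: "\<forall>\<^sub>F x in F. norm (f x * e x) \<le> C * inverse (1 + x\<^sup>2)" for F
      using C(2) by (simp add: norm_mult ne)
    have "((\<lambda>x. C * inverse (1 + x\<^sup>2)) \<longlongrightarrow> 0) at_top" "((\<lambda>x. C * inverse (1 + x\<^sup>2)) \<longlongrightarrow> 0) at_bot"
      by real_asymp+
    then show "((\<lambda>x. f x * e x) \<longlongrightarrow> 0) at_top" "((\<lambda>x. f x * e x) \<longlongrightarrow> 0) at_bot"
      using Lim_null_comparison[OF b] by blast+
  qed
  have "(LBINT x=-\<infinity>..\<infinity>. F' x) = 0 - 0"
  proof (rule interval_integral_FTC_integrable[where F = "\<lambda>x. f x * e x"])
    show "isCont F' x" for x using F'c by (simp add: continuous_on_eq_continuous_at)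
    show "set_integrable lborel (einterval (- \<infinity>) \<infinity>) F'" using F'i by (simp add: set_integrable_def)
  qed (use dF lim in \<open>simp_all add: ereal_tendsto_simps\<close>)
  then have "(\<integral>x. F' x \<partial>lborel) = 0"
    by (simp add: interval_lebesgue_integral_def set_lebesgue_integral_def)
  then have "c * (\<integral>x. f x * e x \<partial>lborel) + (\<integral>x. g x * e x \<partial>lborel) = 0"
    unfolding F'_eq using fi gi by simp
  then have "c * fourier f \<xi> + fourier g \<xi> = 0" unfolding fourier_def e_eq .
  then have "fourier g \<xi> = - c * fourier f \<xi>" by (simp add: eq_neg_iff_add_eq_0 add.commute)
  then show ?thesis by (simp add: c_def)
qed

text \<open>The transform of the second derivative is bounded and has modulus (2 pi \<xi>)^2 times
  that of the transform of f, which controls the growing term.\<close>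

lemma schwartz_fourier_quad_decay:
  assumes "schwartz f"
  shows "quad_decay (fourier f)"
  unfolding quad_decay_def
proof
  note D = schwartz_quad_decay[OF assms]
  have d: "(rderiv n f has_vector_derivative rderiv (Suc n) f x) (at x)" for n x
    using assms unfolding schwartz_def by (simp add: vector_derivative_works)
  show "continuous_on UNIV (fourier f)"
    using continuous_fourier[OF quad_decay_integrable[OF D[of 0]]] by simp
  define C0 C2 where "C0 = (\<integral>x. cmod (f x) \<partial>lborel)" and "C2 = (\<integral>x. cmod (rderiv 2 f x) \<partial>lborel)"
  have "(1 + \<xi>\<^sup>2) * cmod (fourier f \<xi>) \<le> C0 + C2" for \<xi>
  proof -
    have "fourier (rderiv 2 f) \<xi> = (2 * pi * \<i> * \<xi>) * ((2 * pi * \<i> * \<xi>) * fourier f \<xi>)"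
      using fourier_vector_derivative[OF D D d, of 0 \<xi>] fourier_vector_derivative[OF D D d, of "Suc 0" \<xi>]
      by (simp add: numeral_2_eq_2)
    then have "cmod (fourier (rderiv 2 f) \<xi>) = (2 * pi)\<^sup>2 * \<xi>\<^sup>2 * cmod (fourier f \<xi>)"
      by (simp add: norm_mult power2_eq_square)
    moreover have "(2 * pi)\<^sup>2 \<ge> 1"
      using pi_ge_two by (intro one_le_power) simp
    then have "(2 * pi)\<^sup>2 * \<xi>\<^sup>2 * cmod (fourier f \<xi>) \<ge> 1 * \<xi>\<^sup>2 * cmod (fourier f \<xi>)"
      by (intro mult_right_mono) auto
    moreover have "cmod (fourier (rderiv 2 f) \<xi>) \<le> C2" unfolding C2_def by (rule norm_fourier_le)
    moreover have "cmod (fourier f \<xi>) \<le> C0" unfolding C0_def by (rule norm_fourier_le)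
    ultimately show ?thesis by (simp add: algebra_simps)
  qed
  then show "\<exists>C. \<forall>\<xi>. (1 + \<xi>\<^sup>2) * cmod (fourier f \<xi>) \<le> C" by blast
qed

lemma Lnorm_2: "Lnorm 2 g = (\<integral>x. (cmod (g x))\<^sup>2 \<partial>lborel) powr (1 / 2)"
proof -
  have "(2 :: ereal) = ereal 2" by simp
  then show ?thesis unfolding Lnorm_def by simp
qed

lemma quad_decay_square_pos:
  assumes "quad_decay g" "g \<noteq> (\<lambda>x. 0)"
  shows "0 < (\<integral>x. (cmod (g x))\<^sup>2 \<partial>lborel)"
  using quad_decay_integral_pos[OF assms, of 2] by simp

lemma schwartz_plancherel:
  assumes "schwartz f"
  shows "(\<integral>\<xi>. (cmod (fourier f \<xi>))\<^sup>2 \<partial>lborel) = (\<integral>x. (cmod (f x))\<^sup>2 \<partial>lborel)"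
proof -
  have q: "quad_decay f" using schwartz_quad_decay[OF assms, of 0] by simp
  obtain C where "\<And>x. cmod (f x) \<le> C" by (rule quad_decay_bounds[OF q]) blast
  with q show ?thesis unfolding quad_decay_def
    by (intro plancherel(2)) (auto intro: quad_decay_integrable[OF q])
qed

lemma Fq_schwartz:
  assumes "schwartz f"
  shows "Fq q f = Lnorm q f * Lnorm q (fourier f) / (\<integral>x. (cmod (f x))\<^sup>2 \<partial>lborel)"
proof -
  have "(\<integral>x. (cmod (f x))\<^sup>2 \<partial>lborel) \<ge> 0" by (rule Bochner_Integration.integral_nonneg) simp
  then have "Lnorm 2 f * Lnorm 2 (fourier f) = (\<integral>x. (cmod (f x))\<^sup>2 \<partial>lborel)"
    unfolding Lnorm_2 schwartz_plancherel[OF assms] by (simp add: powr_half_sqrt)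
  then show ?thesis by (simp add: Fq_def)
qed

lemma schwartz_fourier_nonzero:
  assumes "schwartz f" "f \<noteq> (\<lambda>x. 0)"
  shows "fourier f \<noteq> (\<lambda>x. 0)"
proof
  assume "fourier f = (\<lambda>x. 0)"
  then have "(\<integral>x. (cmod (f x))\<^sup>2 \<partial>lborel) = 0" using schwartz_plancherel[OF assms(1)] by simp
  then show False using quad_decay_square_pos[of f] schwartz_quad_decay[OF assms(1), of 0] assms(2) by simp
qed

lemma holder_inequality:
  fixes u v :: "'a \<Rightarrow> real"
  assumes pq: "1 < p" "1 < q" "1 / p + 1 / q = 1" and u: "\<And>x. 0 \<le> u x" and v: "\<And>x. 0 \<le> v x"
    and i: "integrable M (\<lambda>x. u x powr p)" "integrable M (\<lambda>x. v x powr q)" "integrable M (\<lambda>x. u x * v x)"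
    and pos: "0 < (\<integral>x. u x powr p \<partial>M)" "0 < (\<integral>x. v x powr q \<partial>M)"
  shows "(\<integral>x. u x * v x \<partial>M) \<le> (\<integral>x. u x powr p \<partial>M) powr (1 / p) * (\<integral>x. v x powr q \<partial>M) powr (1 / q)"
proof -
  define A B where "A = (\<integral>x. u x powr p \<partial>M)" and "B = (\<integral>x. v x powr q \<partial>M)"
  define a b where "a = A powr (1 / p)" and "b = B powr (1 / q)"
  have ab: "a > 0" "b > 0" "a powr p = A" "b powr q = B" "A > 0" "B > 0"
    using pos pq by (auto simp: a_def b_def powr_powr A_def B_def)
  have "(\<integral>x. u x * v x \<partial>M) / (a * b) = (\<integral>x. (u x / a) * (v x / b) \<partial>M)" by simp
  also have "\<dots> \<le> (\<integral>x. u x powr p / (A * p) + v x powr q / (B * q) \<partial>M)"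
  proof (rule integral_mono)
    show "integrable M (\<lambda>x. (u x / a) * (v x / b))" using i by simp
    show "integrable M (\<lambda>x. u x powr p / (A * p) + v x powr q / (B * q))" using i by simp
    show "(u x / a) * (v x / b) \<le> u x powr p / (A * p) + v x powr q / (B * q)" for x
      using Youngs_inequality[of p q "u x / a" "v x / b"] pq u[of x] v[of x] ab by (simp add: powr_divide)
  qed
  also have "\<dots> = A / (A * p) + B / (B * q)" using i by (simp add: A_def B_def)
  also have "\<dots> = 1" using ab pq by simp
  finally have "(\<integral>x. u x * v x \<partial>M) \<le> a * b" using ab by (simp add: field_simps)
  then show ?thesis unfolding a_def b_def A_def B_def .
qed

lemma Fq_lower_bound:
  fixes p q :: real
  assumes q: "1 < q" "q < 2" and pq: "1 / p + 1 / q = 1" and f: "schwartz f" "f \<noteq> (\<lambda>x. 0)"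
  shows "Fq (ereal q) f \<ge> (p powr (1 / p) / q powr (1 / q)) powr (1 / 2)"
proof -
  have p: "p > 2" by (rule conjugate_exponent(2)[OF q pq])
  have qf: "quad_decay f" using schwartz_quad_decay[OF f(1), of 0] by simp
  have qF: "quad_decay (fourier f)" by (rule schwartz_fourier_quad_decay[OF f(1)])
  note F0 = schwartz_fourier_nonzero[OF f]
  define I J Ip N where "I = (\<integral>x. cmod (f x) powr q \<partial>lborel)" and "J = (\<integral>x. cmod (fourier f x) powr q \<partial>lborel)"
    and "Ip = (\<integral>x. cmod (fourier f x) powr p \<partial>lborel)" and "N = (\<integral>x. (cmod (f x))\<^sup>2 \<partial>lborel)"
  have pos: "I > 0" "J > 0" "Ip > 0" "N > 0"
    unfolding I_def J_def Ip_def N_def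
    using quad_decay_integral_pos[OF qf f(2)] quad_decay_integral_pos[OF qF F0] quad_decay_square_pos[OF qf f(2)] p q by auto
  define K where "K = q powr (p / (2 * q)) / sqrt p"
  have K: "K > 0" using p q by (simp add: K_def)
  have "ennreal Ip = (\<integral>\<^sup>+\<xi>. ennreal (cmod (fourier f \<xi>) powr p) \<partial>lborel)"
    unfolding Ip_def using quad_decay_powr_integrable[OF qF, of p] p
    by (intro nn_integral_eq_integral[symmetric]) auto
  also have "\<dots> \<le> ennreal (K * I powr (p / q))"
    unfolding K_def I_def using qf q
    by (intro hausdorff_young_sharp q pq quad_decay_integrable quad_decay_powr_integrable) (auto simp: quad_decay_def)
  finally have hy: "Ip \<le> K * I powr (p / q)" using K by (simp add: ennreal_le_iff)
  define C where "C = (p powr (1 / p) / q powr (1 / q)) powr (1 / 2)"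
  \<comment> \<open>The claimed lower bound \<open>C\<close> is the reciprocal of the
    Hausdorff-Young constant in norm form.\<close>
  have CK: "C * K powr (1 / p) = 1"
  proof -
    have "K powr (1 / p) = q powr (1 / (2 * q)) / p powr (1 / (2 * p))"
      using p q by (simp add: K_def powr_divide powr_powr powr_half_sqrt[symmetric])
    moreover have "C = p powr (1 / (2 * p)) / q powr (1 / (2 * q))"
      by (simp add: C_def powr_divide powr_powr mult.commute)
    ultimately show ?thesis using p q by simp
  qed
  have C: "C > 0" using p q by (simp add: C_def)
  have "Ip powr (1 / p) \<le> (K * I powr (p / q)) powr (1 / p)"
    using hy pos p by (intro powr_mono2) auto
  also have "\<dots> = K powr (1 / p) * I powr (1 / q)" using p by (simp add: powr_mult powr_powr)
  finally have hy': "C * Ip powr (1 / p) \<le> I powr (1 / q)"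
    using mult_left_mono[of "Ip powr (1 / p)" "K powr (1 / p) * I powr (1 / q)" C] C CK
    by (simp add: mult.assoc[symmetric])
  have "N = (\<integral>x. cmod (fourier f x) * cmod (fourier f x) \<partial>lborel)"
    unfolding N_def schwartz_plancherel[OF f(1), symmetric] by (simp add: power2_eq_square)
  also have "\<dots> \<le> Ip powr (1 / p) * J powr (1 / q)"
    unfolding Ip_def J_def
  proof (rule holder_inequality)
    show "integrable lborel (\<lambda>x. cmod (fourier f x) * cmod (fourier f x))"
      using quad_decay_powr_integrable[OF qF, of 2] by (simp add: power2_eq_square)
  qed (use p q pq pos quad_decay_powr_integrable[OF qF] in \<open>auto simp: Ip_def J_def\<close>)
  finally have "C * N \<le> C * (Ip powr (1 / p) * J powr (1 / q))" using C by (intro mult_left_mono) auto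
  also have "\<dots> \<le> I powr (1 / q) * J powr (1 / q)"
    using hy' by (simp add: mult.assoc[symmetric] mult_right_mono)
  finally have "C \<le> I powr (1 / q) * J powr (1 / q) / N" using pos by (simp add: field_simps)
  also have "\<dots> = Fq (ereal q) f"
    unfolding Fq_schwartz[OF f(1)] by (simp add: Lnorm_def I_def J_def N_def)
  finally show ?thesis unfolding C_def .
qed

section \<open>Gaussians with complex parameter\<close>

text \<open>The square is formed in the complex numbers, so that this is the restriction of an
  entire function and complex differentiation rules yield the real derivative.\<close>

definition cgauss :: "complex \<Rightarrow> real \<Rightarrow> complex" where
  "cgauss z x = exp (- (complex_of_real pi * z * (complex_of_real x)\<^sup>2))"

lemma norm_cgauss: "cmod (cgauss z x) = exp (- (pi * Re z * x\<^sup>2))"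
proof -
  have "Re (- (complex_of_real pi * z * (complex_of_real x)\<^sup>2)) = - (pi * Re z * x\<^sup>2)"
    by (simp flip: of_real_power)
  then show ?thesis unfolding cgauss_def norm_exp_eq_Re by (simp only:)
qed

lemma cgauss_of_real: "cgauss (complex_of_real a) x = complex_of_real (exp (- (pi * a * x\<^sup>2)))"
  by (simp add: cgauss_def exp_of_real[symmetric])

text \<open>Polynomials times a fixed Gaussian are closed under differentiation, which makes all
  iterated derivatives accessible by induction.\<close>

lemma poly_cgauss_derivative:
  "((\<lambda>x. poly P (complex_of_real x) * cgauss z x) has_vector_derivative
     poly (pderiv P + [:0, - (2 * complex_of_real pi * z):] * P) (complex_of_real x) * cgauss z x) (at x)"
  unfolding cgauss_def
  by (rule has_vector_derivative_real_field[where f = "\<lambda>w. poly P w * exp (- (complex_of_real pi * z * w\<^sup>2))"])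
     (auto intro!: derivative_eq_intros poly_DERIV simp: algebra_simps)

lemma rderiv_poly_cgauss: "\<exists>Q. rderiv n (\<lambda>x. poly P (complex_of_real x) * cgauss z x) = (\<lambda>x. poly Q (complex_of_real x) * cgauss z x)"
proof (induction n)
  case (Suc n)
  then obtain Q where "rderiv n (\<lambda>x. poly P (complex_of_real x) * cgauss z x) = (\<lambda>x. poly Q (complex_of_real x) * cgauss z x)" by blast
  then show ?case
    using vector_derivative_at[OF poly_cgauss_derivative[of Q z]] by (intro exI[of _ "pderiv Q + [:0, - (2 * complex_of_real pi * z):] * Q"]) simp
qed auto

text \<open>A single term of the exponential series bounds the even power x^(2k), and |x|^k is at
  most 1 + x^(2k).\<close>

lemma power_times_gaussian_bounded:
  fixes a x :: real
  assumes "a > 0"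
  shows "\<bar>x\<bar> ^ k * exp (- (a * x\<^sup>2)) \<le> 1 + fact k / a ^ k"
proof -
  have "(a * x\<^sup>2) ^ k / fact k \<le> exp (a * x\<^sup>2)"
  proof -
    have "(a * x\<^sup>2) ^ k / fact k \<le> (\<Sum>n\<le>k. (a * x\<^sup>2) ^ n / fact n)"
      by (rule member_le_sum) (use assms in auto)
    also have "\<dots> = (\<Sum>n\<le>k. (a * x\<^sup>2) ^ n /\<^sub>R fact n)" by (simp add: divide_inverse_commute)
    also have "\<dots> \<le> exp (a * x\<^sup>2)"
      unfolding exp_def by (rule sum_le_suminf[OF summable_exp_generic]) (use assms in auto)
    finally show ?thesis .
  qed
  then have 1: "(x\<^sup>2) ^ k * exp (- (a * x\<^sup>2)) \<le> fact k / a ^ k"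
    using assms by (simp add: power_mult_distrib exp_minus field_simps)
  have "\<bar>x\<bar> ^ k \<le> 1 + (x\<^sup>2) ^ k"
  proof (cases "\<bar>x\<bar> \<le> 1")
    case True
    then have "\<bar>x\<bar> ^ k \<le> 1" by (simp add: power_le_one)
    then show ?thesis by (simp add: add_increasing2)
  next
    case False
    then have "\<bar>x\<bar> ^ k \<le> \<bar>x\<bar> ^ (2 * k)" by (intro power_increasing) auto
    then show ?thesis by (simp add: power_mult)
  qed
  then have "\<bar>x\<bar> ^ k * exp (- (a * x\<^sup>2)) \<le> (1 + (x\<^sup>2) ^ k) * exp (- (a * x\<^sup>2))" by (intro mult_right_mono) auto
  also have "\<dots> \<le> 1 + fact k / a ^ k" using 1 assms by (simp add: algebra_simps add_mono)
  finally show ?thesis .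
qed

text \<open>Induction on the polynomial with m arbitrary: splitting off the constant coefficient
  leaves a factor x, which is absorbed by raising m by one.\<close>

lemma poly_cgauss_bounded:
  assumes "Re z > 0"
  shows "\<exists>C. \<forall>x. \<bar>x\<bar> ^ m * cmod (poly P (complex_of_real x) * cgauss z x) \<le> C"
proof (induction P arbitrary: m)
  case (pCons c P)
  obtain C where C: "\<And>x. \<bar>x\<bar> ^ Suc m * cmod (poly P (complex_of_real x) * cgauss z x) \<le> C"
    using pCons(2)[of "Suc m"] by blast
  have "\<bar>x\<bar> ^ m * cmod (poly (pCons c P) (complex_of_real x) * cgauss z x)
     \<le> cmod c * (1 + fact m / (pi * Re z) ^ m) + C" for x
  proof -
    have "cmod (poly (pCons c P) (complex_of_real x) * cgauss z x)
      \<le> cmod c * cmod (cgauss z x) + \<bar>x\<bar> * cmod (poly P (complex_of_real x) * cgauss z x)"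
      using norm_triangle_ineq[of "c * cgauss z x" "complex_of_real x * (poly P (complex_of_real x) * cgauss z x)"]
      by (simp add: norm_mult algebra_simps)
    then have "\<bar>x\<bar> ^ m * cmod (poly (pCons c P) (complex_of_real x) * cgauss z x)
      \<le> \<bar>x\<bar> ^ m * (cmod c * cmod (cgauss z x) + \<bar>x\<bar> * cmod (poly P (complex_of_real x) * cgauss z x))"
      by (intro mult_left_mono) auto
    also have "\<dots> = cmod c * (\<bar>x\<bar> ^ m * cmod (cgauss z x)) + \<bar>x\<bar> ^ Suc m * cmod (poly P (complex_of_real x) * cgauss z x)"
      by (simp add: algebra_simps)
    also have "\<dots> \<le> cmod c * (1 + fact m / (pi * Re z) ^ m) + C"
      using power_times_gaussian_bounded[of "pi * Re z" x m] assms
      by (intro add_mono mult_left_mono C) (auto simp: norm_cgauss)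
    finally show ?thesis .
  qed
  then show ?case by blast
qed auto

lemma schwartz_cgauss:
  assumes "Re z > 0"
  shows "schwartz (cgauss z)"
  unfolding schwartz_def
proof (intro conjI allI)
  have *: "\<exists>Q. rderiv n (cgauss z) = (\<lambda>x. poly Q (complex_of_real x) * cgauss z x)" for n
    using rderiv_poly_cgauss[of n 1 z] by simp
  show "rderiv n (cgauss z) differentiable at x" for n x
    using *[of n] poly_cgauss_derivative differentiableI_vector by metis
  show "\<exists>C. \<forall>x. \<bar>x\<bar> ^ m * norm (rderiv n (cgauss z) x) \<le> C" for m n
    using *[of n] poly_cgauss_bounded[OF assms, of m] by metis
qed

lemma rderiv_linear_combination:
  assumes "schwartz f" "schwartz g"
  shows "rderiv n (\<lambda>x. c * f x + d * g x) = (\<lambda>x. c * rderiv n f x + d * rderiv n g x)"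
proof (induction n)
  case (Suc n)
  have "(rderiv n f has_vector_derivative rderiv (Suc n) f x) (at x)"
    "(rderiv n g has_vector_derivative rderiv (Suc n) g x) (at x)" for x
    using assms unfolding schwartz_def by (simp_all add: vector_derivative_works)
  then have "((\<lambda>x. c * rderiv n f x + d * rderiv n g x) has_vector_derivative c * rderiv (Suc n) f x + d * rderiv (Suc n) g x) (at x)" for x
    by (intro derivative_intros)
  then show ?case using Suc by (auto intro!: vector_derivative_at)
qed simp

lemma schwartz_linear_combination:
  assumes f: "schwartz f" and g: "schwartz g"
  shows "schwartz (\<lambda>x. c * f x + d * g x)"
  unfolding schwartz_def rderiv_linear_combination[OF assms]
proof (intro conjI allI)
  show "(\<lambda>x. c * rderiv n f x + d * rderiv n g x) differentiable at x" for n x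
    using f g unfolding schwartz_def by (intro derivative_intros) auto
  fix m n
  obtain C where C: "\<And>x. \<bar>x\<bar> ^ m * cmod (rderiv n f x) \<le> C" using f unfolding schwartz_def by metis
  obtain D where D: "\<And>x. \<bar>x\<bar> ^ m * cmod (rderiv n g x) \<le> D" using g unfolding schwartz_def by metis
  have "\<bar>x\<bar> ^ m * cmod (c * rderiv n f x + d * rderiv n g x) \<le> cmod c * C + cmod d * D" for x
  proof -
    have "\<bar>x\<bar> ^ m * cmod (c * rderiv n f x + d * rderiv n g x) \<le> \<bar>x\<bar> ^ m * (cmod c * cmod (rderiv n f x) + cmod d * cmod (rderiv n g x))"
      by (intro mult_left_mono) (auto intro: order_trans[OF norm_triangle_ineq] simp: norm_mult)
    also have "\<dots> = cmod c * (\<bar>x\<bar> ^ m * cmod (rderiv n f x)) + cmod d * (\<bar>x\<bar> ^ m * cmod (rderiv n g x))"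
      by (simp add: algebra_simps)
    also have "\<dots> \<le> cmod c * C + cmod d * D" by (intro add_mono mult_left_mono C D) auto
    finally show ?thesis .
  qed
  then show "\<exists>C. \<forall>x. \<bar>x\<bar> ^ m * cmod (c * rderiv n f x + d * rderiv n g x) \<le> C" by blast
qed

text \<open>Differentiation under the integral sign. Difference quotients are taken along sequences
  to fit dominated convergence; |exp (\<i> y) - 1| <= |y| gives the majorant 2 pi |x f x|.\<close>

lemma fourier_has_vector_derivative:
  assumes f: "integrable lborel f" and xf: "integrable lborel (\<lambda>x. complex_of_real x * f x)"
  shows "(fourier f has_vector_derivative fourier (\<lambda>x. - 2 * complex_of_real pi * \<i> * (complex_of_real x * f x)) \<xi>) (at \<xi>)"
proof -
  define D where "D = fourier (\<lambda>x. - 2 * complex_of_real pi * \<i> * (complex_of_real x * f x)) \<xi>"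
  have [measurable]: "f \<in> borel_measurable borel" using f borel_measurable_integrable by force
  define c where "c x = - 2 * complex_of_real pi * \<i> * complex_of_real x" for x
  define e where "e x = exp (- 2 * complex_of_real pi * \<i> * complex_of_real (x * \<xi>))" for x
  have ne: "cmod (e x) = 1" for x unfolding e_def by (rule norm_fourier_kernel)
  have [measurable]: "e \<in> borel_measurable borel" unfolding e_def by (rule fourier_kernel_measurable)
  have fe: "fourier f (\<xi> + h) = (\<integral>x. f x * (e x * exp (c x * h)) \<partial>lborel)" for h :: real
    unfolding fourier_def e_def c_def exp_add[symmetric] by (simp add: algebra_simps)
  have De: "D = (\<integral>x. f x * (e x * c x) \<partial>lborel)"
    unfolding D_def fourier_def e_def c_def by (simp only: mult_ac)
  have ei: "integrable lborel (\<lambda>x. f x * (e x * exp (c x * h)))" for h :: real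
    by (rule Bochner_Integration.integrable_bound[OF f], unfold c_def, measurable)
       (simp add: norm_mult ne norm_exp_eq_Re)
  have lim: "(\<lambda>n. (fourier f (\<xi> + s n) - fourier f \<xi>) / complex_of_real (s n)) \<longlonglongrightarrow> D"
    if s: "\<And>n. s n \<noteq> 0" "s \<longlonglongrightarrow> 0" for s :: "nat \<Rightarrow> real"
  proof -
    have "(fourier f (\<xi> + s n) - fourier f \<xi>) / complex_of_real (s n)
      = (\<integral>x. f x * (e x * ((exp (c x * s n) - 1) / complex_of_real (s n))) \<partial>lborel)" for n
    proof -
      have "fourier f (\<xi> + s n) - fourier f \<xi> = (\<integral>x. f x * (e x * exp (c x * s n)) - f x * (e x * exp (c x * complex_of_real 0)) \<partial>lborel)"
        using fe[of 0] fe[of "s n"] ei[of "s n"] ei[of 0] by (simp only: Bochner_Integration.integral_diff add_0_right)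
      also have "\<dots> = (\<integral>x. f x * (e x * ((exp (c x * s n) - 1) / complex_of_real (s n))) * complex_of_real (s n) \<partial>lborel)"
        using s(1)[of n] by (intro Bochner_Integration.integral_cong) (auto simp: field_simps)
      also have "\<dots> = (\<integral>x. f x * (e x * ((exp (c x * s n) - 1) / complex_of_real (s n))) \<partial>lborel) * complex_of_real (s n)"
        by (rule integral_mult_left_zero)
      finally show ?thesis using s(1)[of n] by simp
    qed
    moreover have "(\<lambda>n. \<integral>x. f x * (e x * ((exp (c x * s n) - 1) / complex_of_real (s n))) \<partial>lborel) \<longlonglongrightarrow> D"
      unfolding De
    proof (rule integral_dominated_convergence[where w = "\<lambda>x. 2 * pi * cmod (complex_of_real x * f x)"])
      show "integrable lborel (\<lambda>x. 2 * pi * cmod (complex_of_real x * f x))" using integrable_norm[OF xf] by (rule integrable_mult_right)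
      show "AE x in lborel. (\<lambda>n. f x * (e x * ((exp (c x * s n) - 1) / complex_of_real (s n)))) \<longlonglongrightarrow> f x * (e x * c x)"
      proof (intro AE_I2 tendsto_mult tendsto_const)
        fix x
        have "((\<lambda>z. exp (c x * z)) has_field_derivative c x) (at 0)" by (auto intro!: derivative_eq_intros)
        then have "((\<lambda>z. (exp (c x * z) - 1) / z) \<longlongrightarrow> c x) (at 0)" by (simp add: DERIV_def)
        moreover have "filterlim (\<lambda>n. complex_of_real (s n)) (at 0) sequentially"
          unfolding filterlim_at using s tendsto_of_real[OF s(2), where 'a = complex] by simp
        ultimately show "(\<lambda>n. (exp (c x * s n) - 1) / complex_of_real (s n)) \<longlonglongrightarrow> c x"
          by (rule filterlim_compose)
      qed
      show "AE x in lborel. cmod (f x * (e x * ((exp (c x * s n) - 1) / complex_of_real (s n)))) \<le> 2 * pi * cmod (complex_of_real x * f x)" for n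
      proof (rule AE_I2)
        fix x
        have "cmod (exp (c x * s n) - 1) \<le> \<bar>- 2 * pi * x * s n\<bar>"
          using iexp_approx1[of "- 2 * pi * x * s n" 0] by (simp add: c_def mult_ac)
        also have "\<dots> = 2 * pi * \<bar>x\<bar> * \<bar>s n\<bar>" by (simp add: abs_mult)
        finally have "cmod ((exp (c x * s n) - 1) / complex_of_real (s n)) \<le> 2 * pi * \<bar>x\<bar>"
          using s(1)[of n] by (simp add: norm_divide field_simps)
        then have "cmod (f x) * cmod ((exp (c x * s n) - 1) / complex_of_real (s n)) \<le> cmod (f x) * (2 * pi * \<bar>x\<bar>)"
          by (intro mult_left_mono) auto
        also have "cmod (f x) * (2 * pi * \<bar>x\<bar>) = 2 * pi * cmod (complex_of_real x * f x)" by (simp add: norm_mult)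
        also have "cmod (f x) * cmod w = cmod (f x * (e x * w))" for w by (simp add: norm_mult ne)
        finally show "cmod (f x * (e x * ((exp (c x * s n) - 1) / complex_of_real (s n)))) \<le> 2 * pi * cmod (complex_of_real x * f x)" .
      qed
    qed (unfold c_def, measurable)
    ultimately show ?thesis by (simp only:)
  qed
  have "(\<lambda>h. norm (fourier f (\<xi> + h) - fourier f \<xi> - h *\<^sub>R D) / norm h) \<midarrow>0\<rightarrow> 0"
    unfolding LIMSEQ_SEQ_conv[symmetric]
  proof (intro allI impI)
    fix s :: "nat \<Rightarrow> real" assume s: "(\<forall>n. s n \<noteq> 0) \<and> s \<longlonglongrightarrow> 0"
    then have "(\<lambda>n. norm ((fourier f (\<xi> + s n) - fourier f \<xi>) / complex_of_real (s n) - D)) \<longlonglongrightarrow> norm (D - D)"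
      by (intro tendsto_norm tendsto_diff tendsto_const lim) auto
    moreover have "norm ((fourier f (\<xi> + s n) - fourier f \<xi>) / complex_of_real (s n) - D)
       = norm (fourier f (\<xi> + s n) - fourier f \<xi> - s n *\<^sub>R D) / norm (s n)" for n
    proof -
      have "(fourier f (\<xi> + s n) - fourier f \<xi>) / complex_of_real (s n) - D
        = (fourier f (\<xi> + s n) - fourier f \<xi> - s n *\<^sub>R D) / complex_of_real (s n)"
        using s by (simp add: diff_divide_distrib scaleR_conv_of_real)
      then show ?thesis by (simp add: norm_divide)
    qed
    ultimately show "(\<lambda>n. norm (fourier f (\<xi> + s n) - fourier f \<xi> - s n *\<^sub>R D) / norm (s n)) \<longlonglongrightarrow> 0" by simp
  qed
  then show ?thesis
    unfolding has_vector_derivative_def has_derivative_at D_def[symmetric] by (simp add: bounded_linear_scaleR_left)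
qed

text \<open>The transform satisfies the first-order equation \<phi>' = -(2 pi \<xi> / z) \<phi>, so
  its product with the reciprocal Gaussian \<open>cgauss (- 1 / z)\<close> is constant. The value at
  0 stays unevaluated, which avoids a complex square root; its modulus cancels in
  \<open>Fq\<close>.\<close>

lemma fourier_cgauss:
  assumes z: "Re z > 0"
  shows "fourier (cgauss z) \<xi> = fourier (cgauss z) 0 * cgauss (1 / z) \<xi>"
proof -
  have "z \<noteq> 0" using z by auto
  define \<phi> where "\<phi> = fourier (cgauss z)"
  note S = schwartz_cgauss[OF z]
  have q: "quad_decay (cgauss z)" using schwartz_quad_decay[OF S, of 0] by simp
  define g where "g = (\<lambda>x. - (2 * complex_of_real pi * z) * (complex_of_real x * cgauss z x))"
  have d: "(cgauss z has_vector_derivative g x) (at x)" for x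
    using poly_cgauss_derivative[of 1 z x] by (simp add: g_def mult_ac)
  then have "rderiv (Suc 0) (cgauss z) = g" by (auto intro!: vector_derivative_at)
  then have gq: "quad_decay g" using schwartz_quad_decay[OF S, of "Suc 0"] by simp
  have xe: "complex_of_real x * cgauss z x = (- 1 / (2 * complex_of_real pi * z)) * g x" for x
    using \<open>z \<noteq> 0\<close> by (simp add: g_def)
  have "integrable lborel (\<lambda>x. (- 1 / (2 * complex_of_real pi * z)) * g x)"
    by (intro integrable_mult_right quad_decay_integrable gq)
  then have xi: "integrable lborel (\<lambda>x. complex_of_real x * cgauss z x)" unfolding xe .
  have "fourier (\<lambda>x. - 2 * complex_of_real pi * \<i> * (complex_of_real x * cgauss z x)) \<xi> = - (2 * complex_of_real pi * \<xi> / z) * \<phi> \<xi>" for \<xi>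
  proof -
    have "(\<lambda>x. - 2 * complex_of_real pi * \<i> * (complex_of_real x * cgauss z x)) = (\<lambda>x. (\<i> / z) * g x)"
      unfolding xe by (rule ext) (simp add: field_simps)
    then have "fourier (\<lambda>x. - 2 * complex_of_real pi * \<i> * (complex_of_real x * cgauss z x)) \<xi> = (\<i> / z) * fourier g \<xi>"
      by (simp only: fourier_cmult)
    also have "fourier g \<xi> = 2 * complex_of_real pi * \<i> * \<xi> * \<phi> \<xi>"
      using fourier_vector_derivative[OF q gq d, of \<xi>] by (simp add: \<phi>_def)
    also have "(\<i> / z) * (2 * complex_of_real pi * \<i> * \<xi> * \<phi> \<xi>) = (\<i> * \<i>) * ((2 * complex_of_real pi * \<xi> / z) * \<phi> \<xi>)"
      by (simp only: times_divide_eq_left times_divide_eq_right mult_ac)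
    finally show ?thesis by simp
  qed
  then have d\<phi>: "(\<phi> has_vector_derivative - (2 * complex_of_real pi * \<xi> / z) * \<phi> \<xi>) (at \<xi>)" for \<xi>
    using fourier_has_vector_derivative[OF quad_decay_integrable[OF q] xi, of \<xi>] by (simp add: \<phi>_def)
  have dc: "(cgauss (- 1 / z) has_vector_derivative (2 * complex_of_real pi * \<xi> / z) * cgauss (- 1 / z) \<xi>) (at \<xi>)" for \<xi>
    using poly_cgauss_derivative[of 1 "- 1 / z" \<xi>] by (simp add: mult_ac)
  have "((\<lambda>\<xi>. \<phi> \<xi> * cgauss (- 1 / z) \<xi>) has_vector_derivative 0) (at \<xi>)" for \<xi>
    using has_vector_derivative_mult[OF d\<phi>[of \<xi>] dc[of \<xi>]] by (simp add: mult_ac)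
  then obtain k where k: "\<And>\<xi>. \<phi> \<xi> * cgauss (- 1 / z) \<xi> = k"
    using has_vector_derivative_zero_constant[of UNIV "\<lambda>\<xi>. \<phi> \<xi> * cgauss (- 1 / z) \<xi>"] by auto
  have "cgauss (- 1 / z) \<xi> * cgauss (1 / z) \<xi> = 1" by (simp add: cgauss_def exp_add[symmetric])
  then have "\<phi> \<xi> = k * cgauss (1 / z) \<xi>" using k[of \<xi>] by (metis mult.assoc mult.right_neutral)
  moreover have "\<phi> 0 = k" using k[of 0] by (simp add: cgauss_def)
  ultimately show ?thesis by (simp add: \<phi>_def)
qed

section \<open>All positive values are attained\<close>

text \<open>The essential supremum must first be shown finite for \<open>real_of_ereal\<close> to
  return it: C bounds it above, and -\<infinity> would make Lebesgue measure vanish. The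
  almost-everywhere bound then holds everywhere, as continuity makes its set of validity
  closed.\<close>

lemma Lnorm_infinity_bounds:
  fixes g :: "real \<Rightarrow> complex"
  assumes g: "continuous_on UNIV g" and C: "\<And>x. cmod (g x) \<le> C"
  shows "Lnorm \<infinity> g \<le> C" and "cmod (g x) \<le> Lnorm \<infinity> g"
proof -
  define e where "e = esssup lborel (\<lambda>x. ereal (cmod (g x)))"
  have [measurable]: "g \<in> borel_measurable borel" by (rule borel_measurable_continuous_onI[OF g])
  have up: "e \<le> ereal C" unfolding e_def by (rule esssup_I) (use C in auto)
  have ae: "AE x in lborel. ereal (cmod (g x)) \<le> e" unfolding e_def by (rule esssup_AE)
  have "e \<noteq> - \<infinity>"
  proof
    assume "e = - \<infinity>"
    with ae have "AE x in (lborel :: real measure). False" by simp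
    then show False by (simp add: eventually_False ae_filter_eq_bot_iff)
  qed
  with up obtain r where r: "e = ereal r" by (cases e) auto
  have "closed {x. cmod (g x) \<le> r}"
    using g by (intro closed_Collect_le continuous_intros) auto
  moreover have "AE x in lebesgue. x \<in> {x. cmod (g x) \<le> r}"
    using ae unfolding r by (auto intro: AE_completion)
  ultimately have "cmod (g x) \<le> r" for x using mem_closed_if_AE_lebesgue by blast
  then show "Lnorm \<infinity> g \<le> C" "cmod (g x) \<le> Lnorm \<infinity> g"
    using up unfolding Lnorm_def e_def[symmetric] r by auto
qed

lemma Lnorm_pos:
  fixes q :: ereal
  assumes q: "2 < q" and g: "quad_decay g" "g \<noteq> (\<lambda>x. 0)"
  shows "0 < Lnorm q g"
proof (cases q)
  case (real r)
  then have "r > 2" using q by simp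
  then show ?thesis using quad_decay_integral_pos[OF g, of r] by (simp add: Lnorm_def real)
next
  case PInf
  obtain C where C: "\<And>x. cmod (g x) \<le> C" by (rule quad_decay_bounds[OF g(1)]) blast
  obtain x where "g x \<noteq> 0" using g(2) by auto
  then have "0 < cmod (g x)" by simp
  also have "\<dots> \<le> Lnorm \<infinity> g"
    using g(1) unfolding quad_decay_def by (intro Lnorm_infinity_bounds(2)[OF _ C]) auto
  finally show ?thesis using PInf by simp
qed (use q in auto)

lemma Fq_pos:
  assumes q: "2 < q" and f: "schwartz f" "f \<noteq> (\<lambda>x. 0)"
  shows "0 < Fq q f"
proof -
  have qf: "quad_decay f" using schwartz_quad_decay[OF f(1), of 0] by simp
  show ?thesis unfolding Fq_schwartz[OF f(1)]
    using Lnorm_pos[OF q qf f(2)] Lnorm_pos[OF q schwartz_fourier_quad_decay[OF f(1)] schwartz_fourier_nonzero[OF f]]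
      quad_decay_square_pos[OF qf f(2)] by simp
qed

text \<open>1 / q with value 0 at q = \<infinity>, so that one scaling law covers finite and
  infinite exponents.\<close>

definition recip :: "ereal \<Rightarrow> real" where
  "recip q = (if q = \<infinity> then 0 else 1 / real_of_ereal q)"

text \<open>The \<open>q\<close>-norm of \<open>exp (-\<pi> x\<^sup>2)\<close>.\<close>
definition gauss_norm :: "ereal \<Rightarrow> real" where
  "gauss_norm q = (if q = \<infinity> then 1 else (1 / sqrt (real_of_ereal q)) powr (1 / real_of_ereal q))"

lemma Lnorm_gaussian:
  fixes q :: ereal
  assumes q: "1 < q" and a: "a > 0" and k: "k \<ge> 0" and g: "continuous_on UNIV g"
    and gk: "\<And>x. cmod (g x) = k * exp (- (pi * a * x\<^sup>2))"
  shows "Lnorm q g = k * gauss_norm q * a powr (- recip q / 2)"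
proof (cases q)
  case (real r)
  then have r: "r > 1" using q by simp
  have "(k * exp (- (pi * a * x\<^sup>2))) powr r = k powr r * exp (- (pi * (a * r) * x\<^sup>2))" for x
    by (simp add: powr_mult) (simp add: powr_def)
  then have "(\<integral>x. cmod (g x) powr r \<partial>lborel) = k powr r * (1 / sqrt (a * r))"
    unfolding gk using integral_gaussian[of "a * r"] a r by simp
  then have "Lnorm q g = (k powr r * (1 / sqrt (a * r))) powr (1 / r)"
    by (simp add: Lnorm_def real)
  also have "\<dots> = k * ((1 / sqrt r) powr (1 / r) * (1 / sqrt a) powr (1 / r))"
    using r k by (simp add: powr_mult powr_powr real_sqrt_mult powr_divide)
  also have "(1 / sqrt a) powr (1 / r) = a powr (- recip q / 2)"
    using a r by (simp add: recip_def real powr_half_sqrt[symmetric] powr_powr powr_divide powr_minus_divide mult.commute)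
  finally show ?thesis by (simp add: gauss_norm_def real)
next
  case PInf
  have le: "cmod (g x) \<le> k" for x
    unfolding gk using k a mult_left_mono[of "exp (- (pi * a * x\<^sup>2))" 1 k] by simp
  have "Lnorm \<infinity> g = k"
    using Lnorm_infinity_bounds(1)[OF g le] Lnorm_infinity_bounds(2)[OF g le, of 0] gk[of 0] by simp
  then show ?thesis using PInf a by (simp add: recip_def gauss_norm_def)
qed (use q in auto)

lemma cgauss_nonzero: "cgauss z \<noteq> (\<lambda>x. 0)"
proof
  assume "cgauss z = (\<lambda>x. 0)"
  then have "cgauss z 0 = 0" by simp
  then show False by (simp add: cgauss_def)
qed

lemma continuous_cgauss: "continuous_on UNIV (cgauss z)"
  unfolding cgauss_def by (intro continuous_intros)

text \<open>Chirped Gaussians: the spread of \<open>cgauss (1 + \<i> t)\<close> and of its Fourier transform both grow with \<open>t\<close>, which makes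
  \<open>Fq\<close> small for \<open>q > 2\<close>.\<close>
lemma Fq_chirp:
  fixes q :: ereal
  assumes q: "2 < q"
  shows "Fq q (cgauss (Complex 1 t)) = (gauss_norm q / gauss_norm 2)\<^sup>2 * (1 / (1 + t\<^sup>2)) powr (1 / 4 - recip q / 2)"
proof -
  define z where "z = Complex 1 t"
  define b where "b = 1 / (1 + t\<^sup>2)"
  have z: "Re z > 0" by (simp add: z_def)
  have b: "b > 0" by (simp add: b_def add_pos_nonneg)
  \<comment> \<open>The modulus of \<open>cgauss z\<close> is exp(-pi x^2) for every t. The
    dependence on t enters through this real part, which sets the width of the transform.\<close>
  have Rb: "Re (1 / z) = b" by (simp add: z_def b_def Re_divide)
  define k where "k = cmod (fourier (cgauss z) 0)"
  have F: "cmod (fourier (cgauss z) \<xi>) = k * exp (- (pi * b * \<xi>\<^sup>2))" for \<xi>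
    by (subst fourier_cgauss[OF z]) (simp add: norm_mult norm_cgauss Rb k_def)
  have k: "k > 0"
  proof (rule ccontr)
    assume "\<not> k > 0"
    then have "k = 0" by (simp add: k_def)
    then have "fourier (cgauss z) = (\<lambda>x. 0)" using F by auto
    then show False using schwartz_fourier_nonzero[OF schwartz_cgauss[OF z] cgauss_nonzero] by simp
  qed
  have Fc: "continuous_on UNIV (fourier (cgauss z))"
    using schwartz_fourier_quad_decay[OF schwartz_cgauss[OF z]] unfolding quad_decay_def by blast
  have 2: "(1 :: ereal) < 2" by simp
  have q1: "1 < q" using 2 q by (rule less_trans)
  have r2: "recip 2 = 1 / 2" by (simp add: recip_def)
  have g: "cmod (cgauss z x) = 1 * exp (- (pi * 1 * x\<^sup>2))" for x by (simp add: norm_cgauss z_def)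
  have L1: "Lnorm r (cgauss z) = gauss_norm r" if "1 < r" for r :: ereal
    using Lnorm_gaussian[OF that _ _ continuous_cgauss g] by simp
  have L2: "Lnorm r (fourier (cgauss z)) = k * gauss_norm r * b powr (- recip r / 2)" if "1 < r" for r :: ereal
    using Lnorm_gaussian[OF that b _ Fc F] k by simp
  have "gauss_norm 2 > 0" by (simp add: gauss_norm_def)
  have "Fq q (cgauss z) = gauss_norm q * (k * gauss_norm q * b powr (- recip q / 2)) / (gauss_norm 2 * (k * gauss_norm 2 * b powr (- recip 2 / 2)))"
    unfolding Fq_def L1[OF q1] L2[OF q1] L1[OF 2] L2[OF 2] ..
  also have "\<dots> = (gauss_norm q / gauss_norm 2)\<^sup>2 * (b powr (- recip q / 2) / b powr (- recip 2 / 2))"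
    using k by (simp add: power2_eq_square)
  also have "b powr (- recip q / 2) / b powr (- recip 2 / 2) = b powr (1 / 4 - recip q / 2)"
    unfolding powr_diff[symmetric] r2 by simp
  finally show ?thesis unfolding z_def b_def .
qed

lemma recip_bounds:
  assumes "2 < q"
  shows "0 \<le> recip q" "recip q < 1 / 2"
proof -
  show "0 \<le> recip q" "recip q < 1 / 2"
    using assms by (cases q; simp add: recip_def)+
qed

lemma gauss_norm_pos: "1 < q \<Longrightarrow> gauss_norm q > 0"
  by (cases q) (auto simp: gauss_norm_def)

lemma Fq_small_values:
  fixes q :: ereal
  assumes q: "2 < q" and v: "0 < v" "v \<le> (gauss_norm q / gauss_norm 2)\<^sup>2"
  obtains f where "schwartz f" "f \<noteq> (\<lambda>x. 0)" "Fq q f = v"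
proof -
  have 2: "(1 :: ereal) < 2" by simp
  have q1: "1 < q" using 2 q by (rule less_trans)
  define K where "K = (gauss_norm q / gauss_norm 2)\<^sup>2"
  have K: "K > 0" using gauss_norm_pos[OF q1] gauss_norm_pos[OF 2] by (simp add: K_def)
  define e where "e = 1 / 4 - recip q / 2"
  have e: "e > 0" using recip_bounds[OF q] by (simp add: e_def)
  \<comment> \<open>Solves K w^e = v. The bound v <= K puts w in (0, 1], so that w = 1 / (1 + t^2)
    for some real t; e > 0 is where q > 2 is used.\<close>
  define w where "w = (v / K) powr (1 / e)"
  have w: "0 < w" "w \<le> 1" using v K e by (auto simp: w_def K_def powr_le1)
  define t where "t = sqrt (1 / w - 1)"
  have "1 / (1 + t\<^sup>2) = w" using w by (simp add: t_def)
  then have "Fq q (cgauss (Complex 1 t)) = K * w powr e"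
    unfolding Fq_chirp[OF q] K_def e_def by simp
  also have "\<dots> = v" using e v K by (simp add: w_def powr_powr)
  finally have "Fq q (cgauss (Complex 1 t)) = v" .
  moreover have "Re (Complex 1 t) > 0" by simp
  ultimately show thesis by (rule that[OF schwartz_cgauss cgauss_nonzero, rotated])
qed

text \<open>The second summand is the Fourier transform of the first. The amplitudes keep the 2-norm
  of each summand independent of l.\<close>

definition two_scale :: "real \<Rightarrow> real \<Rightarrow> real" where
  "two_scale l x = sqrt l * exp (- (pi * l\<^sup>2 * x\<^sup>2)) + 1 / sqrt l * exp (- (pi * (1 / l\<^sup>2) * x\<^sup>2))"

definition ctwo_scale :: "real \<Rightarrow> real \<Rightarrow> complex" where
  "ctwo_scale l x = complex_of_real (two_scale l x)"

lemma ctwo_scale_eq: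
  "ctwo_scale l = (\<lambda>x. complex_of_real (sqrt l) * cgauss (complex_of_real (l\<^sup>2)) x
     + complex_of_real (1 / sqrt l) * cgauss (complex_of_real (1 / l\<^sup>2)) x)"
  unfolding ctwo_scale_def two_scale_def cgauss_of_real by (simp only: of_real_add of_real_mult)

lemma two_scale_pos: "l > 0 \<Longrightarrow> two_scale l x > 0"
  unfolding two_scale_def by (intro add_pos_pos mult_pos_pos) auto

lemma norm_ctwo_scale: "l > 0 \<Longrightarrow> cmod (ctwo_scale l x) = two_scale l x"
  using two_scale_pos[of l x] by (simp add: ctwo_scale_def)

lemma schwartz_ctwo_scale: "l > 0 \<Longrightarrow> schwartz (ctwo_scale l)"
  unfolding ctwo_scale_eq by (intro schwartz_linear_combination schwartz_cgauss) auto

lemma ctwo_scale_nonzero: "l > 0 \<Longrightarrow> ctwo_scale l \<noteq> (\<lambda>x. 0)"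
  using norm_ctwo_scale[of l 0] two_scale_pos[of l 0] by (metis norm_zero less_irrefl)

lemma fourier_ctwo_scale:
  assumes l: "l > 0"
  shows "fourier (ctwo_scale l) = ctwo_scale l"
proof
  fix \<xi>
  define u v where "u = (\<lambda>x. complex_of_real (sqrt l) * cgauss (complex_of_real (l\<^sup>2)) x)"
    and "v = (\<lambda>x. complex_of_real (1 / sqrt l) * cgauss (complex_of_real (1 / l\<^sup>2)) x)"
  have F: "fourier (cgauss (complex_of_real a)) \<xi> = complex_of_real (1 / sqrt a * exp (- (pi * \<xi>\<^sup>2 / a)))" if "a > 0" for a
    using fourier_gaussian[OF that, of \<xi>] by (simp only: cgauss_of_real[symmetric])
  have i: "integrable lborel (cgauss (complex_of_real a))" if "a > 0" for a
    using quad_decay_integrable[OF schwartz_quad_decay[OF schwartz_cgauss, of "complex_of_real a" 0]] that by simp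
  have iu: "integrable lborel u" and iv: "integrable lborel v"
    unfolding u_def v_def using l by (intro integrable_mult_right i; simp)+
  have s: "sqrt l * sqrt l = l" using l by simp
  \<comment> \<open>The two summands are indexed by the booleans so that \<open>fourier_sum\<close>
    applies.\<close>
  have "fourier (ctwo_scale l) \<xi> = fourier (\<lambda>x. \<Sum>b\<in>UNIV. (if b then u else v) x) \<xi>"
    unfolding ctwo_scale_eq u_def v_def by (simp add: UNIV_bool add.commute)
  also have "\<dots> = (\<Sum>b\<in>UNIV. fourier (if b then u else v) \<xi>)"
    by (rule fourier_sum) (use iu iv in simp)
  also have "\<dots> = fourier u \<xi> + fourier v \<xi>" by (simp add: UNIV_bool add.commute)
  also have "fourier u \<xi> = complex_of_real (1 / sqrt l * exp (- (pi * (1 / l\<^sup>2) * \<xi>\<^sup>2)))"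
  proof -
    have "sqrt l * (1 / sqrt (l\<^sup>2)) = 1 / sqrt l" using l s by (simp add: field_simps)
    then have "sqrt l * (1 / sqrt (l\<^sup>2) * exp (- (pi * \<xi>\<^sup>2 / l\<^sup>2))) = 1 / sqrt l * exp (- (pi * (1 / l\<^sup>2) * \<xi>\<^sup>2))"
      by (simp only: mult.assoc[symmetric]) simp
    then show ?thesis unfolding u_def fourier_cmult using l by (simp only: F zero_less_power of_real_mult[symmetric])
  qed
  also have "fourier v \<xi> = complex_of_real (sqrt l * exp (- (pi * l\<^sup>2 * \<xi>\<^sup>2)))"
  proof -
    have "1 / sqrt l * (1 / sqrt (1 / l\<^sup>2)) = sqrt l" using l s by (simp add: real_sqrt_divide field_simps)
    then have "1 / sqrt l * (1 / sqrt (1 / l\<^sup>2) * exp (- (pi * \<xi>\<^sup>2 / (1 / l\<^sup>2)))) = sqrt l * exp (- (pi * l\<^sup>2 * \<xi>\<^sup>2))"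
      by (simp only: mult.assoc[symmetric]) (simp add: mult_ac)
    moreover have "1 / l\<^sup>2 > 0" using l by simp
    ultimately show ?thesis unfolding v_def fourier_cmult by (simp only: F of_real_mult[symmetric])
  qed
  finally show "fourier (ctwo_scale l) \<xi> = ctwo_scale l \<xi>"
    unfolding ctwo_scale_def two_scale_def by (simp add: add.commute)
qed

text \<open>A Gaussian majorant valid for all l in [1, L] at once; it is the dominating function for
  continuity of the norms in l.\<close>

lemma two_scale_le:
  assumes "1 \<le> l" "l \<le> L"
  shows "two_scale l x \<le> (sqrt L + 1) * exp (- (pi * (1 / L\<^sup>2) * x\<^sup>2))"
proof -
  have "1 / L\<^sup>2 \<le> 1 / l\<^sup>2" using assms by (intro divide_left_mono power_mono) auto
  moreover have "1 / l\<^sup>2 \<le> 1" "1 \<le> l\<^sup>2" using assms by (auto simp: one_le_power)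
  ultimately have "1 / L\<^sup>2 \<le> 1 / l\<^sup>2" "1 / L\<^sup>2 \<le> l\<^sup>2" by auto
  then have "exp (- (pi * (1 / l\<^sup>2) * x\<^sup>2)) \<le> exp (- (pi * (1 / L\<^sup>2) * x\<^sup>2))" "exp (- (pi * l\<^sup>2 * x\<^sup>2)) \<le> exp (- (pi * (1 / L\<^sup>2) * x\<^sup>2))"
    by (simp_all only: exp_le_cancel_iff neg_le_iff_le) (intro mult_right_mono mult_left_mono; simp)+
  moreover have "sqrt l \<le> sqrt L" "1 / sqrt l \<le> 1" using assms by auto
  ultimately have "two_scale l x \<le> sqrt L * exp (- (pi * (1 / L\<^sup>2) * x\<^sup>2)) + 1 * exp (- (pi * (1 / L\<^sup>2) * x\<^sup>2))"
    unfolding two_scale_def using assms by (intro add_mono mult_mono) auto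
  then show ?thesis by (simp add: algebra_simps)
qed

lemma continuous_on_two_scale_integral:
  assumes r: "r > 0"
  shows "continuous_on {1..L} (\<lambda>l. \<integral>x. two_scale l x powr r \<partial>lborel)"
  unfolding continuous_on_sequentially o_def
proof (intro allI ballI impI)
  fix s l assume l: "l \<in> {1..L}" and "(\<forall>n. s n \<in> {1..L}) \<and> s \<longlonglongrightarrow> l"
  then have s: "\<And>n. s n \<in> {1..L}" "s \<longlonglongrightarrow> l" by auto
  have L: "L > 0" using l by auto
  have m: "(\<lambda>x. two_scale k x powr r) \<in> borel_measurable lborel" for k
    unfolding two_scale_def by measurable
  have lim: "(\<lambda>n. two_scale (s n) x) \<longlonglongrightarrow> two_scale l x" for x
    unfolding two_scale_def using l by (intro tendsto_intros s(2)) auto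
  show "(\<lambda>n. \<integral>x. two_scale (s n) x powr r \<partial>lborel) \<longlonglongrightarrow> (\<integral>x. two_scale l x powr r \<partial>lborel)"
  proof (rule integral_dominated_convergence[OF m m])
    have e: "((sqrt L + 1) * exp (- (pi * (1 / L\<^sup>2) * x\<^sup>2))) powr r = (sqrt L + 1) powr r * exp (- (pi * (r / L\<^sup>2) * x\<^sup>2))" for x
      by (simp add: powr_mult) (simp add: powr_def)
    show "integrable lborel (\<lambda>x. ((sqrt L + 1) * exp (- (pi * (1 / L\<^sup>2) * x\<^sup>2))) powr r)"
      unfolding e using integrable_gaussian[of "r / L\<^sup>2"] r L by simp
    show "AE x in lborel. (\<lambda>n. two_scale (s n) x powr r) \<longlonglongrightarrow> two_scale l x powr r"
      using two_scale_pos[of l] l by (intro AE_I2 tendsto_powr lim tendsto_const) (auto simp: less_imp_neq[symmetric])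
    show "AE x in lborel. norm (two_scale (s n) x powr r) \<le> ((sqrt L + 1) * exp (- (pi * (1 / L\<^sup>2) * x\<^sup>2))) powr r" for n
    proof (rule AE_I2)
      fix x
      have "0 \<le> two_scale (s n) x" using two_scale_pos[of "s n" x] s(1)[of n] by auto
      then show "norm (two_scale (s n) x powr r) \<le> ((sqrt L + 1) * exp (- (pi * (1 / L\<^sup>2) * x\<^sup>2))) powr r"
        using two_scale_le[of "s n" L x] s(1)[of n] r by (auto intro!: powr_mono2)
    qed
  qed
qed

lemma continuous_ctwo_scale: "l > 0 \<Longrightarrow> continuous_on UNIV (ctwo_scale l)"
  unfolding ctwo_scale_eq by (intro continuous_intros continuous_cgauss)

lemma quad_decay_ctwo_scale: "l > 0 \<Longrightarrow> quad_decay (ctwo_scale l)"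
  using schwartz_quad_decay[OF schwartz_ctwo_scale, of l 0] by simp

lemma Lnorm_infinity_ctwo_scale:
  assumes l: "l > 0"
  shows "Lnorm \<infinity> (ctwo_scale l) = sqrt l + 1 / sqrt l"
proof -
  have b: "cmod (ctwo_scale l x) \<le> sqrt l + 1 / sqrt l" for x
  proof -
    have "sqrt l * exp (- (pi * l\<^sup>2 * x\<^sup>2)) + 1 / sqrt l * exp (- (pi * (1 / l\<^sup>2) * x\<^sup>2)) \<le> sqrt l * 1 + 1 / sqrt l * 1"
      using l by (intro add_mono mult_left_mono) auto
    then show ?thesis by (simp add: norm_ctwo_scale[OF l] two_scale_def)
  qed
  have "cmod (ctwo_scale l 0) = sqrt l + 1 / sqrt l" by (simp add: norm_ctwo_scale[OF l] two_scale_def)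
  then show ?thesis
    using Lnorm_infinity_bounds(1)[OF continuous_ctwo_scale[OF l] b] Lnorm_infinity_bounds(2)[OF continuous_ctwo_scale[OF l] b, of 0] by simp
qed

lemma continuous_on_Lnorm_ctwo_scale:
  fixes q :: ereal
  assumes q: "1 < q"
  shows "continuous_on {1..L} (\<lambda>l. Lnorm q (ctwo_scale l))"
proof (cases q)
  case (real r)
  then have r: "r > 1" using q by simp
  have eq: "(\<integral>x. two_scale l x powr r \<partial>lborel) powr (1 / r) = Lnorm q (ctwo_scale l)" and ne: "(\<integral>x. two_scale l x powr r \<partial>lborel) \<noteq> 0" if "l \<in> {1..L}" for l
    using that quad_decay_integral_pos[OF quad_decay_ctwo_scale ctwo_scale_nonzero, of l r] r
    by (auto simp: Lnorm_def real norm_ctwo_scale)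
  have "continuous_on {1..L} (\<lambda>l. (\<integral>x. two_scale l x powr r \<partial>lborel) powr (1 / r))"
    using r ne by (intro continuous_on_powr continuous_on_two_scale_integral continuous_on_const) auto
  then show ?thesis by (rule continuous_on_eq) (use eq in auto)
next
  case PInf
  have "continuous_on {1..L} (\<lambda>l. sqrt l + 1 / sqrt l)" by (intro continuous_intros) auto
  then show ?thesis by (rule continuous_on_eq) (auto simp: PInf Lnorm_infinity_ctwo_scale)
qed (use q in auto)

lemma Lnorm_mono:
  fixes q :: ereal
  assumes q: "1 < q" and g: "quad_decay g" and h: "quad_decay h" and le: "\<And>x. cmod (g x) \<le> cmod (h x)"
  shows "Lnorm q g \<le> Lnorm q h"
proof (cases q)
  case (real r)
  then have r: "r > 1" using q by simp
  have "(\<integral>x. cmod (g x) powr r \<partial>lborel) \<le> (\<integral>x. cmod (h x) powr r \<partial>lborel)"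
    using r by (intro integral_mono quad_decay_powr_integrable g h powr_mono2 le) auto
  then show ?thesis using r
    by (auto simp: Lnorm_def real intro!: powr_mono2 Bochner_Integration.integral_nonneg)
next
  case PInf
  obtain C where C: "\<And>x. cmod (h x) \<le> C" by (rule quad_decay_bounds[OF h]) blast
  have "cmod (g x) \<le> Lnorm \<infinity> h" for x
    using h unfolding quad_decay_def by (intro order_trans[OF le Lnorm_infinity_bounds(2)[OF _ C]]) auto
  then show ?thesis unfolding PInf using g unfolding quad_decay_def by (intro Lnorm_infinity_bounds(1)) auto
qed (use q in auto)

text \<open>The wide summand is positive and is dropped; the narrow one scales exactly. For q > 2
  the exponent 1/2 - 1/q is positive, so the bound is unbounded in l.\<close>

lemma Lnorm_ctwo_scale_ge:
  fixes q :: ereal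
  assumes q: "1 < q" and l: "l > 0"
  shows "gauss_norm q * l powr (1 / 2 - recip q) \<le> Lnorm q (ctwo_scale l)"
proof -
  let ?u = "\<lambda>x. complex_of_real (sqrt l) * cgauss (complex_of_real (l\<^sup>2)) x"
  have "schwartz ?u"
    using schwartz_linear_combination[of "cgauss (complex_of_real (l\<^sup>2))" "cgauss (complex_of_real (l\<^sup>2))" "complex_of_real (sqrt l)" 0] schwartz_cgauss l by simp
  then have qu: "quad_decay ?u" using schwartz_quad_decay[of ?u 0] by simp
  have nu: "cmod (?u x) = sqrt l * exp (- (pi * l\<^sup>2 * x\<^sup>2))" for x
    using l by (simp add: norm_mult norm_cgauss del: of_real_power)
  have "Lnorm q ?u = sqrt l * gauss_norm q * (l\<^sup>2) powr (- recip q / 2)"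
    using qu l unfolding quad_decay_def by (intro Lnorm_gaussian[OF q _ _ _ nu]) auto
  also have "\<dots> = gauss_norm q * (l powr (1 / 2) * l powr (- recip q))"
    using l by (simp add: powr_half_sqrt powr_powr flip: powr_numeral)
  also have "\<dots> = gauss_norm q * l powr (1 / 2 - recip q)" by (simp add: powr_add[symmetric])
  finally have "gauss_norm q * l powr (1 / 2 - recip q) = Lnorm q ?u" by simp
  also have "\<dots> \<le> Lnorm q (ctwo_scale l)"
    by (rule Lnorm_mono[OF q qu quad_decay_ctwo_scale[OF l]])
       (unfold nu norm_ctwo_scale[OF l] two_scale_def, use l in simp)
  finally show ?thesis .
qed

text \<open>A bound independent of l, which keeps the denominator of \<open>Fq\<close> under
  control. The inequality (u + v)^2 <= 2 u^2 + 2 v^2 removes the mixed term; the exact outcome 4 /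
  sqrt 2 is rounded up.\<close>

lemma two_scale_square_integral_le:
  assumes l: "l > 0"
  shows "(\<integral>x. (cmod (ctwo_scale l x))\<^sup>2 \<partial>lborel) \<le> 4"
proof -
  have g: "integrable lborel (\<lambda>x. exp (- (pi * (2 * l\<^sup>2) * x\<^sup>2)))" "integrable lborel (\<lambda>x. exp (- (pi * (2 / l\<^sup>2) * x\<^sup>2)))"
    using l by (intro integrable_gaussian; simp)+
  have e: "(exp (- (pi * a * x\<^sup>2)))\<^sup>2 = exp (- (pi * (2 * a) * x\<^sup>2))" for a x :: real
    by (simp add: power2_eq_square exp_add[symmetric])
  have sq: "(u + v)\<^sup>2 \<le> 2 * u\<^sup>2 + 2 * v\<^sup>2" for u v :: real
    using zero_le_power2[of "u - v"] by (simp add: power2_eq_square algebra_simps)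
  have "(\<integral>x. (cmod (ctwo_scale l x))\<^sup>2 \<partial>lborel) \<le> (\<integral>x. 2 * (l * exp (- (pi * (2 * l\<^sup>2) * x\<^sup>2))) + 2 * (1 / l * exp (- (pi * (2 / l\<^sup>2) * x\<^sup>2))) \<partial>lborel)"
  proof (rule integral_mono)
    show "integrable lborel (\<lambda>x. (cmod (ctwo_scale l x))\<^sup>2)"
      using quad_decay_powr_integrable[OF quad_decay_ctwo_scale[OF l], of 2] by simp
    show "integrable lborel (\<lambda>x. 2 * (l * exp (- (pi * (2 * l\<^sup>2) * x\<^sup>2))) + 2 * (1 / l * exp (- (pi * (2 / l\<^sup>2) * x\<^sup>2))))"
      by (intro Bochner_Integration.integrable_add integrable_mult_right g)
    show "(cmod (ctwo_scale l x))\<^sup>2 \<le> 2 * (l * exp (- (pi * (2 * l\<^sup>2) * x\<^sup>2))) + 2 * (1 / l * exp (- (pi * (2 / l\<^sup>2) * x\<^sup>2)))" for x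
    proof -
      have "(cmod (ctwo_scale l x))\<^sup>2 \<le> 2 * (sqrt l * exp (- (pi * l\<^sup>2 * x\<^sup>2)))\<^sup>2 + 2 * (1 / sqrt l * exp (- (pi * (1 / l\<^sup>2) * x\<^sup>2)))\<^sup>2"
        unfolding norm_ctwo_scale[OF l] two_scale_def by (rule sq)
      then show ?thesis unfolding power_mult_distrib e using l by (simp add: power_divide)
    qed
  qed
  also have "\<dots> = 2 * (l * (1 / sqrt (2 * l\<^sup>2))) + 2 * (1 / l * (1 / sqrt (2 / l\<^sup>2)))"
  proof -
    have "(\<integral>x. exp (- (pi * (2 * l\<^sup>2) * x\<^sup>2)) \<partial>lborel) = 1 / sqrt (2 * l\<^sup>2)" "(\<integral>x. exp (- (pi * (2 / l\<^sup>2) * x\<^sup>2)) \<partial>lborel) = 1 / sqrt (2 / l\<^sup>2)"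
      using l by (intro integral_gaussian; simp)+
    then show ?thesis
      by (subst Bochner_Integration.integral_add) (use g in simp_all)
  qed
  also have "\<dots> = 4 / sqrt 2" using l by (simp add: real_sqrt_mult real_sqrt_divide)
  also have "\<dots> \<le> 4 / 1" by (intro divide_left_mono) auto
  finally show ?thesis by simp
qed

lemma Fq_ctwo_scale:
  assumes "l > 0"
  shows "Fq q (ctwo_scale l) = (Lnorm q (ctwo_scale l))\<^sup>2 / (Lnorm 2 (ctwo_scale l))\<^sup>2"
  unfolding Fq_def fourier_ctwo_scale[OF assms] by (simp add: power2_eq_square)

lemma Fq_large_values:
  fixes q :: ereal
  assumes q: "2 < q" and v: "(gauss_norm q / gauss_norm 2)\<^sup>2 \<le> v"
  obtains f where "schwartz f" "f \<noteq> (\<lambda>x. 0)" "Fq q f = v"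
proof -
  have 2: "(1 :: ereal) < 2" by simp
  have q1: "1 < q" using 2 q by (rule less_trans)
  define K where "K = gauss_norm q"
  have K: "K > 0" using gauss_norm_pos[OF q1] by (simp add: K_def)
  define e where "e = 1 / 2 - recip q"
  have e: "e > 0" using recip_bounds[OF q] by (simp add: e_def)
  \<comment> \<open>Makes \<open>L powr (2 * e)\<close> equal to \<open>m\<close>, so that the lower
    bound K^2 L^(2e) / 4 for \<open>Fq\<close> reaches v. The maximum with 1 ensures L >= 1, as the
    intermediate value theorem on [1, L] requires.\<close>
  define m where "m = max 1 (4 * v / K\<^sup>2)"
  define L where "L = m powr (1 / (2 * e))"
  have L: "L \<ge> 1" using e by (simp add: L_def m_def ge_one_powr_ge_zero)
  \<comment> \<open>At l = 1 both summands coincide, giving twice the standard Gaussian; the factor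
    2 cancels in \<open>Fq\<close>.\<close>
  have F1: "Fq q (ctwo_scale 1) \<le> v"
  proof -
    have g: "cmod (ctwo_scale 1 x) = 2 * exp (- (pi * 1 * x\<^sup>2))" for x
      using norm_ctwo_scale[of 1 x] by (simp add: two_scale_def)
    have "Lnorm r (ctwo_scale 1) = 2 * gauss_norm r" if "1 < r" for r :: ereal
      using Lnorm_gaussian[OF that _ _ continuous_ctwo_scale g] by simp
    then show ?thesis using v q1 2 by (simp only: Fq_ctwo_scale zero_less_one) (simp add: power_divide)
  qed
  have FL: "v \<le> Fq q (ctwo_scale L)"
  proof -
    have "L > 0" using L by simp
    define N where "N = (\<integral>x. (cmod (ctwo_scale L x))\<^sup>2 \<partial>lborel)"
    have N: "0 < N" "N \<le> 4"
      using quad_decay_square_pos[OF quad_decay_ctwo_scale ctwo_scale_nonzero, of L] two_scale_square_integral_le[OF \<open>L > 0\<close>] \<open>L > 0\<close>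
      by (auto simp: N_def)
    have "(Lnorm 2 (ctwo_scale L))\<^sup>2 = N" unfolding Lnorm_2 using N by (simp add: N_def powr_half_sqrt)
    then have "Fq q (ctwo_scale L) = (Lnorm q (ctwo_scale L))\<^sup>2 / N" using Fq_ctwo_scale[OF \<open>L > 0\<close>] by simp
    also have "\<dots> \<ge> (K * L powr e)\<^sup>2 / 4"
      using N K Lnorm_ctwo_scale_ge[OF q1 \<open>L > 0\<close>] by (intro frac_le power_mono) (auto simp: K_def e_def)
    finally have ge: "(K * L powr e)\<^sup>2 / 4 \<le> Fq q (ctwo_scale L)" .
    have "m > 0" by (simp add: m_def)
    have "(L powr e)\<^sup>2 = L powr (2 * e)" by (simp add: power2_eq_square powr_add[symmetric])
    also have "\<dots> = m" using e \<open>m > 0\<close> by (simp add: L_def powr_powr)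
    finally have "(K * L powr e)\<^sup>2 / 4 = K\<^sup>2 * m / 4" by (simp add: power_mult_distrib)
    also have "\<dots> \<ge> K\<^sup>2 * (4 * v / K\<^sup>2) / 4" by (intro divide_right_mono mult_left_mono) (auto simp: m_def)
    finally have "v \<le> (K * L powr e)\<^sup>2 / 4" using K by simp
    then show ?thesis using ge by simp
  qed
  have "continuous_on {1..L} (\<lambda>l. (Lnorm q (ctwo_scale l))\<^sup>2 / (Lnorm 2 (ctwo_scale l))\<^sup>2)"
  proof (intro continuous_on_divide continuous_on_power continuous_on_Lnorm_ctwo_scale q1 2 ballI)
    fix l assume "l \<in> {1..L}"
    then have "0 < (\<integral>x. (cmod (ctwo_scale l x))\<^sup>2 \<partial>lborel)"
      using quad_decay_square_pos[OF quad_decay_ctwo_scale ctwo_scale_nonzero, of l] by auto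
    then show "(Lnorm 2 (ctwo_scale l))\<^sup>2 \<noteq> 0" unfolding Lnorm_2 by simp
  qed
  then have "continuous_on {1..L} (\<lambda>l. Fq q (ctwo_scale l))"
    by (rule continuous_on_eq) (simp add: Fq_ctwo_scale)
  from IVT'[OF F1 FL L this] obtain l where "1 \<le> l" "Fq q (ctwo_scale l) = v" by blast
  then show thesis using that[OF schwartz_ctwo_scale ctwo_scale_nonzero, of l] by simp
qed

theorem theorem4p4:
  shows "(\<forall>p q :: real. 1 < q \<and> q < 2 \<and> 1 / p + 1 / q = 1 \<longrightarrow>
            (\<forall>f. schwartz f \<and> f \<noteq> (\<lambda>x. 0) \<longrightarrow>
               Fq (ereal q) f \<ge> (p powr (1 / p) / q powr (1 / q)) powr (1 / 2)))
       \<and> (\<forall>q :: ereal. 2 < q \<longrightarrow>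
            Fq q ` {f. schwartz f \<and> f \<noteq> (\<lambda>x. 0)} = {0<..})"
proof (intro conjI allI impI)
  fix p q :: real and f
  assume "1 < q \<and> q < 2 \<and> 1 / p + 1 / q = 1" "schwartz f \<and> f \<noteq> (\<lambda>x. 0)"
  then show "(p powr (1 / p) / q powr (1 / q)) powr (1 / 2) \<le> Fq (ereal q) f"
    by (intro Fq_lower_bound) auto
next
  fix q :: ereal assume q: "2 < q"
  show "Fq q ` {f. schwartz f \<and> f \<noteq> (\<lambda>x. 0)} = {0<..}"
  proof (intro equalityI subsetI)
    fix v assume "v \<in> {0 :: real<..}"
    then obtain f where "schwartz f" "f \<noteq> (\<lambda>x. 0)" "Fq q f = v"
      using Fq_small_values[OF q, of v] Fq_large_values[OF q, of v] by (metis greaterThan_iff linear)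
    then show "v \<in> Fq q ` {f. schwartz f \<and> f \<noteq> (\<lambda>x. 0)}" by blast
  qed (use Fq_pos[OF q] in auto)
qed

end
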